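(* Let $n\ge 1$ be a fixed integer. For an integer $H\ge 1$ let $\mathcal{M}_n(\mathbb{Z};H)$ be the set of $n\times n$ matrices $A=(a_{ij})_{i,j=1}^n$ with integer entries satisfying $|a_{ij}|\le H$ for all $i,j$, and let $S_n(H)$ be the number of $A\in\mathcal{M}_n(\mathbb{Z};H)$ whose determinant $\det A$ is square-free (i.e. not divisible by $p^2$ for any prime $p$). Then \[ S_n(H)=2^{n^2}\mathfrak{S}_n H^{n^2}+O\left(H^{n^2-\gamma_n}\right), \] where \[ \mathfrak{S}_n=\prod_{p\ \text{prime}}\ \prod_{j=2}^{n+1}\left(1-p^{-j}\right),\qquad \gamma_n=\frac12+\frac{n-1}{2(n^3+3n^2-n+1)}, \] and the implied constant depends only on $n$. *)

theory Defs
  imports "HOL-Analysis.Analysis" "HOL-Computational_Algebra.Squarefree"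
begin

definition bounded_int_matrices :: "int \<Rightarrow> (int^'n::finite^'n) set" where
  "bounded_int_matrices H = {A. \<forall>i j. \<bar>A $ i $ j\<bar> \<le> H}"

definition sqfree_det_count :: "int \<Rightarrow> ('n::finite) itself \<Rightarrow> nat" where
  "sqfree_det_count H _ = card {A \<in> (bounded_int_matrices H :: (int^'n^'n) set). squarefree (det A)}"

definition singular_series :: "nat \<Rightarrow> real" where
  "singular_series n = (\<Prod>p. if prime p then (\<Prod>j=2..n+1. 1 - 1 / real p ^ j) else 1)"

definition gamma_exp :: "nat \<Rightarrow> real" where
  "gamma_exp n = 1/2 + (real n - 1) / (2 * (real n ^ 3 + 3 * real n ^ 2 - real n + 1))"

end

theory Submission
  imports Defs "HOL-Number_Theory.Cong"
begin

text \<open>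
  Let \<open>n \<ge> 2\<close>. By inclusion-exclusion over the square-free \<open>d\<close> with \<open>d\<^sup>2 dvd det A\<close> one needs the number of matrices in the box
  with \<open>d\<^sup>2 dvd det A\<close>, for \<open>d \<le> D = H powr (1/2 + 1 / (8 * n))\<close> asymptotically and beyond \<open>D\<close> only from above.
  For small \<open>d\<close> the range of one entry at a time is changed from \<open>{-H..H}\<close> to a complete residue system modulo \<open>d\<^sup>2\<close>;
  the determinant is bilinear enough in four entries for exponential sums to bound each change.
  For large \<open>d\<close>, fix all rows but one: the admissible values \<open>x\<close> of that row form a lattice, and as soon as one of them makes
  \<open>det A\<close> non-zero, this lattice has \<open>n\<close> independent vectors inside the box, so its number of points in the box is at most a
  constant times the expected one, however large \<open>d\<close> is. Matrices with \<open>det A = 0\<close> are counted through \<open>D\<^sup>2 dvd det A\<close>.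
  The resulting exponent \<open>1/2 + 1 / (8 * n)\<close>, up to an arbitrarily small loss from divisor functions, exceeds \<open>gamma_exp n\<close>.
  For \<open>n = 1\<close> the classical argument with \<open>D = sqrt H\<close> applies.
\<close>

section \<open>Determinants as functions of the rows\<close>

text \<open>An exponent above 1/2 forces \<open>d\<close> past the square root of \<open>H\<close>,
  where an entry no longer meets every residue class modulo d^2 evenly. The defect is measured by K
  = 1 + d^2 / (2 * H + 1), which enters the error to the power n. For d up to H powr (1/2 + 1 / (8 *
  n)) this costs O(H powr (1/4)), while exchanging one entry gains a full factor H, so the errors
  add up to O(H powr (n^2 - 3/4)); they also carry d powr (-3/2), which makes the sum over
  \<open>d\<close> converge. As \<open>gamma_exp n\<close> is at most 3/4, this is admissible.

  Everything else is of order H^(n^2) / D up to divisor functions: the tail of the Euler product,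
  the matrices with \<open>d\<close> beyond \<open>D\<close>, and the singular matrices. The latter
  are divisible by every d^2, so they are left out of the inversion; their number is then an error
  for each \<open>d\<close> up to \<open>D\<close>, and it is at most about H^(n^2) / D^2.

  The gain of a full factor H rests on a second column and a second row, which supply another
  exponential sum; this is why n = 1 stands apart.\<close>

definition dt :: "('n::finite \<Rightarrow> 'n \<Rightarrow> int) \<Rightarrow> int" where
  "dt A = det (\<chi> i j. A i j)"

definition unit_row :: "'n \<Rightarrow> 'n \<Rightarrow> int" where
  "unit_row j = (\<lambda>k. if k = j then 1 else 0)"

lemma dt_upd_eq: "dt (A(i := u)) = det (\<chi> k. if k = i then vec_lambda u else vec_lambda (A k))"
  unfolding dt_def by (rule arg_cong[where f = det]) (simp add: vec_eq_iff)

text \<open>Laplace expansion along row \<open>i\<close>: replacing that row by a unit vector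
  produces the cofactor, so no matrix of smaller size has to appear.\<close>

lemma dt_row_expand:
  fixes A :: "'n::finite \<Rightarrow> 'n \<Rightarrow> int"
  shows
  "dt (A(i := u)) = (\<Sum>j\<in>UNIV. u j * dt (A(i := unit_row j)))"
proof -
  have "(vec_lambda u :: int^'n) = (\<Sum>j\<in>UNIV. u j *s vec_lambda (unit_row j))"
    by (simp add: vec_eq_iff unit_row_def if_distrib cong: if_cong)
  then have "dt (A(i := u)) = det (\<chi> k. if k = i then (\<Sum>j\<in>UNIV. u j *s vec_lambda (unit_row j)) else vec_lambda (A k))"
    unfolding dt_upd_eq by (simp only:)
  also have "\<dots> = (\<Sum>j\<in>UNIV. det (\<chi> k. if k = i then u j *s vec_lambda (unit_row j) else vec_lambda (A k)))"
    by (rule det_linear_row_sum) simp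
  also have "\<dots> = (\<Sum>j\<in>UNIV. u j * dt (A(i := unit_row j)))"
    unfolding dt_upd_eq by (simp only: det_row_mul)
  finally show ?thesis .
qed

text \<open>The cofactor is the slope in one entry; this reduces each averaging step over an entry
  to a linear congruence in one unknown.\<close>

lemma dt_row_affine:
  "dt (A(i := u(j := b))) = dt (A(i := unit_row j)) * b + dt (A(i := u(j := 0)))"
proof -
  have "dt (A(i := u(j := b))) = b * dt (A(i := unit_row j)) + (\<Sum>k\<in>UNIV - {j}. u k * dt (A(i := unit_row k)))" for b
    by (subst dt_row_expand, subst sum.remove[of _ j]) auto
  from this[of b] this[of 0] show ?thesis by simp
qed

lemma dt_same_rows: "i \<noteq> k \<Longrightarrow> A i = A k \<Longrightarrow> dt A = 0"
  unfolding dt_def by (rule det_identical_rows[of i k]) (auto simp: row_def vec_eq_iff)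

lemma dt_row_sub_sum:
  assumes "i \<notin> R"
  shows "dt (A(i := (\<lambda>j. u j + (\<Sum>k\<in>R. c k * A k j)))) = dt (A(i := u))"
proof -
  have "(\<Sum>j\<in>UNIV. (\<Sum>k\<in>R. c k * A k j) * dt (A(i := unit_row j))) = (\<Sum>k\<in>R. c k * dt (A(i := A k)))"
    by (subst (2) dt_row_expand) (simp add: sum_distrib_right sum_distrib_left mult.assoc sum.swap[of _ UNIV])
  also have "\<dots> = 0"
  proof (rule sum.neutral, clarify)
    fix k assume "k \<in> R"
    with assms have "dt (A(i := A k)) = 0" by (intro dt_same_rows[of i k]) auto
    then show "c k * dt (A(i := A k)) = 0" by simp
  qed
  finally show ?thesis
    by (subst (1 2) dt_row_expand) (simp add: distrib_right sum.distrib)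
qed

lemma dt_row_scale: "dt (A(i := (\<lambda>j. c * u j))) = c * dt (A(i := u))"
  by (subst (1 2) dt_row_expand) (simp add: sum_distrib_left mult.assoc)

lemma dt_cong:
  assumes "\<And>i j. [A i j = B i j] (mod m)"
  shows "[dt A = dt B] (mod m)"
  unfolding dt_def det_def by (intro cong_sum cong_mult cong_prod cong_refl) (simp add: assms)

text \<open>A permutation matrix; it ends the inductions in which all rows get replaced by unit
  vectors.\<close>

lemma dt_unit_rows_bij:
  assumes "bij s" shows "\<bar>dt (\<lambda>i. unit_row (s i))\<bar> = 1"
proof -
  have "s permutes UNIV" using assms by (intro bij_imp_permutes) auto
  then have "det (\<chi> i. (mat 1 :: int^'a^'a) $ s i) = of_int (sign s) * det (mat 1 :: int^'a^'a)"
    by (rule det_permute_rows)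
  moreover have "(\<chi> i. (mat 1 :: int^'a^'a) $ s i) = (\<chi> i j. unit_row (s i) j)"
    by (auto simp: vec_eq_iff mat_def unit_row_def)
  ultimately show ?thesis unfolding dt_def by (auto simp: sign_def)
qed

lemma dt_unit_rows_not_bij:
  fixes s :: "'n::finite \<Rightarrow> 'n"
  assumes "\<not> bij s" shows "dt (\<lambda>i. unit_row (s i)) = 0"
proof -
  have "\<not> inj s" using assms by (simp add: finite_UNIV_inj_surj bij_def)
  then obtain i k where "i \<noteq> k" "s i = s k" unfolding inj_def by blast
  then show ?thesis by (intro dt_same_rows[of i k]) auto
qed

lemma dt_mult: "dt (\<lambda>i j. \<Sum>k\<in>UNIV. A i k * B k j) = dt A * dt B"
  unfolding dt_def det_mul[symmetric] by (simp add: matrix_matrix_mult_def)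

section \<open>Averages over boxes of matrices\<close>

abbreviation upd :: "('a \<Rightarrow> 'b \<Rightarrow> 'c) \<Rightarrow> 'a \<Rightarrow> 'b \<Rightarrow> 'c \<Rightarrow> 'a \<Rightarrow> 'b \<Rightarrow> 'c" where
  "upd A i j b \<equiv> A(i := (A i)(j := b))"

definition mats :: "('n \<Rightarrow> 'n \<Rightarrow> int set) \<Rightarrow> ('n \<Rightarrow> 'n \<Rightarrow> int) set" where
  "mats W = {A. \<forall>i j. A i j \<in> W i j}"

definition tau :: "nat \<Rightarrow> nat" where "tau m = card {d. d dvd m}"

text \<open>Near-equidistribution of one entry: \<open>gcd e u / e\<close> is the largest proportion
  of solutions in a complete residue system, and \<open>K\<close> is the admissible excess. It is
  imposed for all divisors \<open>e\<close> of \<open>m\<close> because averages of gcds are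
  expanded over divisors.\<close>

definition spread :: "int set \<Rightarrow> real \<Rightarrow> nat \<Rightarrow> bool" where
  "spread W K m \<longleftrightarrow> finite W \<and> (\<forall>e u v. e dvd m \<longrightarrow>
     real (card {b \<in> W. int e dvd u * b + v}) * real e \<le> K * real_of_int (gcd (int e) u) * real (card W))"

text \<open>Replacing rows by unit vectors turns the determinant into a minor up to sign, so that minors of all sizes can be treated without changing the index type.\<close>
definition unit_rows :: "'n set \<Rightarrow> ('n \<Rightarrow> 'n) \<Rightarrow> ('n \<Rightarrow> 'n \<Rightarrow> int) \<Rightarrow> 'n \<Rightarrow> 'n \<Rightarrow> int" where
  "unit_rows R s A = (\<lambda>i. if i \<in> R then unit_row (s i) else A i)"

section \<open>Boxes of matrices and resampling of one entry\<close>

lemma mats_PiE: "mats W = PiE UNIV (\<lambda>i. PiE UNIV (W i))"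
  by (auto simp: mats_def PiE_iff)

lemma finite_mats:
  fixes W :: "'n::finite \<Rightarrow> 'n \<Rightarrow> int set"
  assumes "\<And>i j. finite (W i j)" shows "finite (mats W)"
  unfolding mats_PiE by (intro finite_PiE assms) auto

lemma card_mats:
  fixes W :: "'n::finite \<Rightarrow> 'n \<Rightarrow> int set"
  shows "card (mats W) = (\<Prod>i\<in>UNIV. \<Prod>j\<in>UNIV. card (W i j))"
  unfolding mats_PiE by (simp add: card_PiE)

lemma mem_mats_upd:
  "A \<in> mats (upd W i j V) \<longleftrightarrow> A i j \<in> V \<and> (\<forall>k l. k \<noteq> i \<or> l \<noteq> j \<longrightarrow> A k l \<in> W k l)"
  by (auto simp: mats_def)

text \<open>Exchanging the old entry with the fresh value is a map on pairs that is its own inverse.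
  Stated without division, the identity also covers empty ranges; \<open>V\<close> may differ from
  \<open>W i j\<close>, so that two boxes can be compared.\<close>

lemma resample_range:
  fixes W :: "'n::finite \<Rightarrow> 'n \<Rightarrow> int set" and g :: "_ \<Rightarrow> real"
  shows "real (card (W i j)) * (\<Sum>A\<in>mats (upd W i j V). g A) = (\<Sum>A\<in>mats W. \<Sum>b\<in>V. g (upd A i j b))"
proof -
  let ?h = "\<lambda>(A, b). (upd A i j b, A i j)"
  have "(\<Sum>A\<in>mats W. \<Sum>b\<in>V. g (upd A i j b)) = (\<Sum>(A, b)\<in>mats W \<times> V. g (upd A i j b))"
    by (rule sum.cartesian_product)
  also have "\<dots> = (\<Sum>(A, b)\<in>mats (upd W i j V) \<times> W i j. g A)"
    by (rule sum.reindex_bij_witness[of _ ?h ?h]) (auto simp: mem_mats_upd, auto simp: mats_def)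
  also have "\<dots> = (\<Sum>A\<in>mats (upd W i j V). \<Sum>b\<in>W i j. g A)"
    by (rule sum.cartesian_product[symmetric])
  finally show ?thesis by (simp add: sum_distrib_left)
qed

lemma resample:
  fixes W :: "'n::finite \<Rightarrow> 'n \<Rightarrow> int set" and g :: "_ \<Rightarrow> real"
  shows "real (card (W i j)) * (\<Sum>A\<in>mats W. g A) = (\<Sum>A\<in>mats W. \<Sum>b\<in>W i j. g (upd A i j b))"
  using resample_range[of W i j g "W i j"] by simp

lemma resample_le:
  fixes W :: "'n::finite \<Rightarrow> 'n \<Rightarrow> int set" and g h :: "_ \<Rightarrow> real"
  assumes "finite (W i j)"
    and le: "\<And>A. A \<in> mats W \<Longrightarrow> (\<Sum>b\<in>W i j. g (upd A i j b)) \<le> real (card (W i j)) * h A"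
  shows "(\<Sum>A\<in>mats W. g A) \<le> (\<Sum>A\<in>mats W. h A)"
proof (cases "mats W = {}")
  case False
  then have "W i j \<noteq> {}" by (auto simp: mats_def)
  then have pos: "real (card (W i j)) > 0" using assms(1) by (simp add: card_gt_0_iff)
  have "real (card (W i j)) * (\<Sum>A\<in>mats W. g A) \<le> real (card (W i j)) * (\<Sum>A\<in>mats W. h A)"
    unfolding resample sum_distrib_left[of _ h] by (intro sum_mono le)
  then show ?thesis using pos by simp
qed auto

lemma sum_of_bool_card: "finite A \<Longrightarrow> (\<Sum>x\<in>A. of_bool (P x) :: real) = real (card {x \<in> A. P x})"
  by (simp add: of_bool_def sum.If_cases Int_def)

section \<open>Averages of gcds with minors, and determinants divisible by a given modulus\<close>

lemma finite_divisors: "m > 0 \<Longrightarrow> finite {d::nat. d dvd m}"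
  by (simp add: finite_divisors_nat)

lemma tau_ge_1: "m > 0 \<Longrightarrow> tau m \<ge> 1"
proof -
  assume m: "m > 0"
  have "card {1::nat} \<le> card {d. d dvd m}" using finite_divisors[OF m] by (intro card_mono) auto
  then show "tau m \<ge> 1" by (simp add: tau_def)
qed

text \<open>The gcd is itself one of the divisors in the sum. An average of gcds thus becomes a sum
  of divisibility counts, at the price of a factor \<open>tau m\<close>.\<close>

lemma gcd_le_sum_divisors:
  assumes "m > 0"
  shows "real_of_int (gcd (int m) x) \<le> (\<Sum>e | e dvd m. real e * of_bool (int e dvd x))"
proof -
  let ?e = "nat (gcd (int m) x)"
  have e: "int ?e = gcd (int m) x" by simp
  have "?e dvd m" by (metis e gcd_dvd1 int_dvd_int_iff)
  have "int ?e dvd x" unfolding e by simp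
  have "real_of_int (gcd (int m) x) = real ?e * of_bool (int ?e dvd x)" using \<open>int ?e dvd x\<close> by simp
  also have "\<dots> \<le> (\<Sum>e | e dvd m. real e * of_bool (int e dvd x))"
    using \<open>?e dvd m\<close> assms by (intro member_le_sum) (auto simp: finite_divisors)
  finally show ?thesis .
qed

lemma gcd_le_mono: "(e::nat) dvd m \<Longrightarrow> m > 0 \<Longrightarrow> gcd (int e) u \<le> gcd (int m) u"
  by (intro zdvd_imp_le gcd_mono) (auto simp: gcd_pos_int)

lemma spreadD: "spread W K m \<Longrightarrow> e dvd m \<Longrightarrow>
    real (card {b \<in> W. int e dvd u * b + v}) * real e \<le> K * real_of_int (gcd (int e) u) * real (card W)"
  by (simp add: spread_def)

lemma spread_sum_gcd:
  assumes "spread W K m" "m > 0" "K \<ge> 0"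
  shows "(\<Sum>b\<in>W. real_of_int (gcd (int m) (u * b + v))) \<le> real (card W) * (K * tau m * real_of_int (gcd (int m) u))"
proof -
  have fin: "finite W" using assms by (simp add: spread_def)
  have "(\<Sum>b\<in>W. real_of_int (gcd (int m) (u * b + v)))
      \<le> (\<Sum>b\<in>W. \<Sum>e | e dvd m. real e * of_bool (int e dvd u * b + v))"
    by (intro sum_mono gcd_le_sum_divisors assms)
  also have "\<dots> = (\<Sum>e | e dvd m. real (card {b \<in> W. int e dvd u * b + v}) * real e)"
    by (subst sum.swap) (simp add: sum_distrib_left[symmetric] Int_def fin mult.commute)
  also have "\<dots> \<le> (\<Sum>e | e dvd m. K * real_of_int (gcd (int m) u) * real (card W))"
  proof (intro sum_mono)
    fix e assume "e \<in> {e. e dvd m}"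
    then have "real (card {b \<in> W. int e dvd u * b + v}) * real e \<le> K * real_of_int (gcd (int e) u) * real (card W)"
      using assms(1) by (simp add: spread_def)
    also have "\<dots> \<le> K * real_of_int (gcd (int m) u) * real (card W)"
      using gcd_le_mono[of e m u] \<open>e \<in> _\<close> assms by (intro mult_mono) auto
    finally show "real (card {b \<in> W. int e dvd u * b + v}) * real e \<le> \<dots>" .
  qed
  also have "\<dots> = real (card W) * (K * tau m * real_of_int (gcd (int m) u))"
    by (simp add: tau_def)
  finally show ?thesis .
qed

lemma unit_rows_upd:
  "i \<notin> R \<Longrightarrow> unit_rows R s (upd A i j b) = (unit_rows R s A)(i := (A i)(j := b))"
  by (auto simp: unit_rows_def)

lemma unit_rows_insert:
  "(unit_rows R s A)(i := unit_row j) = unit_rows (insert i R) (s(i := j)) A"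
  by (auto simp: unit_rows_def)

lemma unit_rows_affine:
  fixes A :: "'n::finite \<Rightarrow> 'n \<Rightarrow> int"
  assumes "i \<notin> R"
  obtains v where "\<And>b. dt (unit_rows R s (upd A i (s i) b)) = dt (unit_rows (insert i R) s A) * b + v"
proof (rule that)
  fix b
  show "dt (unit_rows R s (upd A i (s i) b))
      = dt (unit_rows (insert i R) s A) * b + dt ((unit_rows R s A)(i := (A i)(s i := 0)))"
    unfolding unit_rows_upd[OF assms] dt_row_affine[of _ i _ "s i" b] unit_rows_insert by simp
qed

text \<open>Induction on the rows \<open>T\<close> not replaced by unit vectors. Resampling the
  entry \<open>(i, s i)\<close> makes the minor affine with the next smaller minor as slope, so each
  row costs one factor \<open>K * tau m\<close>; once every row is a unit vector the minor is 1 up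
  to sign.\<close>

lemma sum_gcd_unit_rows:
  fixes W :: "'n::finite \<Rightarrow> 'n \<Rightarrow> int set"
  assumes spread: "\<And>i j. spread (W i j) K m" and m: "m > 0" and K: "K \<ge> 0" and s: "bij s"
  shows "(\<Sum>A\<in>mats W. real_of_int (gcd (int m) (dt (unit_rows (- T) s A))))
      \<le> (K * tau m) ^ card T * real (card (mats W))"
  using finite[of T]
proof (induction T rule: finite_induct)
  case empty
  have "gcd (int m) (dt (unit_rows (- {}) s A)) = 1" for A
    using dt_unit_rows_bij[OF s] by (simp add: unit_rows_def abs_if split: if_splits)
  then show ?case by simp
next
  case (insert i T)
  have R: "i \<notin> - insert i T" and ins: "insert i (- insert i T) = - T" using insert by auto
  have "(\<Sum>A\<in>mats W. real_of_int (gcd (int m) (dt (unit_rows (- insert i T) s A))))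
     \<le> (\<Sum>A\<in>mats W. K * tau m * real_of_int (gcd (int m) (dt (unit_rows (- T) s A))))"
  proof (rule resample_le[where i = i and j = "s i"])
    show "finite (W i (s i))" using spread by (simp add: spread_def)
    show "(\<Sum>b\<in>W i (s i). real_of_int (gcd (int m) (dt (unit_rows (- insert i T) s (upd A i (s i) b)))))
         \<le> real (card (W i (s i))) * (K * tau m * real_of_int (gcd (int m) (dt (unit_rows (- T) s A))))" for A
    proof -
      obtain v where v: "\<And>b. dt (unit_rows (- insert i T) s (upd A i (s i) b)) = dt (unit_rows (- T) s A) * b + v"
        using unit_rows_affine[OF R, of s A] unfolding ins by metis
      show ?thesis unfolding v by (rule spread_sum_gcd[OF spread m K])
    qed
  qed
  also have "\<dots> \<le> K * tau m * ((K * tau m) ^ card T * real (card (mats W)))"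
    unfolding sum_distrib_left[symmetric] using K by (intro mult_left_mono insert.IH) auto
  finally show ?case using insert by (simp add: mult_ac)
qed

text \<open>The first entry is averaged by the congruence bound itself, which costs \<open>K\<close>
  and no \<open>tau m\<close>; its slope is a minor with n - 1 free rows, whose gcd with
  \<open>m\<close> is averaged by \<open>sum_gcd_unit_rows\<close>.\<close>

lemma count_dvd_dt:
  fixes W :: "'n::finite \<Rightarrow> 'n \<Rightarrow> int set"
  assumes spread: "\<And>i j. spread (W i j) K m" and m: "m > 0" and K: "K \<ge> 0"
  shows "real (card {A \<in> mats W. int m dvd dt A}) * real m \<le> K * (K * tau m) ^ (CARD('n) - 1) * real (card (mats W))"
proof -
  fix i :: 'n
  have fin: "finite (mats W)" using spread by (intro finite_mats) (auto simp: spread_def)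
  have R: "unit_rows {} id A = A" for A :: "'n \<Rightarrow> 'n \<Rightarrow> int" by (simp add: unit_rows_def)
  have "real (card {A \<in> mats W. int m dvd dt A}) * real m = (\<Sum>A\<in>mats W. of_bool (int m dvd dt A) * real m)"
    by (simp add: Int_def fin flip: sum_distrib_right)
  also have "\<dots> \<le> (\<Sum>A\<in>mats W. K * real_of_int (gcd (int m) (dt (unit_rows {i} id A))))"
  proof (rule resample_le[where i = i and j = i])
    show f: "finite (W i i)" using spread by (simp add: spread_def)
    show "(\<Sum>b\<in>W i i. of_bool (int m dvd dt (upd A i i b)) * real m)
         \<le> real (card (W i i)) * (K * real_of_int (gcd (int m) (dt (unit_rows {i} id A))))" for A
    proof -
      obtain v where v: "\<And>b. dt (upd A i i b) = dt (unit_rows {i} id A) * b + v"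
        using unit_rows_affine[of i "{}" id A] unfolding R id_apply by blast
      let ?u = "dt (unit_rows {i} id A)"
      have "real (card {b \<in> W i i. int m dvd ?u * b + v}) * real m \<le> K * real_of_int (gcd (int m) ?u) * real (card (W i i))"
        by (rule spreadD[OF spread dvd_refl])
      then show ?thesis
        unfolding v sum_distrib_right[symmetric] sum_of_bool_card[OF f] by (simp add: mult_ac)
    qed
  qed
  also have "\<dots> \<le> K * ((K * tau m) ^ card (UNIV - {i}) * real (card (mats W)))"
    using sum_gcd_unit_rows[OF spread m K bij_id, of "UNIV - {i}"] K
    unfolding sum_distrib_left[symmetric] by (intro mult_left_mono) (auto simp: Compl_eq_Diff_UNIV double_diff)
  finally show ?thesis by (simp add: mult_ac)
qed

section \<open>Exponential sums over an interval\<close>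

definition expsum :: "int set \<Rightarrow> real \<Rightarrow> complex" where
  "expsum W t = (\<Sum>x\<in>W. cis (2 * pi * t * real_of_int x))"

definition norm_avg :: "int set \<Rightarrow> real \<Rightarrow> real" where
  "norm_avg W t = norm (expsum W t) / real (card W)"

section \<open>Orthogonality and periodicity\<close>

lemma cis_2pi_eq_1_iff: "cis (2 * pi * t) = 1 \<longleftrightarrow> t \<in> \<int>"
proof
  assume "cis (2 * pi * t) = 1"
  then have "cos (2 * pi * t) = 1" by (simp add: complex_eq_iff)
  then obtain n :: int where "2 * pi * t = n * 2 * pi" by (auto simp: cos_one_2pi_int)
  then show "t \<in> \<int>" by simp
qed simp

lemma of_int_divide_in_Ints_iff_dvd: "m > 0 \<Longrightarrow> real_of_int k / real m \<in> \<int> \<longleftrightarrow> int m dvd k"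
proof
  assume m: "m > 0" and "real_of_int k / real m \<in> \<int>"
  then obtain z where "real_of_int k / real m = of_int z" by (auto elim: Ints_cases)
  then have "real_of_int k = real_of_int (z * int m)" using m by (simp add: field_simps)
  then show "int m dvd k" by (simp only: of_int_eq_iff) simp
next
  assume "m > 0" "int m dvd k"
  then show "real_of_int k / real m \<in> \<int>" by (auto elim!: dvdE)
qed

lemma cis_orthogonality:
  assumes m: "m > 0"
  shows "(\<Sum>h<m. cis (2 * pi * (real h * real_of_int k / real m))) = (if int m dvd k then of_nat m else 0)"
proof -
  let ?z = "cis (2 * pi * (real_of_int k / real m))"
  have pow: "cis (2 * pi * (real h * real_of_int k / real m)) = ?z ^ h" for h
    by (subst Complex.DeMoivre) (simp add: mult_ac)
  have z1: "?z = 1 \<longleftrightarrow> int m dvd k"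
    unfolding cis_2pi_eq_1_iff by (rule of_int_divide_in_Ints_iff_dvd[OF m])
  have zm: "?z ^ m = 1"
    using m by (simp add: Complex.DeMoivre)
  show ?thesis
  proof (cases "int m dvd k")
    case False
    then have "?z \<noteq> 1" using z1 by simp
    then show ?thesis using False zm unfolding pow geometric_sum[OF \<open>?z \<noteq> 1\<close>] by (simp del: cis_multiple_2pi)
  next
    case True
    then have "?z = 1" using z1 by simp
    then show ?thesis unfolding pow using True by (simp only: power_one) simp
  qed
qed

lemma expsum_add_int:
  assumes "n \<in> \<int>" shows "expsum W (t + n) = expsum W t"
proof -
  have "cis (2 * pi * (t + n) * real_of_int x) = cis (2 * pi * t * real_of_int x)" for x
  proof -
    have "cis (2 * pi * (n * real_of_int x)) = 1" using assms by (intro cis_multiple_2pi) auto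
    moreover have "cis (2 * pi * (t + n) * real_of_int x) = cis (2 * pi * t * real_of_int x) * cis (2 * pi * (n * real_of_int x))"
      by (simp add: cis_mult algebra_simps)
    ultimately show ?thesis by simp
  qed
  then show ?thesis by (simp add: expsum_def)
qed

lemma navg_mod:
  assumes "m > 0" shows "norm_avg W (real_of_int k / real m) = norm_avg W (real_of_int (k mod int m) / real m)"
proof -
  have "real_of_int k / real m = real_of_int (k mod int m) / real m + real_of_int (k div int m)"
  proof -
    have "real_of_int k = real_of_int (k mod int m + k div int m * int m)" by simp
    also have "\<dots> = real_of_int (k mod int m) + real_of_int (k div int m) * real m"
      by (simp only: of_int_add of_int_mult of_int_of_nat_eq)
    finally show ?thesis using assms by (simp add: field_simps)
  qed
  then show ?thesis unfolding norm_avg_def by (simp add: expsum_add_int)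
qed

lemma navg_nonneg: "norm_avg W t \<ge> 0"
  by (simp add: norm_avg_def)

lemma navg_le_1: "norm_avg W t \<le> 1"
proof -
  have "norm (expsum W t) \<le> (\<Sum>x\<in>W. norm (cis (2 * pi * t * real_of_int x)))"
    unfolding expsum_def by (rule norm_sum)
  then show ?thesis by (cases "card W = 0") (simp_all add: norm_avg_def divide_le_eq_1)
qed

lemma expsum_int: "n \<in> \<int> \<Longrightarrow> expsum W n = of_nat (card W)"
  using expsum_add_int[of n W 0] by (simp add: expsum_def)

lemma expsum_residues:
  assumes "m > 0"
  shows "expsum {0..<int m} (real_of_int k / real m) = (if int m dvd k then of_nat m else 0)"
proof -
  have "expsum {0..<int m} (real_of_int k / real m) = (\<Sum>h<m. cis (2 * pi * (real h * real_of_int k / real m)))"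
    unfolding expsum_def by (rule sum.reindex_bij_witness[of _ int nat]) (auto simp: mult_ac)
  then show ?thesis using cis_orthogonality[OF assms] by simp
qed

section \<open>Bounds for a symmetric interval\<close>

lemma sin_ge_linear:
  assumes "0 \<le> t" "t \<le> 1/2" shows "sin (pi * t) \<ge> 2 * t"
proof -
  have "convex_on {0..pi/2} (\<lambda>x. - sin x)"
  proof (rule f''_ge0_imp_convex)
    show "((\<lambda>x. - sin x) has_real_derivative - cos x) (at x)" for x :: real
      by (auto intro!: derivative_eq_intros)
    show "((\<lambda>x. - cos x) has_real_derivative sin x) (at x)" for x :: real
      by (auto intro!: derivative_eq_intros)
    show "x \<in> {0..pi/2} \<Longrightarrow> 0 \<le> sin x" for x :: real
      by (auto intro!: sin_ge_zero)
  qed auto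
  then have "- sin ((1 - 2 * t) *\<^sub>R 0 + (2 * t) *\<^sub>R (pi/2)) \<le> (1 - 2 * t) * - sin 0 + (2 * t) * - sin (pi/2)"
    by (rule convex_onD) (use assms in auto)
  then show ?thesis by (simp add: mult.commute)
qed

text \<open>Geometric sum and Jordan's inequality. The two reciprocals replace the distance from r /
  q to the nearest integer, so that summing over \<open>r\<close> gives two harmonic sums.\<close>

lemma norm_expsum_interval_le:
  assumes "0 < r" "r < q" "H \<ge> 0"
  shows "norm (expsum {-H..H} (real r / real q)) \<le> real q / 2 * (1 / real r + 1 / real (q - r))"
proof -
  define t where "t = real r / real q"
  define z where "z = cis (2 * pi * t)"
  have t: "0 < t" "t < 1" using assms by (auto simp: t_def)
  have powi: "cis (2 * pi * t * real_of_int x) = z powi x" for x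
    unfolding z_def by (simp add: cis_power_int mult_ac)
  have "z \<noteq> 0" by (simp add: z_def)
  \<comment> \<open>The induction adds one term at each end of the symmetric interval.\<close>
  have tele: "(z - 1) * (\<Sum>x\<in>{-int n..int n}. z powi x) = z powi (int n + 1) - z powi (- int n)" for n
  proof (induction n)
    case 0
    then show ?case by simp
  next
    case (Suc n)
    have "{-int (Suc n)..int (Suc n)} = insert (- int n - 1) (insert (int n + 1) {-int n..int n})" by auto
    then have "(z - 1) * (\<Sum>x\<in>{-int (Suc n)..int (Suc n)}. z powi x)
       = (z - 1) * z powi (- int n - 1) + (z - 1) * z powi (int n + 1) + (z powi (int n + 1) - z powi (- int n))"
      by (simp only:) (simp add: distrib_left Suc.IH)
    also have "\<dots> = z powi (int n + 1 + 1) - z powi (- int n - 1)"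
    proof -
      have p: "z powi (int n + 1 + 1) = z powi (int n + 1) * z" "z powi (- int n) = z powi (- int n - 1) * z"
        using \<open>z \<noteq> 0\<close> power_int_add_1[of z "int n + 1"] power_int_add_1[of z "- int n - 1"] by simp_all
      show ?thesis unfolding p by algebra
    qed
    moreover have "- int (Suc n) = - int n - 1" "int (Suc n) + 1 = int n + 1 + 1" by simp_all
    ultimately show ?case by (simp only:)
  qed
  have "norm ((z - 1) * expsum {-H..H} t) \<le> 2"
  proof -
    have "(z - 1) * expsum {-H..H} t = z powi (H + 1) - z powi (- H)"
      using tele[of "nat H"] assms by (simp add: expsum_def powi)
    moreover have "norm (z powi (H + 1)) = 1" "norm (z powi (- H)) = 1"
      by (simp_all add: norm_power_int z_def)
    ultimately show ?thesis using norm_triangle_ineq4[of "z powi (H + 1)" "z powi (- H)"] by simp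
  qed
  moreover have "norm (z - 1) = 2 * \<bar>sin (pi * t)\<bar>"
    using dist_exp_i_1[of "2 * pi * t"] by (simp add: z_def cis_conv_exp)
  moreover have "sin (pi * t) > 0" using t by (intro sin_gt_zero) auto
  ultimately have S: "norm (expsum {-H..H} t) \<le> 1 / sin (pi * t)"
    by (simp add: norm_mult pos_le_divide_eq mult.commute)
  also have "\<dots> \<le> 1 / (2 * t) + 1 / (2 * (1 - t))"
  proof (cases "t \<le> 1/2")
    case True
    then have "1 / sin (pi * t) \<le> 1 / (2 * t)" using sin_ge_linear[of t] t by (intro divide_left_mono) auto
    then show ?thesis using t by (smt (verit) divide_nonneg_nonneg)
  next
    case False
    have "sin (pi * (1 - t)) = sin (pi * t)" by (simp add: algebra_simps sin_diff)
    then have "1 / sin (pi * t) \<le> 1 / (2 * (1 - t))" using sin_ge_linear[of "1 - t"] t False by (intro divide_left_mono) auto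
    then show ?thesis using t by (smt (verit) divide_nonneg_nonneg)
  qed
  also have "\<dots> = real q / 2 * (1 / real r + 1 / real (q - r))"
    using assms by (simp add: t_def field_simps of_nat_diff)
  finally show ?thesis unfolding t_def .
qed

lemma harm_le_ln: "n > 0 \<Longrightarrow> harm n \<le> (1 :: real) + ln (real n)"
proof (induction n rule: nat_induct_non_zero)
  case 1
  then show ?case by (simp add: harm_expand)
next
  case (Suc n)
  have "ln (real n / real (Suc n)) \<le> real n / real (Suc n) - 1" using Suc by (intro ln_le_minus_one) auto
  also have "real n / real (Suc n) - 1 = - inverse (real (Suc n))" by (simp add: field_simps)
  finally have "inverse (real (Suc n)) \<le> ln (real (Suc n)) - ln (real n)" using Suc by (simp add: ln_div)
  then show ?case using Suc by (simp add: harm_Suc)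
qed

lemma sum_navg_interval:
  assumes "q > 0" "H \<ge> 0"
  shows "(\<Sum>r\<in>{1..<q}. norm_avg {-H..H} (real r / real q)) \<le> real q * (1 + ln (real q)) / real_of_int (2 * H + 1)"
proof -
  have c: "real (card {-H..H}) = real_of_int (2 * H + 1)" using assms by simp
  have "(\<Sum>r\<in>{1..<q}. norm (expsum {-H..H} (real r / real q)))
      \<le> (\<Sum>r\<in>{1..<q}. real q / 2 * (1 / real r + 1 / real (q - r)))"
    using assms by (intro sum_mono norm_expsum_interval_le) auto
  also have "\<dots> = real q / 2 * ((\<Sum>r\<in>{1..<q}. 1 / real r) + (\<Sum>r\<in>{1..<q}. 1 / real (q - r)))"
    by (simp only: sum_distrib_left[symmetric] sum.distrib)
  also have "(\<Sum>r\<in>{1..<q}. 1 / real (q - r)) = (\<Sum>r\<in>{1..<q}. 1 / real r)"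
    by (rule sum.reindex_bij_witness[of _ "\<lambda>r. q - r" "\<lambda>r. q - r"]) auto
  also have "(\<Sum>r\<in>{1..<q}. 1 / real r) \<le> 1 + ln (real q)"
  proof -
    have "(\<Sum>r\<in>{1..<q}. 1 / real r) \<le> (\<Sum>r\<in>{1..q}. 1 / real r)" by (intro sum_mono2) auto
    also have "\<dots> = harm q" by (simp add: harm_def inverse_eq_divide)
    finally show ?thesis using harm_le_ln[of q] assms by simp
  qed
  finally have "(\<Sum>r\<in>{1..<q}. norm (expsum {-H..H} (real r / real q))) \<le> real q * (1 + ln (real q))"
    using assms by (simp add: field_simps)
  then show ?thesis
    unfolding norm_avg_def c sum_divide_distrib[symmetric] using assms by (intro divide_right_mono) auto
qed

lemma sum_periodic:
  fixes f :: "nat \<Rightarrow> real"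
  shows "(\<Sum>h<g * q. f (h mod q)) = real g * (\<Sum>h<q. f h)"
proof -
  have "(\<Sum>h<g * q. f (h mod q)) = (\<Sum>m<g. \<Sum>h\<in>{m * q..<m * q + q}. f (h mod q))"
    by (rule sum.nat_group[symmetric])
  also have "\<dots> = (\<Sum>m<g. \<Sum>h<q. f h)"
  proof (rule sum.cong[OF refl])
    fix m
    show "(\<Sum>h\<in>{m * q..<m * q + q}. f (h mod q)) = (\<Sum>h<q. f h)"
      by (rule sum.reindex_bij_witness[of _ "\<lambda>h. h + m * q" "\<lambda>h. h - m * q"]) (auto simp: le_iff_add)
  qed
  finally show ?thesis by simp
qed

text \<open>Multiplication by \<open>C\<close> permutes the non-zero residues modulo
  \<open>q\<close>, which reduces the sum to \<open>sum_navg_interval\<close>.\<close>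

lemma sum_navg_multiples_coprime:
  assumes q: "q > 0" and H: "H \<ge> 0" and cop: "coprime C (int q)"
  shows "(\<Sum>h<q. if int q dvd int h * C then 0 else norm_avg {-H..H} (real h * real_of_int C / real q))
     \<le> real q * (1 + ln (real q)) / real_of_int (2 * H + 1)"
proof -
  let ?\<phi> = "\<lambda>h. nat ((int h * C) mod int q)"
  have dvd_iff: "int q dvd int h * C \<longleftrightarrow> q dvd h" for h
    using cop by (simp add: coprime_dvd_mult_left_iff coprime_commute)
  have inj: "inj_on ?\<phi> {1..<q}"
  proof (rule inj_onI)
    fix x y assume xy: "x \<in> {1..<q}" "y \<in> {1..<q}" "?\<phi> x = ?\<phi> y"
    then have "(int x * C) mod int q = (int y * C) mod int q" using q by (simp add: nat_eq_iff2)
    then have "[int x = int y] (mod int q)"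
      using cop by (metis cong_def cong_mult_rcancel)
    then show "x = y" using xy by (auto simp: cong_def)
  qed
  have sub: "?\<phi> ` {1..<q} \<subseteq> {1..<q}"
  proof clarify
    fix h assume h: "h \<in> {1..<q}"
    then have "\<not> int q dvd int h * C" unfolding dvd_iff by (auto dest: dvd_imp_le)
    then have "(int h * C) mod int q \<noteq> 0" by (simp add: dvd_eq_mod_eq_0)
    moreover have "0 \<le> (int h * C) mod int q" "(int h * C) mod int q < int q" using q by auto
    ultimately show "?\<phi> h \<in> {1..<q}" by (auto simp: nat_less_iff)
  qed
  have img: "?\<phi> ` {1..<q} = {1..<q}"
    using endo_inj_surj[OF _ sub inj] by simp
  have "(\<Sum>h<q. if int q dvd int h * C then 0 else norm_avg {-H..H} (real h * real_of_int C / real q))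
     = (\<Sum>h\<in>{1..<q}. norm_avg {-H..H} (real (?\<phi> h) / real q))"
  proof (rule sum.mono_neutral_cong_right)
    show "\<forall>i\<in>{..<q} - {1..<q}. (if int q dvd int i * C then 0 else norm_avg {-H..H} (real i * real_of_int C / real q)) = 0"
      by (auto simp: not_le less_Suc_eq_0_disj)
    show "(if int q dvd int h * C then 0 else norm_avg {-H..H} (real h * real_of_int C / real q)) = norm_avg {-H..H} (real (?\<phi> h) / real q)"
      if "h \<in> {1..<q}" for h
    proof -
      have "\<not> int q dvd int h * C" using that unfolding dvd_iff by (auto dest: dvd_imp_le)
      moreover have "norm_avg {-H..H} (real_of_int (int h * C) / real q) = norm_avg {-H..H} (real (?\<phi> h) / real q)"
        using q by (subst navg_mod) auto
      ultimately show ?thesis by simp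
    qed
  qed auto
  also have "\<dots> = (\<Sum>h\<in>?\<phi> ` {1..<q}. norm_avg {-H..H} (real h / real q))"
    using inj by (simp add: sum.reindex)
  finally show ?thesis unfolding img using sum_navg_interval[OF q H] by simp
qed

text \<open>After cancelling the common factor g of \<open>C\<close> and \<open>q\<close> the
  summand depends only on h modulo q / g. The sum is therefore g copies of the coprime case, and g *
  (q / g) = q restores the same bound.\<close>

lemma sum_navg_multiples:
  assumes q: "q > 0" and H: "H \<ge> 0"
  shows "(\<Sum>h<q. if int q dvd int h * C then 0 else norm_avg {-H..H} (real h * real_of_int C / real q))
     \<le> real q * (1 + ln (real q)) / real_of_int (2 * H + 1)"
proof -
  define g where "g = nat (gcd C (int q))"
  define q' where "q' = q div g"
  define C' where "C' = C div int g"
  have g: "g > 0" "int g = gcd C (int q)" using q by (auto simp: g_def)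
  have "g dvd q" by (metis g(2) gcd_dvd2 int_dvd_int_iff)
  then have qq: "q = g * q'" by (simp add: q'_def)
  have CC: "C = int g * C'" using g(2) by (simp add: C'_def)
  have q': "q' > 0" using q qq by auto
  have cop: "coprime C' (int q')"
    using div_gcd_coprime[of C "int q"] q g by (simp add: C'_def q'_def zdiv_int)
  let ?F = "\<lambda>h. if int q' dvd int h * C' then 0 else norm_avg {-H..H} (real h * real_of_int C' / real q')"
  have "(if int q dvd int h * C then 0 else norm_avg {-H..H} (real h * real_of_int C / real q)) = ?F (h mod q')" for h
  proof -
    have "int q dvd int h * C \<longleftrightarrow> int q' dvd int h * C'"
      using g(1) by (simp add: qq CC mult.left_commute)
    moreover have "int q' dvd int h * C' \<longleftrightarrow> int q' dvd int (h mod q') * C'"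
      by (simp add: zmod_int dvd_eq_mod_eq_0 mod_mult_left_eq)
    moreover have "real h * real_of_int C / real q = real_of_int (int h * C') / real q'"
      using g(1) q' by (simp add: qq CC field_simps)
    moreover have "norm_avg {-H..H} (real_of_int (int h * C') / real q') = norm_avg {-H..H} (real_of_int (int (h mod q') * C') / real q')"
      unfolding navg_mod[OF q', of _ "int h * C'"] navg_mod[OF q', of _ "int (h mod q') * C'"]
      by (simp add: zmod_int mod_mult_left_eq)
    ultimately show ?thesis by simp
  qed
  then have "(\<Sum>h<q. if int q dvd int h * C then 0 else norm_avg {-H..H} (real h * real_of_int C / real q))
    = (\<Sum>h<g * q'. ?F (h mod q'))" unfolding qq[symmetric] by (intro sum.cong) auto
  also have "\<dots> = real g * (\<Sum>h<q'. ?F h)" by (rule sum_periodic)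
  also have "\<dots> \<le> real g * (real q' * (1 + ln (real q')) / real_of_int (2 * H + 1))"
    by (intro mult_left_mono sum_navg_multiples_coprime q' H cop) auto
  also have "\<dots> = real q * (1 + ln (real q')) / real_of_int (2 * H + 1)"
    by (simp add: qq)
  also have "\<dots> \<le> real q * (1 + ln (real q)) / real_of_int (2 * H + 1)"
    using q q' H g by (intro divide_right_mono mult_left_mono) (auto simp: qq)
  finally show ?thesis .
qed

text \<open>Expanding the gcd over divisors e and writing h as e times a new frequency turns the
  modulus m into m / e; the weight e exactly compensates for the shorter sum, so each divisor
  contributes the same bound.\<close>

lemma sum_gcd_navg_multiples:
  assumes m: "m > 0" and H: "H \<ge> 0"
  shows "(\<Sum>h<m. if int m dvd int h * C then 0
       else real_of_int (gcd (int m) (int h)) * norm_avg {-H..H} (real h * real_of_int C / real m))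
     \<le> tau m * (real m * (1 + ln (real m)) / real_of_int (2 * H + 1))" (is "?L \<le> _ * ?B")
proof -
  let ?f = "\<lambda>m h. if int m dvd int h * C then 0 else norm_avg {-H..H} (real h * real_of_int C / real m)"
  have nn: "?f m h \<ge> 0" for m h by (simp add: navg_nonneg)
  have "?L = (\<Sum>h<m. real_of_int (gcd (int m) (int h)) * ?f m h)"
    by (intro sum.cong) auto
  also have "\<dots> \<le> (\<Sum>h<m. (\<Sum>e | e dvd m. real e * of_bool (int e dvd int h)) * ?f m h)"
    by (intro sum_mono mult_right_mono gcd_le_sum_divisors m nn)
  also have "\<dots> = (\<Sum>e | e dvd m. real e * (\<Sum>h<m. of_bool (e dvd h) * ?f m h))"
    unfolding sum_distrib_right sum_distrib_left by (subst sum.swap) (simp add: mult_ac)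
  also have "\<dots> \<le> (\<Sum>e | e dvd m. ?B)"
  proof (intro sum_mono)
    fix e assume "e \<in> {e. e dvd m}"
    then obtain q where q: "m = e * q" by (auto elim: dvdE)
    have e: "e > 0" and q0: "q > 0" using m q by auto
    have "(\<Sum>h<m. of_bool (e dvd h) * ?f m h) = (\<Sum>h<q. ?f q h)"
    proof -
      have "(\<Sum>h<m. of_bool (e dvd h) * ?f m h) = (\<Sum>h\<in>(\<lambda>h. e * h) ` {..<q}. ?f m h)"
        using e q by (intro sum.mono_neutral_cong_right) auto
      also have "\<dots> = (\<Sum>h<q. ?f m (e * h))" using e by (subst sum.reindex) (auto simp: inj_on_def)
      also have "\<dots> = (\<Sum>h<q. ?f q h)"
        using e by (intro sum.cong) (auto simp: q mult.assoc)
      finally show ?thesis .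
    qed
    then have "real e * (\<Sum>h<m. of_bool (e dvd h) * ?f m h)
       \<le> real e * (real q * (1 + ln (real q)) / real_of_int (2 * H + 1))"
      using sum_navg_multiples[OF q0 H, of C] by (simp only: mult_left_mono of_nat_0_le_iff)
    also have "\<dots> = real m * (1 + ln (real q)) / real_of_int (2 * H + 1)" by (simp add: q)
    also have "\<dots> \<le> ?B"
      using q0 e H by (intro divide_right_mono mult_left_mono) (auto simp: q)
    finally show "real e * (\<Sum>h<m. of_bool (e dvd h) * ?f m h) \<le> ?B" .
  qed
  also have "\<dots> = tau m * ?B" by (simp add: tau_def)
  finally show ?thesis .
qed

text \<open>The values \<open>b\<close> are sorted by the residue of \<open>u * b + v\<close> modulo
  \<open>m\<close>; \<open>spread\<close> bounds the size of every class, which leaves a complete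
  sum over residues.\<close>

lemma sum_navg_good:
  assumes W: "spread W K m" and m: "m > 0" and K: "K \<ge> 0"
  shows "(\<Sum>b\<in>W. norm_avg W' (real_of_int (u * b + v) / real m)) * real m
      \<le> K * real_of_int (gcd (int m) u) * real (card W) * (\<Sum>r<m. norm_avg W' (real r / real m))"
proof -
  have fin: "finite W" using W by (simp add: spread_def)
  let ?\<rho> = "\<lambda>b. nat ((u * b + v) mod int m)"
  have lt: "?\<rho> b < m" for b using m by (simp add: nat_less_iff)
  have "(\<Sum>b\<in>W. norm_avg W' (real_of_int (u * b + v) / real m)) = (\<Sum>b\<in>W. norm_avg W' (real (?\<rho> b) / real m))"
    using m by (intro sum.cong refl) (subst navg_mod, auto)
  also have "\<dots> = (\<Sum>r<m. \<Sum>b | b \<in> W \<and> ?\<rho> b = r. norm_avg W' (real (?\<rho> b) / real m))"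
    using lt fin by (intro sum.group[symmetric]) auto
  also have "\<dots> = (\<Sum>r<m. real (card {b \<in> W. int m dvd u * b + (v - int r)}) * norm_avg W' (real r / real m))"
  proof (intro sum.cong refl)
    fix r assume r: "r \<in> {..<m}"
    have "{b \<in> W. ?\<rho> b = r} = {b \<in> W. int m dvd u * b + (v - int r)}"
    proof (intro Collect_cong conj_cong refl)
      fix b
      have "?\<rho> b = r \<longleftrightarrow> (u * b + v) mod int m = int r mod int m"
        using r m by (auto simp: nat_eq_iff2)
      also have "\<dots> \<longleftrightarrow> int m dvd u * b + (v - int r)"
        by (simp add: mod_eq_dvd_iff algebra_simps)
      finally show "?\<rho> b = r \<longleftrightarrow> int m dvd u * b + (v - int r)" .
    qed
    moreover have "(\<Sum>b | b \<in> W \<and> ?\<rho> b = r. norm_avg W' (real (?\<rho> b) / real m))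
       = (\<Sum>b | b \<in> W \<and> ?\<rho> b = r. norm_avg W' (real r / real m))" by (intro sum.cong) auto
    ultimately show "(\<Sum>b | b \<in> W \<and> ?\<rho> b = r. norm_avg W' (real (?\<rho> b) / real m)) =
       real (card {b \<in> W. int m dvd u * b + (v - int r)}) * norm_avg W' (real r / real m)" by simp
  qed
  finally have "(\<Sum>b\<in>W. norm_avg W' (real_of_int (u * b + v) / real m)) * real m
     = (\<Sum>r<m. real (card {b \<in> W. int m dvd u * b + (v - int r)}) * real m * norm_avg W' (real r / real m))"
    by (simp add: sum_distrib_left mult_ac)
  also have "\<dots> \<le> (\<Sum>r<m. K * real_of_int (gcd (int m) u) * real (card W) * norm_avg W' (real r / real m))"
    by (intro sum_mono mult_right_mono spreadD[OF W] navg_nonneg) auto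
  finally show ?thesis by (simp add: sum_distrib_left)
qed

lemma count_solutions_expsum:
  assumes m: "m > 0" and fin: "finite W1" "finite W2"
  shows "of_nat m * of_nat (card {z \<in> W1 \<times> W2. int m dvd C1 * fst z + C2 * snd z + k})
     = (\<Sum>h<m. cis (2 * pi * (real h * real_of_int k / real m)) *
          expsum W1 (real h * real_of_int C1 / real m) * expsum W2 (real h * real_of_int C2 / real m))"
proof -
  have "(\<Sum>h<m. cis (2 * pi * (real h * real_of_int k / real m)) *
          expsum W1 (real h * real_of_int C1 / real m) * expsum W2 (real h * real_of_int C2 / real m))
     = (\<Sum>h<m. \<Sum>x\<in>W1. \<Sum>y\<in>W2. cis (2 * pi * (real h * real_of_int (C1 * x + C2 * y + k) / real m)))"
    unfolding expsum_def sum_distrib_left sum_distrib_right mult.assoc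
    by (subst (2) sum.swap) (simp add: cis_mult algebra_simps add_divide_distrib)
  also have "\<dots> = (\<Sum>x\<in>W1. \<Sum>y\<in>W2. \<Sum>h<m. cis (2 * pi * (real h * real_of_int (C1 * x + C2 * y + k) / real m)))"
    by (simp add: sum.swap[of _ _ "{..<m}"])
  also have "\<dots> = (\<Sum>x\<in>W1. \<Sum>y\<in>W2. if int m dvd C1 * x + C2 * y + k then of_nat m else 0)"
    by (simp only: cis_orthogonality[OF m])
  also have "\<dots> = (\<Sum>(x,y)\<in>W1 \<times> W2. if int m dvd C1 * x + C2 * y + k then of_nat m else 0)"
    by (rule sum.cartesian_product)
  also have "\<dots> = (\<Sum>z\<in>{z \<in> W1 \<times> W2. int m dvd C1 * fst z + C2 * snd z + k}. of_nat m)"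
    using fin by (intro sum.mono_neutral_cong_right) (auto split: if_splits)
  finally show ?thesis by simp
qed

section \<open>From boxes to complete residue systems\<close>

text \<open>Two elements of \<open>S\<close> never share a block of length \<open>e\<close> counted
  from \<open>a\<close>, and the last block index is \<open>(n - 1) div e\<close>. If
  \<open>e\<close> divides \<open>n\<close> the blocks fit exactly and the extra \<open>e\<close>
  disappears.\<close>

lemma card_congruent_interval:
  fixes a :: int and n e :: nat
  assumes n: "n > 0" and e: "e > 0" and S: "S \<subseteq> {a..<a + int n}"
    and dvd: "\<And>x y. x \<in> S \<Longrightarrow> y \<in> S \<Longrightarrow> int e dvd x - y"
  shows "card S * e \<le> n + e" "e dvd n \<Longrightarrow> card S * e \<le> n"
proof -
  let ?f = "\<lambda>b. (b - a) div int e"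
  have inj: "inj_on ?f S"
  proof (rule inj_onI)
    fix x y assume xy: "x \<in> S" "y \<in> S" "?f x = ?f y"
    have "int e dvd (x - a) - (y - a)" using dvd[OF xy(1,2)] by simp
    then have "(x - a) mod int e = (y - a) mod int e" by (simp only: mod_eq_dvd_iff)
    with xy(3) have "x - a = y - a" by (metis mult_div_mod_eq)
    then show "x = y" by simp
  qed
  have "?f ` S \<subseteq> {0..(int n - 1) div int e}"
  proof clarify
    fix x assume "x \<in> S"
    with S have "0 \<le> x - a" "x - a \<le> int n - 1" by auto
    then show "?f x \<in> {0..(int n - 1) div int e}" using e by (auto intro: zdiv_mono1 simp: pos_imp_zdiv_nonneg_iff)
  qed
  then have "card (?f ` S) \<le> card {0..(int n - 1) div int e}" by (rule card_mono[rotated]) simp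
  then have c: "int (card S) \<le> (int n - 1) div int e + 1"
    using n e by (simp add: card_image[OF inj] pos_imp_zdiv_nonneg_iff le_nat_iff)
  have "int (card S) * int e \<le> ((int n - 1) div int e) * int e + int e"
    using mult_right_mono[OF c, of "int e"] by (simp add: algebra_simps)
  also have "\<dots> \<le> int n + int e"
    using div_mult_mod_eq[of "int n - 1" "int e"] pos_mod_sign[of "int e" "int n - 1"] e by linarith
  finally show "card S * e \<le> n + e" by (metis of_nat_le_iff of_nat_add of_nat_mult)
  assume "e dvd n"
  then obtain k where k: "n = e * k" by (auto elim: dvdE)
  have "(int n - 1) div int e \<le> int k - 1"
  proof -
    have "\<not> int k \<le> (int n - 1) div int e"
    proof
      assume "int k \<le> (int n - 1) div int e"
      then have "int k * int e \<le> ((int n - 1) div int e) * int e" by (intro mult_right_mono) auto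
      also have "\<dots> \<le> int n - 1"
        using div_mult_mod_eq[of "int n - 1" "int e"] pos_mod_sign[of "int e" "int n - 1"] e by linarith
      finally show False by (simp add: k)
    qed
    then show ?thesis by simp
  qed
  then have "int (card S) * int e \<le> int k * int e" using c by (intro mult_right_mono) auto
  then show "card S * e \<le> n" by (metis k mult.commute of_nat_le_iff of_nat_mult)
qed

text \<open>Dividing by the gcd of \<open>e\<close> and \<open>u\<close> leaves a congruence that
  determines \<open>b\<close> modulo the quotient e'. The alternative \<open>m = n\<close> is a
  complete residue system, where K = 1 is enough because e' divides the length.\<close>

lemma spread_interval_aux:
  fixes a :: int and n e m :: nat
  assumes n: "n > 0" and m: "m > 0" and e: "e dvd m" and K: "K \<ge> 1" "K \<ge> 1 + real m / real n \<or> m = n"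
  shows "real (card {b \<in> {a..<a + int n}. int e dvd u * b + v}) * real e \<le> K * real_of_int (gcd (int e) u) * real n"
proof -
  let ?S = "{b \<in> {a..<a + int n}. int e dvd u * b + v}"
  define g where "g = nat (gcd (int e) u)"
  have e0: "e > 0" using e m by (auto intro: Nat.gr0I)
  have g: "int g = gcd (int e) u" "g > 0" using e0 by (auto simp: g_def gcd_pos_int)
  have "g dvd e" by (metis g(1) gcd_dvd1 int_dvd_int_iff)
  then obtain e' where e': "e = g * e'" by (auto elim: dvdE)
  define u' where "u' = u div int g"
  have u': "u = int g * u'" using g by (simp add: u'_def)
  have e'0: "e' > 0" using e0 e' by auto
  have cop: "coprime (int e') u'"
  proof -
    have "int g * gcd (int e') u' = int g"
      using g(1) unfolding e' u' of_nat_mult gcd_mult_distrib_int[symmetric] by simp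
    then show ?thesis using g(2) by (simp add: coprime_iff_gcd_eq_1)
  qed
  have dvd: "int e' dvd x - y" if "x \<in> ?S" "y \<in> ?S" for x y
  proof -
    have "int e dvd (u * x + v) - (u * y + v)" using that by (intro dvd_diff) auto
    then have "int g * int e' dvd int g * (u' * (x - y))" by (simp add: e' u' algebra_simps)
    then have "int e' dvd u' * (x - y)" using g(2) by simp
    then show ?thesis using cop by (simp add: coprime_dvd_mult_right_iff)
  qed
  have sub: "?S \<subseteq> {a..<a + int n}" by auto
  have le: "e' dvd m" "e' \<le> m" using e e' m by (auto intro: dvd_imp_le dvd_trans)
  have "real (card ?S) * real e' \<le> K * real n"
  proof (cases "m = n")
    case True
    have "card ?S * e' \<le> n"
      by (rule card_congruent_interval(2)[OF n e'0 sub], rule dvd, assumption+) (use le True in simp)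
    then have "real (card ?S) * real e' \<le> 1 * real n" by (simp flip: of_nat_mult)
    also have "\<dots> \<le> K * real n" using K by (intro mult_right_mono) auto
    finally show ?thesis .
  next
    case False
    have "card ?S * e' \<le> n + e'"
      by (rule card_congruent_interval(1)[OF n e'0 sub], rule dvd, assumption+)
    then have "real (card ?S) * real e' \<le> real n + real e'" by (simp flip: of_nat_mult of_nat_add)
    also have "\<dots> \<le> (1 + real m / real n) * real n" using n le by (simp add: field_simps)
    also have "\<dots> \<le> K * real n" using K False by (intro mult_right_mono) auto
    finally show ?thesis .
  qed
  then have "real g * (real (card ?S) * real e') \<le> real g * (K * real n)" by (intro mult_left_mono) auto
  moreover have "real_of_int (gcd (int e) u) = real g" by (simp flip: g(1))
  moreover have "real e = real g * real e'" by (simp add: e')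
  ultimately show ?thesis by (simp only: mult_ac)
qed

lemma spread_interval:
  assumes "H \<ge> 0" "m > 0" "K \<ge> 1 + real m / real_of_int (2 * H + 1)"
  shows "spread {-H..H} K m"
proof -
  have "{-H..H} = {-H..<-H + int (nat (2 * H + 1))}" using assms by auto
  moreover have "K \<ge> 1" using assms by (smt (verit) divide_nonneg_nonneg of_nat_0_le_iff of_int_0_le_iff)
  ultimately show ?thesis using spread_interval_aux[of "nat (2*H+1)" m _ K "-H"] assms
    unfolding spread_def by auto
qed

lemma spread_residues: "m > 0 \<Longrightarrow> K \<ge> 1 \<Longrightarrow> spread {0..<int m} K m"
  using spread_interval_aux[of m m _ K 0] unfolding spread_def by auto

lemma sum_navg_residues:
  assumes "m > 0"
  shows "(\<Sum>r<m. norm_avg {0..<int m} (real r / real m)) = 1"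
proof -
  have "norm_avg {0..<int m} (real r / real m) = (if r = 0 then 1 else 0)" if "r < m" for r
    using expsum_residues[OF assms, of "int r"] that assms by (auto simp: norm_avg_def dest: dvd_imp_le)
  then show ?thesis using assms by simp
qed

lemma sum_navg_interval_le:
  assumes "m > 0" "H \<ge> 0" "K \<ge> 1 + real m / real_of_int (2 * H + 1)"
  shows "(\<Sum>r<m. norm_avg {-H..H} (real r / real m)) \<le> K * (1 + ln (real m))"
proof -
  have "{..<m} = insert 0 {1..<m}" using assms by auto
  then have "(\<Sum>r<m. norm_avg {-H..H} (real r / real m)) = norm_avg {-H..H} 0 + (\<Sum>r\<in>{1..<m}. norm_avg {-H..H} (real r / real m))"
    by simp
  also have "\<dots> \<le> 1 * (1 + ln (real m)) + (real m / real_of_int (2 * H + 1)) * (1 + ln (real m))"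
    using sum_navg_interval[of m H] assms navg_le_1[of "{-H..H}" 0] by (intro add_mono) (auto intro: order_trans)
  also have "\<dots> \<le> K * (1 + ln (real m))"
    using assms unfolding distrib_right[symmetric] by (intro mult_right_mono) auto
  finally show ?thesis .
qed

section \<open>Comparison of densities by exchanging the ranges of entries\<close>

definition dens :: "('n::finite \<Rightarrow> 'n \<Rightarrow> int set) \<Rightarrow> nat \<Rightarrow> real" where
  "dens W m = real (card {A \<in> mats W. int m dvd dt A}) / real (card (mats W))"

text \<open>Frequencies with \<open>m\<close> dividing \<open>h * C1\<close> give average 1 on both
  ranges of the first variable and cancel; for all others the complete residue sum vanishes, so only
  the interval contributes.\<close>

lemma pair_count_diff:
  assumes m: "m > 0" and H: "H \<ge> 0" and W: "finite W" "W \<noteq> {}"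
  shows "\<bar>real (card {z \<in> {-H..H} \<times> W. int m dvd C1 * fst z + C2 * snd z + k}) / (real_of_int (2 * H + 1) * real (card W))
        - real (card {z \<in> {0..<int m} \<times> W. int m dvd C1 * fst z + C2 * snd z + k}) / (real m * real (card W))\<bar> * real m
      \<le> (\<Sum>h<m. if int m dvd int h * C1 then 0
             else norm_avg {-H..H} (real h * real_of_int C1 / real m) * norm_avg W (real h * real_of_int C2 / real m))"
proof -
  let ?I = "{-H..H}" and ?J = "{0..<int m}"
  let ?a = "real (card {z \<in> ?I \<times> W. int m dvd C1 * fst z + C2 * snd z + k}) / (real_of_int (2 * H + 1) * real (card W))"
  let ?b = "real (card {z \<in> ?J \<times> W. int m dvd C1 * fst z + C2 * snd z + k}) / (real m * real (card W))"
  let ?c = "\<lambda>h. cis (2 * pi * (real h * real_of_int k / real m))"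
  let ?S = "\<lambda>W C h. expsum W (real h * real_of_int C / real m)"
  define Nn where "Nn = card ?I"
  have N: "real_of_int (2 * H + 1) = real Nn" "Nn > 0" using H by (auto simp: Nn_def)
  have c: "real (card W) > 0" using W by (simp add: card_gt_0_iff)
  have SJ: "?S ?J C1 h = (if int m dvd int h * C1 then of_nat m else 0)" for h
    using expsum_residues[OF m, of "int h * C1"] by simp
  have SI: "?S ?I C1 h = of_nat Nn" if "int m dvd int h * C1" for h
  proof -
    have "real h * real_of_int C1 / real m \<in> \<int>"
      using of_int_divide_in_Ints_iff_dvd[OF m, of "int h * C1"] that by simp
    then show ?thesis unfolding Nn_def by (rule expsum_int)
  qed
  have "complex_of_real ((?a - ?b) * real m)
      = (\<Sum>h<m. ?c h * ?S ?I C1 h * ?S W C2 h) / (of_nat Nn * of_nat (card W))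
      - (\<Sum>h<m. ?c h * ?S ?J C1 h * ?S W C2 h) / (of_nat m * of_nat (card W))"
    using m unfolding N(1) count_solutions_expsum[OF m _ W(1), of ?I, symmetric, OF finite_atLeastAtMost_int]
      count_solutions_expsum[OF m _ W(1), of ?J, symmetric, OF finite_atLeastLessThan_int]
    by (simp add: algebra_simps)
  also have "\<dots> = (\<Sum>h<m. ?c h * (?S ?I C1 h / of_nat Nn - ?S ?J C1 h / of_nat m) * (?S W C2 h / of_nat (card W)))"
    unfolding sum_divide_distrib sum_subtractf[symmetric]
    by (intro sum.cong refl) (simp add: algebra_simps)
  finally have "norm (complex_of_real ((?a - ?b) * real m)) \<le>
     (\<Sum>h<m. norm (?c h * (?S ?I C1 h / of_nat Nn - ?S ?J C1 h / of_nat m) * (?S W C2 h / of_nat (card W))))"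
    by (simp only: norm_sum)
  also have "\<dots> = (\<Sum>h<m. if int m dvd int h * C1 then 0
             else norm_avg {-H..H} (real h * real_of_int C1 / real m) * norm_avg W (real h * real_of_int C2 / real m))"
  proof (intro sum.cong refl)
    fix h
    show "norm (?c h * (?S ?I C1 h / of_nat Nn - ?S ?J C1 h / of_nat m) * (?S W C2 h / of_nat (card W)))
      = (if int m dvd int h * C1 then 0
             else norm_avg {-H..H} (real h * real_of_int C1 / real m) * norm_avg W (real h * real_of_int C2 / real m))"
    proof (cases "int m dvd int h * C1")
      case True
      then show ?thesis using m N SI[OF True] SJ[of h] by simp
    next
      case False
      then show ?thesis using SJ[of h] by (simp add: norm_mult norm_divide norm_avg_def Nn_def)
    qed
  qed
  finally show ?thesis unfolding norm_of_real abs_mult by simp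
qed

text \<open>Selects the columns deleted together with the rows \<open>i0\<close> and
  \<open>i1\<close>, so that the remaining minor has the format of \<open>unit_rows\<close>.\<close>

lemma bij_two_values:
  fixes i0 i1 j1 j2 :: "'n::finite"
  assumes "i0 \<noteq> i1" "j1 \<noteq> j2"
  obtains s where "bij s" "s i0 = j2" "s i1 = j1"
proof -
  let ?p = "Transposition.transpose i0 j2"
  let ?q = "Transposition.transpose (?p i1) j1"
  have ne: "?p i1 \<noteq> j2" using assms by (auto simp: Transposition.transpose_def split: if_splits)
  have "bij (?q \<circ> ?p)" by (intro bij_comp) auto
  moreover have "(?q \<circ> ?p) i0 = j2" using ne assms by (simp add: Transposition.transpose_def)
  moreover have "(?q \<circ> ?p) i1 = j1" by simp
  ultimately show ?thesis by (rule that)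
qed

lemma gcd_mult_le:
  fixes m a b :: int
  assumes "m > 0" shows "gcd m (a * b) \<le> gcd m a * gcd m b"
proof -
  have "gcd m (a * b) dvd gcd (a * m) (a * b)" by simp
  then have 1: "gcd m (a * b) dvd a * gcd m b" by (simp add: gcd_mult_left abs_dvd_iff)
  have 2: "gcd m (a * b) dvd m * gcd m b" by (rule dvd_mult2) simp
  from 1 2 have "gcd m (a * b) dvd gcd (m * gcd m b) (a * gcd m b)" by simp
  also have "gcd (m * gcd m b) (a * gcd m b) = gcd m a * gcd m b"
    by (simp add: gcd_mult_right abs_mult gcd.commute)
  finally show ?thesis using assms by (intro zdvd_imp_le) (auto simp: gcd_pos_int)
qed

text \<open>
  Write the determinant as \<open>C1 * x + C2 * y + k\<close> with \<open>x\<close>, \<open>y\<close> the entries \<open>(i0, j1)\<close>, \<open>(i0, j2)\<close>. Only frequencies \<open>h\<close> with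
  \<open>\<not> m dvd h * C1\<close> distinguish the two ranges of \<open>x\<close>. The entry \<open>(i1, j1)\<close> occurs in \<open>C2\<close> but not in \<open>C1\<close>, and
  averaging over it makes the second exponential sum small too; the loss is the gcd of \<open>m\<close> with the minor \<open>E\<close>.
\<close>
lemma dens_residues_entry_diff:
  fixes W :: "'n::finite \<Rightarrow> 'n \<Rightarrow> int set" and i0 i1 j1 j2 :: 'n
  assumes spread: "\<And>i j. spread (W i j) K m" and ne: "\<And>i j. W i j \<noteq> {}"
    and m: "m > 0" and K: "K \<ge> 0" and H: "H \<ge> 0" and I: "W i0 j1 = {-H..H}"
    and L: "L = 1 + ln (real m)"
    and nav: "(\<Sum>r<m. norm_avg (W i0 j2) (real r / real m)) \<le> K * L"
    and ij: "i0 \<noteq> i1" "j1 \<noteq> j2"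
  shows "\<bar>dens W m - dens (upd W i0 j1 {0..<int m}) m\<bar> * (real m * real_of_int (2 * H + 1))
      \<le> K ^ 2 * L ^ 2 * tau m * (K * tau m) ^ (CARD('n) - 2)"
proof -
  let ?J = "{0..<int m}" and ?W2 = "W i0 j2"
  let ?W' = "upd W i0 j1 ?J"
  define N where "N = real_of_int (2 * H + 1)"
  define N2 where "N2 = real (card ?W2)"
  define M where "M = real (card (mats W))"
  have fin: "finite (W i j)" for i j using spread by (simp add: spread_def)
  have finW': "finite (?W' i j)" for i j using fin by auto
  have N: "N > 0" "N = real (card (W i0 j1))" using H by (auto simp: N_def I)
  have N2: "N2 > 0" using fin ne by (simp add: N2_def card_gt_0_iff)
  have Mpos: "M > 0" using finite_mats[of W, OF fin] ne unfolding M_def mats_PiE by (auto simp: card_gt_0_iff PiE_eq_empty_iff)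
  have L0: "L \<ge> 1" using m by (simp add: L)
  define ind where "ind = (\<lambda>A :: 'n \<Rightarrow> 'n \<Rightarrow> int. of_bool (int m dvd dt A) :: real)"
  define cnt where "cnt = (\<lambda>V A. \<Sum>x\<in>V. \<Sum>y\<in>?W2. ind (upd (upd A i0 j1 x) i0 j2 y))"
  define C1 where "C1 = (\<lambda>A. dt (A(i0 := unit_row j1)))"
  define C2 where "C2 = (\<lambda>A. dt (A(i0 := unit_row j2)))"
  define T where "T = (\<lambda>A. \<Sum>h<m. if int m dvd int h * C1 A then 0
     else norm_avg {-H..H} (real h * real_of_int (C1 A) / real m) * norm_avg ?W2 (real h * real_of_int (C2 A) / real m))"

  define r where "r = (\<lambda>A. \<Sum>y\<in>?W2. ind (upd A i0 j2 y))"
  have cnt_r: "cnt V A = (\<Sum>x\<in>V. r (upd A i0 j1 x))" for V A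
    by (simp only: cnt_def r_def)
  have W'2: "?W' i0 j2 = ?W2" using ij by simp
  have cntI: "N2 * N * (\<Sum>A\<in>mats W. ind A) = (\<Sum>A\<in>mats W. cnt (W i0 j1) A)"
  proof -
    have "N2 * (\<Sum>A\<in>mats W. ind A) = (\<Sum>A\<in>mats W. r A)"
      unfolding N2_def r_def by (rule resample)
    moreover have "N * (\<Sum>A\<in>mats W. r A) = (\<Sum>A\<in>mats W. cnt (W i0 j1) A)"
      unfolding N(2) cnt_r by (rule resample)
    ultimately show ?thesis by (simp only: mult.commute[of N2 N] mult.assoc)
  qed
  have cntJ: "N2 * N * (\<Sum>A\<in>mats ?W'. ind A) = (\<Sum>A\<in>mats W. cnt ?J A)"
  proof -
    have "N2 * (\<Sum>A\<in>mats ?W'. ind A) = (\<Sum>A\<in>mats ?W'. r A)"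
      unfolding N2_def r_def W'2[symmetric] by (rule resample)
    moreover have "N * (\<Sum>A\<in>mats ?W'. r A) = (\<Sum>A\<in>mats W. cnt ?J A)"
      unfolding N(2) cnt_r by (rule resample_range)
    ultimately show ?thesis by (simp only: mult.commute[of N2 N] mult.assoc)
  qed
  have cM': "real (card (mats ?W')) * N = M * real m"
    using resample_range[of W i0 j1 "\<lambda>_. 1" ?J] by (simp add: M_def N(2) mult_ac)
  have sumind: "(\<Sum>A\<in>mats W. ind A) = dens W m * M"
    using Mpos unfolding ind_def sum_of_bool_card[OF finite_mats[of W, OF fin]] by (simp add: dens_def M_def)
  have sumind': "(\<Sum>A\<in>mats ?W'. ind A) * N = dens ?W' m * (M * real m)"
  proof -
    have "real (card (mats ?W')) * N > 0" unfolding cM' using Mpos m by simp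
    then have "card (mats ?W') > 0" using N(1) by (simp add: zero_less_mult_iff)
    then have "(\<Sum>A\<in>mats ?W'. ind A) = dens ?W' m * real (card (mats ?W'))"
      unfolding ind_def sum_of_bool_card[OF finite_mats[of ?W', OF finW']] by (simp add: dens_def)
    then show ?thesis by (simp only: mult.assoc cM')
  qed
  \<comment> \<open>Both densities are expressed over the same index set \<open>mats W\<close>,
    which allows a comparison matrix by matrix.\<close>
  have diff: "(dens W m - dens ?W' m) * M = (\<Sum>A\<in>mats W. cnt (W i0 j1) A / (N * N2) - cnt ?J A / (real m * N2))"
  proof -
    have "(\<Sum>A\<in>mats W. cnt (W i0 j1) A / (N * N2) - cnt ?J A / (real m * N2))
       = (N2 * N * (\<Sum>A\<in>mats W. ind A)) / (N * N2) - (N2 * N * (\<Sum>A\<in>mats ?W'. ind A)) / (real m * N2)"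
      by (simp only: sum_subtractf sum_divide_distrib[symmetric] cntI cntJ)
    also have "\<dots> = dens W m * M - ((\<Sum>A\<in>mats ?W'. ind A) * N) / real m"
      using N N2 by (simp add: sumind field_simps)
    also have "\<dots> = dens W m * M - dens ?W' m * M" unfolding sumind' using m by simp
    finally show ?thesis by (simp add: algebra_simps)
  qed
  have each: "\<bar>cnt (W i0 j1) A / (N * N2) - cnt ?J A / (real m * N2)\<bar> * real m \<le> T A" for A
  proof -
    obtain k where k: "\<And>x y. dt (upd (upd A i0 j1 x) i0 j2 y) = C1 A * x + C2 A * y + k"
    proof
      fix x y
      have 1: "upd (upd A i0 j1 x) i0 j2 y = A(i0 := (A i0)(j1 := x, j2 := y))" by simp
      have 2: "dt (A(i0 := (A i0)(j1 := x, j2 := y))) = C2 A * y + dt (A(i0 := (A i0)(j1 := x, j2 := 0)))"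
        unfolding C2_def by (rule dt_row_affine)
      have 3: "(A i0)(j1 := x, j2 := 0) = (A i0)(j2 := 0, j1 := x)" using ij by (intro fun_upd_twist)
      have 4: "dt (A(i0 := (A i0)(j2 := 0, j1 := x))) = C1 A * x + dt (A(i0 := (A i0)(j2 := 0, j1 := 0)))"
        unfolding C1_def by (rule dt_row_affine)
      show "dt (upd (upd A i0 j1 x) i0 j2 y) = C1 A * x + C2 A * y + dt (A(i0 := (A i0)(j2 := 0, j1 := 0)))"
        unfolding 1 2 unfolding 3 4 by (simp only: add_ac)
    qed
    have cc: "cnt V A = real (card {z \<in> V \<times> ?W2. int m dvd C1 A * fst z + C2 A * snd z + k})" if "finite V" for V
    proof -
      have "cnt V A = (\<Sum>x\<in>V. \<Sum>y\<in>?W2. of_bool (int m dvd C1 A * x + C2 A * y + k))"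
        by (simp only: cnt_def ind_def k)
      also have "\<dots> = (\<Sum>z\<in>V \<times> ?W2. of_bool (int m dvd C1 A * fst z + C2 A * snd z + k))"
        by (simp only: sum.cartesian_product case_prod_unfold)
      finally show ?thesis using that fin by (simp only: sum_of_bool_card finite_cartesian_product)
    qed
    show ?thesis
      using pair_count_diff[OF m H fin[of i0 j2] ne, of "C1 A" "C2 A" k]
      unfolding I unfolding cc[OF finite_atLeastAtMost_int] cc[OF finite_atLeastLessThan_int] N_def N2_def T_def .
  qed
  obtain s where s: "bij s" "s i0 = j2" "s i1 = j1" by (rule bij_two_values[OF ij])
  define E where "E = (\<lambda>A. dt (unit_rows {i0, i1} s A))"
  define c where "c = K ^ 2 * L ^ 2 * tau m / N"
  have c0: "c \<ge> 0" using K N by (simp add: c_def)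
  have "(\<Sum>A\<in>mats W. T A) \<le> (\<Sum>A\<in>mats W. c * real_of_int (gcd (int m) (E A)))"
  proof (rule resample_le[where i = i1 and j = j1])
    show "finite (W i1 j1)" by (rule fin)
    fix A :: "'n \<Rightarrow> 'n \<Rightarrow> int"
    have tw: "(upd A i1 j1 b)(i0 := u) = (A(i0 := u))(i1 := (A i1)(j1 := b))" for b u
      using ij by (auto simp: fun_eq_iff)
    \<comment> \<open>The slope of \<open>C1\<close> in the entry (i1, j1) is a determinant with two
      rows equal to \<open>unit_row j1\<close>.\<close>
    have C1u: "C1 (upd A i1 j1 b) = C1 A" for b
    proof -
      have z: "dt ((A(i0 := unit_row j1))(i1 := unit_row j1)) = 0"
        using ij by (intro dt_same_rows[of i0 i1]) auto
      have c: "dt ((A(i0 := unit_row j1))(i1 := (A i1)(j1 := b))) = dt ((A(i0 := unit_row j1))(i1 := (A i1)(j1 := 0)))" for b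
        by (subst dt_row_affine) (simp only: z mult_zero_left add_0)
      have "(A(i0 := unit_row j1))(i1 := (A i1)(j1 := A i1 j1)) = A(i0 := unit_row j1)"
        using ij by (auto simp: fun_eq_iff)
      then show ?thesis
        unfolding C1_def tw using c[of b] c[of "A i1 j1"] by (simp only:)
    qed
    obtain l where l: "\<And>b. C2 (upd A i1 j1 b) = E A * b + l"
    proof
      fix b
      have u: "(A(i0 := unit_row j2))(i1 := unit_row j1) = unit_rows {i0, i1} s A"
        using s ij by (auto simp: unit_rows_def)
      show "C2 (upd A i1 j1 b) = E A * b + dt ((A(i0 := unit_row j2))(i1 := (A i1)(j1 := 0)))"
        unfolding C2_def E_def tw u[symmetric] by (rule dt_row_affine)
    qed
    let ?B = "real (card (W i1 j1))"
    let ?w = "\<lambda>h. if int m dvd int h * C1 A then 0 else norm_avg {-H..H} (real h * real_of_int (C1 A) / real m)"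
    have "(\<Sum>b\<in>W i1 j1. T (upd A i1 j1 b))
        = (\<Sum>h<m. ?w h * (\<Sum>b\<in>W i1 j1. norm_avg ?W2 (real_of_int (int h * E A * b + int h * l) / real m)))"
    proof -
      have "T (upd A i1 j1 b) = (\<Sum>h<m. ?w h * norm_avg ?W2 (real_of_int (int h * E A * b + int h * l) / real m))" for b
        unfolding T_def C1u l by (intro sum.cong refl) (simp add: algebra_simps)
      then show ?thesis by (simp only: sum_distrib_left sum.swap[of _ "W i1 j1"])
    qed
    \<comment> \<open>The gcd of \<open>m\<close> with \<open>h * E A\<close> is split: the part
      from \<open>h\<close> becomes a weight in the sum over frequencies, the part from
      \<open>E A\<close> is kept for the final average over matrices.\<close>
    also have "\<dots> \<le> (\<Sum>h<m. ?w h * (K * (real_of_int (gcd (int m) (int h)) * real_of_int (gcd (int m) (E A))) * ?B * (K * L) / real m))"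
    proof (intro sum_mono mult_left_mono)
      fix h
      have "(\<Sum>b\<in>W i1 j1. norm_avg ?W2 (real_of_int (int h * E A * b + int h * l) / real m)) * real m
         \<le> K * real_of_int (gcd (int m) (int h * E A)) * ?B * (\<Sum>r<m. norm_avg ?W2 (real r / real m))"
        by (rule sum_navg_good[OF spread m K])
      also have "\<dots> \<le> K * (real_of_int (gcd (int m) (int h)) * real_of_int (gcd (int m) (E A))) * ?B * (K * L)"
      proof (intro mult_mono nav)
        have "gcd (int m) (int h * E A) \<le> gcd (int m) (int h) * gcd (int m) (E A)"
          using m by (intro gcd_mult_le) auto
        then show "real_of_int (gcd (int m) (int h * E A)) \<le> real_of_int (gcd (int m) (int h)) * real_of_int (gcd (int m) (E A))"
          by (metis of_int_le_iff of_int_mult)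
      qed (use K in \<open>auto intro!: sum_nonneg navg_nonneg\<close>)
      finally show "(\<Sum>b\<in>W i1 j1. norm_avg ?W2 (real_of_int (int h * E A * b + int h * l) / real m))
         \<le> K * (real_of_int (gcd (int m) (int h)) * real_of_int (gcd (int m) (E A))) * ?B * (K * L) / real m"
        using m by (simp only: pos_le_divide_eq of_nat_0_less_iff)
      show "0 \<le> ?w h" by (simp add: navg_nonneg)
    qed
    also have "\<dots> = K * K * L * ?B * real_of_int (gcd (int m) (E A)) / real m *
        (\<Sum>h<m. if int m dvd int h * C1 A then 0
       else real_of_int (gcd (int m) (int h)) * norm_avg {-H..H} (real h * real_of_int (C1 A) / real m))"
      unfolding sum_distrib_left by (intro sum.cong) auto
    also have "\<dots> \<le> K * K * L * ?B * real_of_int (gcd (int m) (E A)) / real m * (tau m * (real m * L / N))"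
      using sum_gcd_navg_multiples[OF m H, of "C1 A"] K L0
      unfolding L[symmetric] N_def[symmetric] by (intro mult_left_mono) auto
    also have "\<dots> = ?B * (c * real_of_int (gcd (int m) (E A)))"
      using m N by (simp add: c_def power2_eq_square)
    finally show "(\<Sum>b\<in>W i1 j1. T (upd A i1 j1 b)) \<le> ?B * (c * real_of_int (gcd (int m) (E A)))" .
  qed
  also have "\<dots> \<le> c * ((K * tau m) ^ (CARD('n) - 2) * M)"
  proof -
    have "card (UNIV - {i0, i1}) = CARD('n) - 2" using ij by (simp add: card_Diff_subset)
    moreover have "- (UNIV - {i0, i1}) = {i0, i1}" by auto
    ultimately show ?thesis
      using sum_gcd_unit_rows[OF spread m K s(1), of "UNIV - {i0, i1}"] c0
      unfolding sum_distrib_left[symmetric] M_def E_def by (intro mult_left_mono) auto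
  qed
  finally have TT: "(\<Sum>A\<in>mats W. T A) \<le> c * (K * tau m) ^ (CARD('n) - 2) * M" by (simp add: mult_ac)
  have "\<bar>(dens W m - dens ?W' m) * M\<bar> * real m
      \<le> (\<Sum>A\<in>mats W. \<bar>cnt (W i0 j1) A / (N * N2) - cnt ?J A / (real m * N2)\<bar>) * real m"
    unfolding diff by (intro mult_right_mono sum_abs) auto
  also have "\<dots> \<le> (\<Sum>A\<in>mats W. T A)"
    unfolding sum_distrib_right by (intro sum_mono each)
  also note TT
  finally have "M * (\<bar>dens W m - dens ?W' m\<bar> * real m) \<le> M * (c * (K * tau m) ^ (CARD('n) - 2))"
    using Mpos by (simp add: abs_mult mult_ac)
  then have "\<bar>dens W m - dens ?W' m\<bar> * real m \<le> c * (K * tau m) ^ (CARD('n) - 2)"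
    using Mpos by simp
  then have "\<bar>dens W m - dens ?W' m\<bar> * real m * N \<le> c * (K * tau m) ^ (CARD('n) - 2) * N"
    using N by (intro mult_right_mono) auto
  also have "c * (K * tau m) ^ (CARD('n) - 2) * N = (c * N) * (K * tau m) ^ (CARD('n) - 2)"
    by (simp only: mult_ac)
  also have "c * N = K ^ 2 * L ^ 2 * tau m" using N by (simp add: c_def)
  finally show ?thesis unfolding N_def by (simp only: mult.assoc)
qed

text \<open>Telescopes over the entries: in \<open>WP P\<close> those in \<open>P\<close> are
  already exchanged. The entry to be exchanged is still an interval; the others matter only through
  \<open>spread\<close> and \<open>nav\<close>, which hold for both kinds of range. The auxiliary
  row and column exist since n is at least 2.\<close>

lemma dens_residues_diff:
  assumes n: "CARD('n::finite) \<ge> 2" and m: "m > 0" and H: "H \<ge> 0"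
    and K: "K \<ge> 1 + real m / real_of_int (2 * H + 1)" and L: "L = 1 + ln (real m)"
  shows "\<bar>dens (\<lambda>(i::'n) j. {-H..H}) m - dens (\<lambda>(i::'n) j. {0..<int m}) m\<bar> * (real m * real_of_int (2 * H + 1))
      \<le> real (CARD('n)) ^ 2 * (K * tau m) ^ CARD('n) * L ^ 2"
proof -
  define WP where "WP = (\<lambda>(P :: ('n \<times> 'n) set) i j. if (i, j) \<in> P then {0..<int m} else {-H..H})"
  define B where "B = K ^ 2 * L ^ 2 * tau m * (K * tau m) ^ (CARD('n) - 2)"
  let ?D = "real m * real_of_int (2 * H + 1)"
  have K1: "K \<ge> 1" using K H by (smt (verit) divide_nonneg_nonneg of_nat_0_le_iff of_int_0_le_iff)
  have L1: "L \<ge> 1" using m by (simp add: L)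
  have D0: "?D \<ge> 0" using H by auto
  have spread: "spread (WP P i j) K m" for P i j
    using spread_interval[OF H m K] spread_residues[OF m K1] by (simp add: WP_def)
  have ne: "WP P i j \<noteq> {}" for P i j using H m by (simp add: WP_def)
  \<comment> \<open>A residue range has total 1 and an interval at most \<open>K * L\<close>, so one
    bound covers every intermediate box.\<close>
  have nav: "(\<Sum>r<m. norm_avg (WP P i j) (real r / real m)) \<le> K * L" for P i j
    using sum_navg_interval_le[OF m H K] sum_navg_residues[OF m] mult_mono[of 1 K 1 L] K1 L1
    by (auto simp: WP_def L)
  have "\<bar>dens (WP {}) m - dens (WP P) m\<bar> * ?D \<le> real (card P) * B" for P
    using finite[of P]
  proof (induction P rule: finite_induct)
    case (insert p P)
    obtain i0 j1 where p: "p = (i0, j1)" by (cases p)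
    have ex_other: "\<exists>y. y \<noteq> x" for x :: 'n
    proof (rule ccontr)
      assume "\<nexists>y. y \<noteq> x"
      then have "(UNIV :: 'n set) = {x}" by auto
      then have "CARD('n) = card {x}" by (rule arg_cong)
      with n show False by simp
    qed
    obtain i1 where i1: "i1 \<noteq> i0" using ex_other by blast
    obtain j2 where j2: "j2 \<noteq> j1" using ex_other by blast
    have "\<bar>dens (WP P) m - dens (upd (WP P) i0 j1 {0..<int m}) m\<bar> * ?D \<le> B"
      unfolding B_def using insert.hyps p i1 j2 K1
      by (intro dens_residues_entry_diff[where ?i1.0 = i1 and ?j2.0 = j2, OF spread ne m _ H _ L nav]) (auto simp: WP_def)
    moreover have "upd (WP P) i0 j1 {0..<int m} = WP (insert p P)" by (auto simp: WP_def p fun_eq_iff)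
    ultimately have "\<bar>dens (WP P) m - dens (WP (insert p P)) m\<bar> * ?D \<le> B" by simp
    moreover have "\<bar>dens (WP {}) m - dens (WP (insert p P)) m\<bar> * ?D
       \<le> (\<bar>dens (WP {}) m - dens (WP P) m\<bar> + \<bar>dens (WP P) m - dens (WP (insert p P)) m\<bar>) * ?D"
      using D0 by (intro mult_right_mono) auto
    ultimately show ?case using insert by (simp add: distrib_right)
  qed auto
  from this[of UNIV] have "\<bar>dens (WP {}) m - dens (WP UNIV) m\<bar> * ?D \<le> real (CARD('n)) ^ 2 * B"
    unfolding UNIV_Times_UNIV[symmetric] card_cartesian_product by (simp only: of_nat_mult power2_eq_square)
  also have "\<dots> \<le> real (CARD('n)) ^ 2 * ((K * tau m) ^ CARD('n) * L ^ 2)"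
  proof (intro mult_left_mono)
    have t: "real (tau m) \<ge> 1" using tau_ge_1[OF m] by simp
    \<comment> \<open>One factor \<open>tau m\<close> is given away so that the powers merge into
      exponent n.\<close>
    have "B \<le> K ^ 2 * L ^ 2 * (tau m) ^ 2 * (K * tau m) ^ (CARD('n) - 2)"
      unfolding B_def using t K1 by (intro mult_right_mono mult_left_mono) (auto simp: power2_eq_square)
    also have "\<dots> = (K * tau m) ^ (2 + (CARD('n) - 2)) * L ^ 2"
      unfolding power_add by (simp add: power_mult_distrib mult_ac)
    also have "2 + (CARD('n) - 2) = CARD('n)" using n by simp
    finally show "B \<le> (K * tau m) ^ CARD('n) * L ^ 2" .
  qed auto
  finally show ?thesis by (simp add: WP_def mult.assoc)
qed

section \<open>Divisibility of non-zero determinants\<close>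

lemma bezout_Gcd_image:
  fixes C :: "'a \<Rightarrow> int"
  assumes "finite S"
  shows "\<exists>y. Gcd (C ` S) = (\<Sum>j\<in>S. y j * C j)"
  using assms
proof (induction S rule: finite_induct)
  case (insert j S)
  then obtain y where y: "Gcd (C ` S) = (\<Sum>j\<in>S. y j * C j)" by blast
  obtain u v where uv: "u * C j + v * Gcd (C ` S) = gcd (C j) (Gcd (C ` S))"
    using bezout_int by blast
  let ?y = "\<lambda>k. if k = j then u else v * y k"
  have "(\<Sum>k\<in>insert j S. ?y k * C k) = u * C j + (\<Sum>k\<in>S. ?y k * C k)"
    using insert.hyps by simp
  also have "(\<Sum>k\<in>S. ?y k * C k) = v * (\<Sum>k\<in>S. y k * C k)"
    unfolding sum_distrib_left using insert.hyps by (intro sum.cong) auto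
  finally have "Gcd (C ` insert j S) = (\<Sum>k\<in>insert j S. ?y k * C k)"
    using uv y by simp
  then show ?case by (rule exI[of _ ?y])
qed simp

text \<open>Solving z = t A over the reals and subtracting the integer parts of t leaves a
  combination of the n rows with coefficients in [0, 1).\<close>

lemma reduce_mod_rows:
  fixes A :: "'n::finite \<Rightarrow> 'n \<Rightarrow> int" and z :: "'n \<Rightarrow> int"
  assumes "dt A \<noteq> 0" and H: "\<And>i j. \<bar>A i j\<bar> \<le> H"
  obtains c where "\<And>j. \<bar>z j - (\<Sum>i\<in>UNIV. c i * A i j)\<bar> \<le> int CARD('n) * H"
proof -
  define M :: "real^'n^'n" where "M = (\<chi> i j. of_int (A i j))"
  have "det M = of_int (dt A)"
    by (simp add: M_def dt_def det_def)
  then have "invertible M" using assms by (simp add: invertible_det_nz)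
  then obtain M' where M': "M' ** M = mat 1" by (auto simp: invertible_def)
  define t where "t = (\<lambda>i. \<Sum>k\<in>UNIV. of_int (z k) * M' $ k $ i)"
  have t: "(\<Sum>i\<in>UNIV. t i * of_int (A i j)) = of_int (z j)" for j
  proof -
    have "(\<Sum>i\<in>UNIV. t i * of_int (A i j)) = (\<Sum>k\<in>UNIV. of_int (z k) * (\<Sum>i\<in>UNIV. M' $ k $ i * of_int (A i j)))"
      unfolding t_def sum_distrib_right sum_distrib_left by (subst sum.swap) (simp add: mult.assoc)
    also have "\<dots> = (\<Sum>k\<in>UNIV. of_int (z k) * (M' ** M) $ k $ j)"
      by (simp add: matrix_matrix_mult_def M_def)
    also have "\<dots> = of_int (z j)"
      unfolding M' by (simp add: mat_def if_distrib cong: if_cong)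
    finally show ?thesis .
  qed
  show ?thesis
  proof (rule that[of "\<lambda>i. \<lfloor>t i\<rfloor>"])
    fix j
    have "real_of_int (z j - (\<Sum>i\<in>UNIV. \<lfloor>t i\<rfloor> * A i j)) = (\<Sum>i\<in>UNIV. (t i - \<lfloor>t i\<rfloor>) * of_int (A i j))"
      by (simp add: t[symmetric] left_diff_distrib sum_subtractf)
    also have "\<bar>\<dots>\<bar> \<le> (\<Sum>i\<in>UNIV. \<bar>(t i - \<lfloor>t i\<rfloor>) * of_int (A i j)\<bar>)" by (rule sum_abs)
    also have "\<dots> \<le> (\<Sum>i\<in>(UNIV::'n set). 1 * real_of_int H)"
      unfolding abs_mult
    proof (intro sum_mono mult_mono)
      fix i
      show "\<bar>t i - \<lfloor>t i\<rfloor>\<bar> \<le> 1" by linarith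
      show "\<bar>real_of_int (A i j)\<bar> \<le> real_of_int H" using H[of i j] by linarith
    qed auto
    finally have "real_of_int \<bar>z j - (\<Sum>i\<in>UNIV. \<lfloor>t i\<rfloor> * A i j)\<bar> \<le> real_of_int (int CARD('n) * H)" by simp
    then show "\<bar>z j - (\<Sum>i\<in>UNIV. \<lfloor>t i\<rfloor> * A i j)\<bar> \<le> int CARD('n) * H" by (simp only: of_int_le_iff)
  qed
qed

text \<open>
  The lattice \<open>m dvd \<Sum>j. x j * C j\<close> has index \<open>m / g\<close> and contains the independent rows of \<open>A\<close>, so every
  class modulo it has a representative of size at most \<open>n * H\<close>; translates of the lattice points in the
  box by these representatives are disjoint.
\<close>
lemma card_lattice_box_le:
  fixes A :: "'n::finite \<Rightarrow> 'n \<Rightarrow> int" and C :: "'n \<Rightarrow> int"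
  assumes "dt A \<noteq> 0" and bd: "\<And>i j. \<bar>A i j\<bar> \<le> H" and m: "m > 0"
    and C: "\<And>i. int m dvd (\<Sum>j\<in>UNIV. A i j * C j)"
  shows "int (card {x \<in> PiE UNIV (\<lambda>_. {-H..H}). int m dvd (\<Sum>j\<in>UNIV. x j * C j)}) * int m
     \<le> (2 * (int CARD('n) + 1) * H + 1) ^ CARD('n) * gcd (int m) (Gcd (range C))"
proof -
  let ?X = "{x \<in> PiE UNIV (\<lambda>_. {-H..H}). int m dvd (\<Sum>j\<in>UNIV. x j * C j)}"
  let ?n = "int CARD('n)"
  define g where "g = gcd (int m) (Gcd (range C))"
  have g: "g > 0" "g dvd int m" using m by (auto simp: g_def)
  then obtain m' where m': "int m = g * m'" by (auto elim: dvdE)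
  have m'0: "m' > 0" using m' g m by (metis of_nat_0_less_iff zero_less_mult_pos)
  obtain y where y: "Gcd (range C) = (\<Sum>j\<in>UNIV. y j * C j)" using bezout_Gcd_image[of UNIV C] by auto
  obtain u v where uv: "u * int m + v * Gcd (range C) = g" unfolding g_def using bezout_int by blast
  have H0: "H \<ge> 0" using bd by (meson abs_ge_zero order_trans)
  \<comment> \<open>By Bezout, the linear form takes the value \<open>c * g\<close> modulo
    \<open>m\<close> at \<open>c * v * y\<close>. The rows of \<open>A\<close> lie in the lattice,
    so subtracting them shortens this vector without changing its class.\<close>
  have "\<exists>w. (\<forall>j. \<bar>w j\<bar> \<le> ?n * H) \<and> int m dvd (\<Sum>j\<in>UNIV. w j * C j) - c * g" for c
  proof -
    obtain a where a: "\<And>j. \<bar>c * v * y j - (\<Sum>i\<in>UNIV. a i * A i j)\<bar> \<le> ?n * H"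
      using reduce_mod_rows[OF assms(1) bd, of "\<lambda>j. c * v * y j"] by blast
    define w where "w = (\<lambda>j. c * v * y j - (\<Sum>i\<in>UNIV. a i * A i j))"
    have "(\<Sum>j\<in>UNIV. w j * C j) = (\<Sum>j\<in>UNIV. c * v * (y j * C j)) - (\<Sum>j\<in>UNIV. (\<Sum>i\<in>UNIV. a i * A i j) * C j)"
      by (simp add: w_def left_diff_distrib sum_subtractf mult.assoc)
    also have "(\<Sum>j\<in>UNIV. c * v * (y j * C j)) = c * g - c * u * int m"
      unfolding sum_distrib_left[symmetric] y[symmetric] uv[symmetric] by (simp add: algebra_simps)
    also have "(\<Sum>j\<in>UNIV. (\<Sum>i\<in>UNIV. a i * A i j) * C j) = (\<Sum>i\<in>UNIV. a i * (\<Sum>j\<in>UNIV. A i j * C j))"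
      unfolding sum_distrib_right sum_distrib_left by (subst sum.swap) (simp add: mult.assoc)
    finally have "(\<Sum>j\<in>UNIV. w j * C j) - c * g = - (c * u * int m + (\<Sum>i\<in>UNIV. a i * (\<Sum>j\<in>UNIV. A i j * C j)))"
      by simp
    also have "int m dvd \<dots>" unfolding dvd_minus_iff by (intro dvd_add dvd_sum dvd_mult C) simp
    finally show ?thesis using a by (intro exI[of _ w]) (simp add: w_def)
  qed
  then obtain w where w: "\<And>c j. \<bar>w c j\<bar> \<le> ?n * H" "\<And>c. int m dvd (\<Sum>j\<in>UNIV. w c j * C j) - c * g"
    by metis
  let ?f = "\<lambda>(x, c) j. x j + w c j"
  \<comment> \<open>Room for a lattice vector of size H plus a representative of size n * H.\<close>
  let ?box = "PiE UNIV (\<lambda>_::'n. {- ((?n + 1) * H)..(?n + 1) * H})"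
  have inj: "inj_on ?f (?X \<times> {0..<m'})"
  proof (rule inj_onI, clarify)
    fix x c x' c'
    assume x: "x \<in> PiE UNIV (\<lambda>_. {-H..H})" "int m dvd (\<Sum>j\<in>UNIV. x j * C j)"
      and x': "x' \<in> PiE UNIV (\<lambda>_. {-H..H})" "int m dvd (\<Sum>j\<in>UNIV. x' j * C j)"
      and c: "c \<in> {0..<m'}" "c' \<in> {0..<m'}" and eq: "(\<lambda>j. x j + w c j) = (\<lambda>j. x' j + w c' j)"
    have *: "int m dvd (\<Sum>j\<in>UNIV. (x j + w c j) * C j) - c * g"
      if "int m dvd (\<Sum>j\<in>UNIV. x j * C j)" for x c
    proof -
      have "(\<Sum>j\<in>UNIV. (x j + w c j) * C j) - c * g = (\<Sum>j\<in>UNIV. x j * C j) + ((\<Sum>j\<in>UNIV. w c j * C j) - c * g)"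
        by (simp add: distrib_right sum.distrib)
      then show ?thesis using that w(2)[of c] by (simp only: dvd_add)
    qed
    have e: "x j + w c j = x' j + w c' j" for j using fun_cong[OF eq, of j] by simp
    have "int m dvd ((\<Sum>j\<in>UNIV. (x j + w c j) * C j) - c * g) - ((\<Sum>j\<in>UNIV. (x' j + w c' j) * C j) - c' * g)"
      by (intro dvd_diff * x x')
    then have "g * m' dvd g * (c' - c)" unfolding e m' by (simp add: algebra_simps)
    then have "m' dvd c' - c" using g by simp
    then have "c' mod m' = c mod m'" by (simp only: mod_eq_dvd_iff)
    with c have "c' = c" by simp
    then show "x = x' \<and> c = c'" using e by (auto simp: fun_eq_iff)
  qed
  have sub: "?f ` (?X \<times> {0..<m'}) \<subseteq> ?box"
  proof (rule image_subsetI)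
    fix z assume z: "z \<in> ?X \<times> {0..<m'}"
    obtain x c where xc: "z = (x, c)" by (cases z)
    show "?f z \<in> ?box"
      unfolding xc
    proof (clarsimp simp: PiE_iff)
      fix j
      have "\<bar>x j\<bar> \<le> H" using z by (auto simp: xc PiE_iff abs_le_iff minus_le_iff)
      then show "- ((?n + 1) * H) \<le> x j + w c j \<and> x j + w c j \<le> (?n + 1) * H"
        using w(1)[of c j] by (auto simp: algebra_simps abs_le_iff)
    qed
  qed
  have finbox: "finite ?box" by (intro finite_PiE) auto
  have "card (?f ` (?X \<times> {0..<m'})) \<le> card ?box" by (rule card_mono[OF finbox sub])
  then have "card ?X * nat m' \<le> card ?box"
    by (simp only: card_image[OF inj] card_cartesian_product card_atLeastLessThan_int) simp
  then have "int (card ?X * nat m') \<le> int (card ?box)" by (simp only: of_nat_le_iff)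
  moreover have "int (nat m') = m'" using m'0 by simp
  ultimately have "int (card ?X) * m' \<le> int (card ?box)" by (simp only: of_nat_mult)
  also have "int (card ?box) = (2 * (?n + 1) * H + 1) ^ CARD('n)"
    using H0 by (simp add: card_PiE algebra_simps)
  finally have "int (card ?X) * m' * g \<le> (2 * (?n + 1) * H + 1) ^ CARD('n) * g"
    using g by (intro mult_right_mono) auto
  then show ?thesis unfolding g_def[symmetric] unfolding m' by (simp only: mult_ac)
qed

section \<open>Resampling of whole rows\<close>

lemma resample_row:
  fixes W :: "'n::finite \<Rightarrow> 'n \<Rightarrow> int set" and g :: "_ \<Rightarrow> real"
  shows "real (card (PiE UNIV (W i))) * (\<Sum>A\<in>mats W. g A) = (\<Sum>A\<in>mats W. \<Sum>x\<in>PiE UNIV (W i). g (A(i := x)))"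
proof -
  let ?P = "PiE UNIV (W i)" and ?h = "\<lambda>(A, x). (A(i := x), A i)"
  have "(\<Sum>A\<in>mats W. \<Sum>x\<in>?P. g (A(i := x))) = (\<Sum>(A, x)\<in>mats W \<times> ?P. g (A(i := x)))"
    by (rule sum.cartesian_product)
  also have "\<dots> = (\<Sum>(A, x)\<in>mats W \<times> ?P. g A)"
    by (rule sum.reindex_bij_witness[of _ ?h ?h]) (auto simp: mats_def PiE_iff)
  also have "\<dots> = (\<Sum>A\<in>mats W. \<Sum>x\<in>?P. g A)"
    by (rule sum.cartesian_product[symmetric])
  finally show ?thesis
    by (simp add: sum_distrib_left)
qed

lemma resample_row_le:
  fixes W :: "'n::finite \<Rightarrow> 'n \<Rightarrow> int set" and g h :: "_ \<Rightarrow> real"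
  assumes fin: "\<And>j. finite (W i j)"
    and le: "\<And>A. A \<in> mats W \<Longrightarrow> (\<Sum>x\<in>PiE UNIV (W i). g (A(i := x))) \<le> real (card (PiE UNIV (W i))) * h A"
  shows "(\<Sum>A\<in>mats W. g A) \<le> (\<Sum>A\<in>mats W. h A)"
proof (cases "mats W = {}")
  case False
  let ?P = "PiE UNIV (W i)"
  have "?P \<noteq> {}" using False by (auto simp: mats_def PiE_eq_empty_iff)
  moreover have "finite ?P" by (intro finite_PiE fin) auto
  ultimately have pos: "real (card ?P) > 0" by (simp add: card_gt_0_iff)
  have "real (card ?P) * (\<Sum>A\<in>mats W. g A) \<le> real (card ?P) * (\<Sum>A\<in>mats W. h A)"
    unfolding resample_row sum_distrib_left[of _ h] by (intro sum_mono le)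
  then show ?thesis using pos by simp
qed auto

lemma tau_mono_dvd: "e dvd m \<Longrightarrow> m > 0 \<Longrightarrow> tau e \<le> tau m"
  unfolding tau_def by (intro card_mono finite_divisors) (auto intro: dvd_trans)

text \<open>Variant of \<open>gcd_le_sum_divisors\<close> for a vector with a non-zero coordinate.
  The condition \<open>C j \<noteq> 0\<close> is carried along because the induction in
  \<open>count_dvd_dt_nonzero\<close> controls only non-zero minors.\<close>

lemma gcd_Gcd_le_sum:
  fixes C :: "'n::finite \<Rightarrow> int"
  assumes m: "m > 0" and "C j \<noteq> 0"
  shows "real_of_int (gcd (int m) (Gcd (range C)))
     \<le> (\<Sum>j\<in>UNIV. \<Sum>e | e dvd m. real e * of_bool (int e dvd C j \<and> C j \<noteq> 0))"
proof -
  let ?e = "nat (gcd (int m) (Gcd (range C)))"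
  have e: "int ?e = gcd (int m) (Gcd (range C))" by simp
  have "?e dvd m" by (metis e gcd_dvd1 int_dvd_int_iff)
  have "gcd (int m) (Gcd (range C)) dvd C j" by (meson Gcd_dvd gcd_dvd2 dvd_trans rangeI)
  then have "int ?e dvd C j" unfolding e .
  have "real_of_int (gcd (int m) (Gcd (range C))) = real ?e * of_bool (int ?e dvd C j \<and> C j \<noteq> 0)"
    using \<open>int ?e dvd C j\<close> assms by simp
  also have "\<dots> \<le> (\<Sum>e | e dvd m. real e * of_bool (int e dvd C j \<and> C j \<noteq> 0))"
    using \<open>?e dvd m\<close> m by (intro member_le_sum) (auto simp: finite_divisors)
  also have "\<dots> \<le> (\<Sum>j\<in>UNIV. \<Sum>e | e dvd m. real e * of_bool (int e dvd C j \<and> C j \<noteq> 0))"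
    by (intro member_le_sum sum_nonneg) auto
  finally show ?thesis .
qed

text \<open>Induction on the free rows \<open>S\<close>, resampling one whole row at a time. The
  modulus may be arbitrarily large compared with \<open>H\<close>: an admissible row with non-zero
  determinant completes a non-singular matrix all of whose rows lie in the lattice of admissible
  rows, and without such a row nothing is counted. Per row, the factor n comes from the choice of a
  cofactor, (n + 1)^n from the enlarged box, and \<open>tau m\<close> from the choice of a divisor
  of \<open>m\<close>.\<close>

lemma count_dvd_dt_nonzero:
  fixes R S :: "'n::finite set"
  assumes "H \<ge> 1" and "m > 0" and "S = - R"
  shows "real (card {A \<in> mats (\<lambda>_ _. {-H..H}). int m dvd dt (unit_rows R s A) \<and> dt (unit_rows R s A) \<noteq> 0}) * real m
     \<le> (real CARD('n) * real (CARD('n) + 1) ^ CARD('n) * tau m) ^ card S * real (card (mats (\<lambda>(_::'n) (_::'n). {-H..H})))"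
  using finite[of S] assms(2,3)
proof (induction S arbitrary: R s m rule: finite_induct)
  case empty
  then have R: "R = UNIV" by auto
  let ?W = "\<lambda>(_::'n) (_::'n). {-H..H}"
  have u: "unit_rows R s A = (\<lambda>i. unit_row (s i))" for A by (simp add: unit_rows_def R)
  let ?E = "{A \<in> mats ?W. int m dvd dt (unit_rows R s A) \<and> dt (unit_rows R s A) \<noteq> 0}"
  have fin: "finite (mats ?W)" by (rule finite_mats) auto
  show ?case
  proof (cases "?E = {}")
    case False
    then have "int m dvd dt (\<lambda>i. unit_row (s i))" "dt (\<lambda>i. unit_row (s i)) \<noteq> 0" unfolding u by auto
    then have "m = 1" using dt_unit_rows_bij[of s] dt_unit_rows_not_bij[of s] by (cases "bij s") (auto simp: abs_if split: if_splits)
    moreover have "card ?E \<le> card (mats ?W)" by (intro card_mono fin) auto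
    ultimately show ?thesis by simp
  next
    case True
    then show ?thesis unfolding True by simp
  qed
next
  case (insert i S)
  let ?W = "\<lambda>(_::'n) (_::'n). {-H..H}" and ?n = "CARD('n)"
  let ?K = "real (?n + 1) ^ ?n" and ?N = "real (card (mats ?W))"
  let ?P = "PiE UNIV (?W i)"
  let ?B = "real ?n * ?K * tau m"
  let ?C = "\<lambda>A j. dt (unit_rows (insert i R) (s(i := j)) A)"
  have iR: "i \<notin> R" and SR: "S = - insert i R" using insert.hyps insert.prems by auto
  have m: "m > 0" using insert.prems by simp
  have fin: "finite (mats ?W)" by (rule finite_mats) auto
  have finP: "finite ?P" by (intro finite_PiE) auto
  have cP: "real (card ?P) = real_of_int (2 * H + 1) ^ ?n" using assms(1) by (simp add: card_PiE)
  have dtC: "dt ((unit_rows R s A)(i := x)) = (\<Sum>j\<in>UNIV. x j * ?C A j)" for A x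
    by (subst dt_row_expand) (simp only: unit_rows_insert)
  have uu: "unit_rows R s (A(i := x)) = (unit_rows R s A)(i := x)" for A x
    using iR by (auto simp: unit_rows_def)
  have "real (card {A \<in> mats ?W. int m dvd dt (unit_rows R s A) \<and> dt (unit_rows R s A) \<noteq> 0}) * real m
      = (\<Sum>A\<in>mats ?W. of_bool (int m dvd dt (unit_rows R s A) \<and> dt (unit_rows R s A) \<noteq> 0) * real m)"
    by (simp only: sum_distrib_right[symmetric] sum_of_bool_card[OF fin])
  also have "\<dots> \<le> (\<Sum>A\<in>mats ?W. ?K * (\<Sum>j\<in>UNIV. \<Sum>e | e dvd m. real e * of_bool (int e dvd ?C A j \<and> ?C A j \<noteq> 0)))"
  proof (rule resample_row_le[where i = i])
    fix A assume A: "A \<in> mats ?W"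
    let ?G = "\<Sum>j\<in>UNIV. \<Sum>e | e dvd m. real e * of_bool (int e dvd ?C A j \<and> ?C A j \<noteq> 0)"
    let ?E = "{x \<in> ?P. int m dvd (\<Sum>j\<in>UNIV. x j * ?C A j) \<and> (\<Sum>j\<in>UNIV. x j * ?C A j) \<noteq> 0}"
    have "(\<Sum>x\<in>?P. of_bool (int m dvd dt (unit_rows R s (A(i := x))) \<and> dt (unit_rows R s (A(i := x))) \<noteq> 0) * real m)
       = real (card ?E) * real m"
      unfolding uu dtC by (simp only: sum_distrib_right[symmetric] sum_of_bool_card[OF finP])
    also have "\<dots> \<le> real (card ?P) * (?K * ?G)"
    proof (cases "?E = {}")
      case True
      then show ?thesis unfolding True by (auto intro!: mult_nonneg_nonneg sum_nonneg)
    next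
      case False
      then obtain x0 where x0: "x0 \<in> ?P" "int m dvd (\<Sum>j\<in>UNIV. x0 j * ?C A j)" "(\<Sum>j\<in>UNIV. x0 j * ?C A j) \<noteq> 0"
        by blast
      then obtain j where j: "?C A j \<noteq> 0" by (metis (mono_tags, lifting) mult_zero_right sum.neutral)
      define B where "B = (unit_rows R s A)(i := x0)"
      have B0: "dt B \<noteq> 0" using x0 by (simp add: B_def dtC)
      have Bbd: "\<bar>B k l\<bar> \<le> H" for k l
        using x0(1) A assms(1) by (auto simp: B_def unit_rows_def unit_row_def mats_def PiE_iff abs_le_iff minus_le_iff)
      have Bdvd: "int m dvd (\<Sum>j\<in>UNIV. B k j * ?C A j)" for k
      proof (cases "k = i")
        case True
        then show ?thesis using x0 by (simp add: B_def)
      next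
        case False
        have "(\<Sum>j\<in>UNIV. B k j * ?C A j) = dt ((unit_rows R s A)(i := B k))" by (simp only: dtC)
        also have "\<dots> = 0" using False by (intro dt_same_rows[of i k]) (auto simp: B_def)
        finally show ?thesis by simp
      qed
      have "card ?E \<le> card {x \<in> ?P. int m dvd (\<Sum>j\<in>UNIV. x j * ?C A j)}"
        using finP by (intro card_mono) auto
      then have "int (card ?E) * int m \<le> int (card {x \<in> ?P. int m dvd (\<Sum>j\<in>UNIV. x j * ?C A j)}) * int m"
        by (intro mult_right_mono) auto
      also have "\<dots> \<le> (2 * (int ?n + 1) * H + 1) ^ ?n * gcd (int m) (Gcd (range (?C A)))"
        by (rule card_lattice_box_le[OF B0 Bbd m Bdvd])
      finally have "real_of_int (int (card ?E) * int m) \<le> real_of_int ((2 * (int ?n + 1) * H + 1) ^ ?n * gcd (int m) (Gcd (range (?C A))))"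
        by (simp only: of_int_le_iff)
      then have "real (card ?E) * real m \<le> real_of_int (2 * (int ?n + 1) * H + 1) ^ ?n * real_of_int (gcd (int m) (Gcd (range (?C A))))"
        by (simp only: of_int_mult of_int_power of_int_of_nat_eq)
      also have "\<dots> \<le> (real (?n + 1) * real_of_int (2 * H + 1)) ^ ?n * ?G"
      proof (intro mult_mono power_mono gcd_Gcd_le_sum[where C = "?C A" and j = j, OF m j])
        show "real_of_int (2 * (int ?n + 1) * H + 1) \<le> real (?n + 1) * real_of_int (2 * H + 1)"
          by (simp add: algebra_simps)
        show "0 \<le> real_of_int (2 * (int ?n + 1) * H + 1)" using assms(1) by simp
      qed (use assms(1) in auto)
      also have "\<dots> = real (card ?P) * (?K * ?G)" by (simp only: cP power_mult_distrib mult_ac)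
      finally show ?thesis .
    qed
    finally show "(\<Sum>x\<in>?P. of_bool (int m dvd dt (unit_rows R s (A(i := x))) \<and> dt (unit_rows R s (A(i := x))) \<noteq> 0) * real m)
        \<le> real (card ?P) * (?K * ?G)" .
  qed auto
  also have "\<dots> = ?K * (\<Sum>j\<in>UNIV. \<Sum>e | e dvd m.
       real (card {A \<in> mats ?W. int e dvd ?C A j \<and> ?C A j \<noteq> 0}) * real e)"
    unfolding sum_distrib_left[symmetric] sum_of_bool_card[OF fin, symmetric]
    by (simp only: sum_distrib_left sum_distrib_right sum.swap[of _ "mats ?W"] mult.commute[of "of_bool _"])
  also have "\<dots> \<le> ?K * (\<Sum>j\<in>(UNIV::'n set). \<Sum>e | e dvd m. ?B ^ card S * ?N)"
  proof (intro mult_left_mono sum_mono)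
    fix j e assume e: "e \<in> {e. e dvd m}"
    then have e0: "e > 0" using m by (auto intro: Nat.gr0I)
    have "real (card {A \<in> mats ?W. int e dvd ?C A j \<and> ?C A j \<noteq> 0}) * real e
       \<le> (real ?n * ?K * tau e) ^ card S * ?N" by (rule insert.IH[OF e0 SR])
    also have "\<dots> \<le> ?B ^ card S * ?N"
      using tau_mono_dvd[of e m] e m by (intro mult_right_mono power_mono mult_left_mono) auto
    finally show "real (card {A \<in> mats ?W. int e dvd ?C A j \<and> ?C A j \<noteq> 0}) * real e \<le> ?B ^ card S * ?N" .
  qed auto
  also have "\<dots> = ?B ^ card (insert i S) * ?N"
    using insert.hyps by (simp add: tau_def)
  finally show ?case .
qed

section \<open>Local densities at primes\<close>

text \<open>Linear algebra over the field with \<open>p\<close> elements, written as congruences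
  between integer vectors so that \<open>p\<close> can vary freely.\<close>

definition in_span :: "nat \<Rightarrow> 'n set \<Rightarrow> ('n \<Rightarrow> 'n \<Rightarrow> int) \<Rightarrow> ('n \<Rightarrow> int) \<Rightarrow> bool" where
  "in_span p R A x \<longleftrightarrow> (\<exists>c. \<forall>j. int p dvd x j - (\<Sum>i\<in>R. c i * A i j))"

definition indep_rows :: "nat \<Rightarrow> 'n set \<Rightarrow> ('n \<Rightarrow> 'n \<Rightarrow> int) \<Rightarrow> bool" where
  "indep_rows p R A \<longleftrightarrow> (\<forall>c. (\<forall>j. int p dvd (\<Sum>i\<in>R. c i * A i j)) \<longrightarrow> (\<forall>i\<in>R. int p dvd c i))"

definition merge_rows :: "'n set \<Rightarrow> ('n \<Rightarrow> 'n \<Rightarrow> int) \<Rightarrow> ('n \<Rightarrow> 'n \<Rightarrow> int) \<Rightarrow> 'n \<Rightarrow> 'n \<Rightarrow> int" where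
  "merge_rows R A B = (\<lambda>i. if i \<in> R then A i else B i)"

abbreviation cube :: "nat \<Rightarrow> ('n \<Rightarrow> int) set" where
  "cube N \<equiv> PiE UNIV (\<lambda>_. {0..<int N})"

lemma finite_cube: "finite (cube N :: ('n::finite \<Rightarrow> int) set)"
  by (intro finite_PiE) auto

lemma card_cube: "card (cube N :: ('n::finite \<Rightarrow> int) set) = N ^ CARD('n)"
  by (simp add: card_PiE)

lemma in_span_cong:
  assumes "\<And>j. int p dvd x j - y j"
  shows "in_span p R A x \<longleftrightarrow> in_span p R A y"
proof -
  have "int p dvd x j - s \<longleftrightarrow> int p dvd y j - s" for s j
  proof -
    have "x j - s = (x j - y j) + (y j - s)" by simp
    then show ?thesis using assms[of j] by (metis dvd_add_right_iff)
  qed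
  then show ?thesis by (simp add: in_span_def)
qed

text \<open>Coefficient vectors modulo \<open>p\<close> parametrise the span, injectively by
  independence. The translate by \<open>w\<close> is needed in \<open>unit_mass_2\<close>, where
  extracting a factor \<open>p\<close> leaves a shifted vector.\<close>

lemma card_in_span_translate:
  fixes A :: "'n::finite \<Rightarrow> 'n \<Rightarrow> int"
  assumes p: "p > 0" and ind: "indep_rows p R A"
  shows "card {y \<in> cube p. in_span p R A (\<lambda>j. w j + y j)} = p ^ card R"
proof -
  let ?C = "PiE R (\<lambda>_. {0..<int p})"
  let ?s = "\<lambda>c j. \<Sum>i\<in>R. c i * A i j"
  let ?f = "\<lambda>c j. (?s c j - w j) mod int p"
  have inj: "inj_on ?f ?C"
  proof (rule inj_onI)
    fix c c' assume c: "c \<in> ?C" "c' \<in> ?C" and eq: "?f c = ?f c'"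
    have z: "int p dvd (\<Sum>i\<in>R. (c i - c' i) * A i j)" for j
    proof -
      have "int p dvd (?s c j - w j) - (?s c' j - w j)" using fun_cong[OF eq, of j] by (simp add: mod_eq_dvd_iff)
      then show ?thesis by (simp add: left_diff_distrib sum_subtractf)
    qed
    have d: "int p dvd c i - c' i" if "i \<in> R" for i
      by (rule ind[unfolded indep_rows_def, rule_format, OF z that])
    show "c = c'"
    proof (rule PiE_ext[OF c])
      fix i assume i: "i \<in> R"
      have "c i mod int p = c' i mod int p" using d[OF i] by (simp add: mod_eq_dvd_iff)
      moreover have "c i \<in> {0..<int p}" "c' i \<in> {0..<int p}" using c i by (auto simp: PiE_iff)
      ultimately show "c i = c' i" by simp
    qed
  qed
  have "?f ` ?C = {y \<in> cube p. in_span p R A (\<lambda>j. w j + y j)}"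
  proof (intro equalityI subsetI)
    fix z assume "z \<in> ?f ` ?C"
    then obtain c where z: "z = ?f c" by (rule imageE)
    have "?f c \<in> cube p" using p by (auto simp: PiE_iff)
    moreover have "in_span p R A (\<lambda>j. w j + ?f c j)"
      unfolding in_span_def
    proof (intro exI allI)
      fix j
      have "int p dvd (?s c j - w j) mod int p - (?s c j - w j)" by (simp add: mod_eq_dvd_iff[symmetric])
      then show "int p dvd w j + ?f c j - ?s c j" by (simp add: algebra_simps)
    qed
    ultimately show "z \<in> {y \<in> cube p. in_span p R A (\<lambda>j. w j + y j)}" unfolding z by (intro CollectI conjI)
  next
    fix y assume "y \<in> {y \<in> cube p. in_span p R A (\<lambda>j. w j + y j)}"
    then have y: "y \<in> cube p" "in_span p R A (\<lambda>j. w j + y j)" by auto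
    then obtain c where c: "\<And>j. int p dvd w j + y j - ?s c j" by (auto simp: in_span_def)
    let ?c = "restrict (\<lambda>i. c i mod int p) R"
    have yc: "?f ?c = y"
    proof
      fix j
      have "[?s ?c j = ?s c j] (mod int p)" by (intro cong_sum cong_mult) (auto simp: cong_def)
      moreover have "[?s c j = w j + y j] (mod int p)" using c[of j] by (simp add: cong_iff_dvd_diff dvd_diff_commute)
      ultimately have "[?s ?c j - w j = w j + y j - w j] (mod int p)" by (intro cong_diff cong_refl) (rule cong_trans)
      then have "?f ?c j = y j mod int p" by (simp add: cong_def)
      then show "?f ?c j = y j" using y(1) by (simp add: PiE_iff)
    qed
    have cC: "?c \<in> ?C" using p by auto
    show "y \<in> ?f ` ?C" using imageI[OF cC, of ?f] unfolding yc .
  qed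
  then have "card {y \<in> cube p. in_span p R A (\<lambda>j. w j + y j)} = card ?C"
    using card_image[OF inj] by simp
  then show ?thesis by (simp add: card_PiE)
qed

text \<open>Base-p digits: in the applications \<open>y\<close> alone decides membership in the span
  modulo \<open>p\<close>, while \<open>w\<close> stays free.\<close>

lemma sum_cube_square:
  fixes g :: "('n::finite \<Rightarrow> int) \<Rightarrow> real"
  assumes "p > 0"
  shows "(\<Sum>x\<in>cube (p ^ 2). g x) = (\<Sum>y\<in>cube p. \<Sum>w\<in>cube p. g (\<lambda>j. y j + int p * w j))"
proof -
  have *: "y + int p * w < int p * int p" if "y < int p" "w < int p" for y w
  proof -
    have "y + int p * w < int p + int p * (int p - 1)"
      using that by (intro add_less_le_mono mult_left_mono) auto
    then show ?thesis by (simp add: algebra_simps)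
  qed
  have d: "x div int p < int p" if "x < int p * int p" for x
  proof (rule ccontr)
    assume "\<not> x div int p < int p"
    then have "int p * int p \<le> int p * (x div int p)" by (intro mult_left_mono) auto
    also have "\<dots> \<le> x" using mult_div_mod_eq[of "int p" x] pos_mod_sign[of "int p" x] assms by linarith
    finally show False using that by simp
  qed
  have "(\<Sum>y\<in>cube p. \<Sum>w\<in>cube p. g (\<lambda>j. y j + int p * w j))
      = (\<Sum>(y, w)\<in>cube p \<times> cube p. g (\<lambda>j. y j + int p * w j))"
    by (rule sum.cartesian_product)
  also have "\<dots> = (\<Sum>x\<in>cube (p ^ 2). g x)"
    by (rule sum.reindex_bij_witness[of _ "\<lambda>x. (\<lambda>j. x j mod int p, \<lambda>j. x j div int p)" "\<lambda>(y, w) j. y j + int p * w j"])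
       (use assms in \<open>auto simp: PiE_iff fun_eq_iff power2_eq_square pos_imp_zdiv_nonneg_iff intro!: * d\<close>)
  finally show ?thesis by simp
qed

lemma dvd_in_span_shift:
  "in_span p R A (\<lambda>j. y j + int p * w j) \<longleftrightarrow> in_span p R A y"
  by (rule in_span_cong) simp

lemma card_in_span_square:
  fixes A :: "'n::finite \<Rightarrow> 'n \<Rightarrow> int"
  assumes p: "p > 0" and ind: "indep_rows p R A"
  shows "real (card {x \<in> cube (p ^ 2). in_span p R A x}) = real p ^ CARD('n) * real p ^ card R"
proof -
  have "real (card {x \<in> cube (p ^ 2). in_span p R A x}) = (\<Sum>x\<in>cube (p ^ 2). of_bool (in_span p R A x))"
    by (simp only: sum_of_bool_card[OF finite_cube])
  also have "\<dots> = (\<Sum>y\<in>cube p. \<Sum>w\<in>(cube p :: ('n \<Rightarrow> int) set). of_bool (in_span p R A y))"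
    unfolding sum_cube_square[OF p] dvd_in_span_shift ..
  also have "\<dots> = real p ^ CARD('n) * (\<Sum>y\<in>cube p. of_bool (in_span p R A y))"
    by (simp only: sum_constant card_cube sum_distrib_left[symmetric] of_nat_power)
  also have "(\<Sum>y\<in>cube p. of_bool (in_span p R A y)) = real (p ^ card R)"
    unfolding sum_of_bool_card[OF finite_cube] using card_in_span_translate[OF p ind, of "\<lambda>_. 0"] by simp
  finally show ?thesis by simp
qed

lemma indep_rows_insert:
  assumes p: "prime p" and ind: "indep_rows p R A" and i: "i \<notin> R" and fin: "finite R" and x: "\<not> in_span p R A x"
  shows "indep_rows p (insert i R) (A(i := x))"
  unfolding indep_rows_def
proof (intro allI impI)
  fix c assume c: "\<forall>j. int p dvd (\<Sum>k\<in>insert i R. c k * (A(i := x)) k j)"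
  have s: "(\<Sum>k\<in>insert i R. c k * (A(i := x)) k j) = c i * x j + (\<Sum>k\<in>R. c k * A k j)" for j
  proof -
    have "(\<Sum>k\<in>R. c k * (A(i := x)) k j) = (\<Sum>k\<in>R. c k * A k j)" using i by (intro sum.cong) auto
    then show ?thesis using i fin by simp
  qed
  have ci: "int p dvd c i"
  proof (rule ccontr)
    assume "\<not> int p dvd c i"
    then have "coprime (c i) (int p)" using p by (metis coprime_commute prime_imp_coprime prime_nat_int_transfer)
    then obtain u where u: "[c i * u = 1] (mod int p)" using cong_solve_coprime_int by blast
    have "in_span p R A x"
      unfolding in_span_def
    proof (intro exI allI)
      fix j
      have "int p dvd u * (c i * x j + (\<Sum>k\<in>R. c k * A k j))" using c unfolding s by (intro dvd_mult) auto
      moreover have "int p dvd (1 - c i * u) * x j" using u by (intro dvd_mult2) (simp add: cong_iff_dvd_diff dvd_diff_commute)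
      ultimately have "int p dvd u * (c i * x j + (\<Sum>k\<in>R. c k * A k j)) + (1 - c i * u) * x j" by (rule dvd_add)
      also have "\<dots> = x j - (\<Sum>k\<in>R. (- u * c k) * A k j)"
        by (simp add: algebra_simps sum_distrib_left sum_negf)
      finally show "int p dvd x j - (\<Sum>k\<in>R. (- u * c k) * A k j)" .
    qed
    with x show False by simp
  qed
  have "\<forall>j. int p dvd (\<Sum>k\<in>R. c k * A k j)"
  proof
    fix j
    have "int p dvd (c i * x j + (\<Sum>k\<in>R. c k * A k j)) - c i * x j"
      using c ci unfolding s by (intro dvd_diff dvd_mult2) auto
    then show "int p dvd (\<Sum>k\<in>R. c k * A k j)" by simp
  qed
  then have "\<forall>k\<in>R. int p dvd c k" using ind by (simp add: indep_rows_def)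
  with ci show "\<forall>k\<in>insert i R. int p dvd c k" by simp
qed

text \<open>By counting, n independent rows reach every class modulo \<open>p\<close>. Hence some
  integer matrix \<open>c\<close> makes the product of \<open>c\<close> and \<open>A\<close> the
  identity modulo \<open>p\<close>, and the determinant is invertible there.\<close>

lemma indep_rows_UNIV_dt:
  fixes A :: "'n::finite \<Rightarrow> 'n \<Rightarrow> int"
  assumes p: "p > 1" and ind: "indep_rows p UNIV A"
  shows "\<not> int p dvd dt A"
proof
  assume dv: "int p dvd dt A"
  have "card {y \<in> cube p. in_span p UNIV A (\<lambda>j. 0 + y j)} = card (cube p :: ('n \<Rightarrow> int) set)"
    using card_in_span_translate[of p UNIV A "\<lambda>_. 0"] p ind by (simp add: card_cube)
  then have all: "{y \<in> cube p. in_span p UNIV A (\<lambda>j. 0 + y j)} = cube p"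
    by (intro card_subset_eq finite_cube) auto
  have "in_span p UNIV A (unit_row k)" for k :: 'n
  proof -
    have "unit_row k \<in> (cube p :: ('n \<Rightarrow> int) set)" using p by (auto simp: PiE_iff unit_row_def)
    then show ?thesis using all by auto
  qed
  then obtain c where c: "\<And>k j. int p dvd unit_row k j - (\<Sum>i\<in>UNIV. c k i * A i j)"
    unfolding in_span_def by metis
  have "[dt (\<lambda>k j. \<Sum>i\<in>UNIV. c k i * A i j) = dt (\<lambda>k. unit_row k :: 'n \<Rightarrow> int)] (mod int p)"
    by (intro dt_cong) (metis c cong_iff_dvd_diff cong_sym)
  then have "[dt c * dt A = dt (\<lambda>k. unit_row k :: 'n \<Rightarrow> int)] (mod int p)" unfolding dt_mult .
  moreover have "int p dvd dt c * dt A" using dv by simp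
  ultimately have "int p dvd dt (\<lambda>k. unit_row k :: 'n \<Rightarrow> int)" by (simp add: cong_dvd_iff)
  then have "int p dvd 1" using dt_unit_rows_bij[OF bij_id, where 'a = 'n] by (simp add: abs_if dvd_minus_iff split: if_splits)
  with p show False by simp
qed

text \<open>Row operations with the fixed rows remove the combination from row \<open>i\<close> and
  leave \<open>p * w\<close>, from which \<open>p\<close> is extracted.\<close>

lemma dt_merge_span:
  fixes A :: "'n::finite \<Rightarrow> 'n \<Rightarrow> int"
  assumes i: "i \<notin> R" and x: "\<And>j. x j = (\<Sum>k\<in>R. c k * A k j) + int p * w j"
  shows "dt (merge_rows (insert i R) (A(i := x)) B) = int p * dt (merge_rows (insert i R) (A(i := w)) B)"
proof -
  let ?M = "merge_rows R A B"
  have m: "merge_rows (insert i R) (A(i := x)) B = ?M(i := x)" for x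
    using i by (auto simp: merge_rows_def fun_eq_iff)
  have x': "x = (\<lambda>j. int p * w j + (\<Sum>k\<in>R. c k * ?M k j))"
    using x by (auto simp: merge_rows_def fun_eq_iff)
  have "dt (?M(i := x)) = dt (?M(i := (\<lambda>j. int p * w j)))"
    unfolding x' by (rule dt_row_sub_sum[OF i])
  then show ?thesis unfolding m dt_row_scale .
qed

lemma in_spanE:
  assumes "in_span p R A x"
  obtains c w where "\<And>j. x j = (\<Sum>k\<in>R. c k * A k j) + int p * w j"
proof -
  obtain c where "\<And>j. int p dvd x j - (\<Sum>k\<in>R. c k * A k j)" using assms by (auto simp: in_span_def)
  then obtain w where "\<And>j. x j - (\<Sum>k\<in>R. c k * A k j) = int p * w j" unfolding dvd_def by metis
  then show ?thesis by (intro that[of c w]) (simp add: algebra_simps)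
qed

lemma merge_rows_upd:
  "i \<notin> R \<Longrightarrow> merge_rows R A (B(i := x)) = merge_rows (insert i R) (A(i := x)) B"
  by (auto simp: merge_rows_def fun_eq_iff)

section \<open>Completions of given independent rows\<close>

context
  fixes p :: nat
  assumes p: "prime p"
begin

text \<open>The sum runs over complete matrices \<open>B\<close>, although the rows in
  \<open>R\<close> are overwritten, so that one normalising factor serves every
  \<open>R\<close>.\<close>

definition unit_mass :: "'n::finite set \<Rightarrow> ('n \<Rightarrow> 'n \<Rightarrow> int) \<Rightarrow> nat \<Rightarrow> real" where
  "unit_mass R A e = (\<Sum>B\<in>mats (\<lambda>_ _. {0..<int (p ^ 2)}). of_bool (\<not> int p ^ e dvd dt (merge_rows R A B)))"

lemma unit_mass_insert:
  fixes A :: "'n::finite \<Rightarrow> 'n \<Rightarrow> int"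
  assumes "i \<notin> R"
  shows "real p ^ (2 * CARD('n)) * unit_mass R A e = (\<Sum>x\<in>cube (p ^ 2). unit_mass (insert i R) (A(i := x)) e)"
proof -
  have "real (card (cube (p ^ 2) :: ('n \<Rightarrow> int) set)) * unit_mass R A e
     = (\<Sum>B\<in>mats (\<lambda>_ _. {0..<int (p ^ 2)}). \<Sum>x\<in>cube (p ^ 2). of_bool (\<not> int p ^ e dvd dt (merge_rows R A (B(i := x)))))"
    unfolding unit_mass_def
    by (rule resample_row[of "\<lambda>_ _. {0..<int (p ^ 2)}" i "\<lambda>B. of_bool (\<not> int p ^ e dvd dt (merge_rows R A B))"])
  also have "\<dots> = (\<Sum>x\<in>cube (p ^ 2). unit_mass (insert i R) (A(i := x)) e)"
    unfolding unit_mass_def merge_rows_upd[OF assms] by (rule sum.swap)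
  finally show ?thesis unfolding card_cube unfolding of_nat_power power_mult[symmetric] .
qed

lemma unit_mass_UNIV:
  fixes A :: "'n::finite \<Rightarrow> 'n \<Rightarrow> int"
  assumes "indep_rows p UNIV A" "e > 0"
  shows "unit_mass UNIV A e = real (card (mats (\<lambda>(_::'n) (_::'n). {0..<int (p ^ 2)})))"
proof -
  have "\<not> int p dvd dt A" using assms p by (intro indep_rows_UNIV_dt prime_gt_1_nat)
  then have "\<not> int p ^ e dvd dt A" using assms(2) by (meson dvd_power dvd_trans)
  then show ?thesis by (simp add: unit_mass_def merge_rows_def)
qed

lemma unit_mass_in_span_1:
  fixes A :: "'n::finite \<Rightarrow> 'n \<Rightarrow> int"
  assumes "in_span p R A x" "i \<notin> R"
  shows "unit_mass (insert i R) (A(i := x)) 1 = 0"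
proof -
  obtain c w where xw: "\<And>j. x j = (\<Sum>k\<in>R. c k * A k j) + int p * w j" using in_spanE[OF assms(1)] by metis
  show ?thesis unfolding unit_mass_def dt_merge_span[OF assms(2) xw] by simp
qed

text \<open>With k free rows, a new row avoids the span of the fixed ones with probability 1 - 1 /
  p^k; inside the span the determinant becomes divisible by \<open>p\<close>.\<close>

lemma unit_mass_1:
  fixes A :: "'n::finite \<Rightarrow> 'n \<Rightarrow> int"
  assumes "S = - R" "indep_rows p R A"
  shows "unit_mass R A 1 = (\<Prod>j=1..card S. 1 - 1 / real p ^ j) * real (card (mats (\<lambda>(_::'n) (_::'n). {0..<int (p ^ 2)})))"
  using finite[of S] assms
proof (induction S arbitrary: R A rule: finite_induct)
  case empty
  then have "R = UNIV" by auto
  then show ?case using empty unit_mass_UNIV[of A 1] by simp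
next
  case (insert i S)
  let ?M = "real (card (mats (\<lambda>(_::'n) (_::'n). {0..<int (p ^ 2)})))" and ?G = "\<lambda>k. \<Prod>j=1..k. 1 - 1 / real p ^ j"
  have p0: "p > 0" using p by (simp add: prime_gt_0_nat)
  have iR: "i \<notin> R" and SR: "S = - insert i R" using insert.hyps insert.prems by auto
  have fin: "finite (cube (p ^ 2) :: ('n \<Rightarrow> int) set)" by (rule finite_cube)
  have cS: "card (insert i S) = Suc (card S)" and cR: "CARD('n) = card R + Suc (card S)"
  proof -
    show "card (insert i S) = Suc (card S)" using insert.hyps by simp
    then show "CARD('n) = card R + Suc (card S)"
      using insert.prems(1) card_mono[of UNIV R] by (simp add: Compl_eq_Diff_UNIV card_Diff_subset)
  qed
  have "real p ^ (2 * CARD('n)) * unit_mass R A 1 = (\<Sum>x\<in>cube (p ^ 2). of_bool (\<not> in_span p R A x) * (?G (card S) * ?M))"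
    unfolding unit_mass_insert[OF iR]
  proof (intro sum.cong refl)
    fix x :: "'n \<Rightarrow> int"
    show "unit_mass (insert i R) (A(i := x)) 1 = of_bool (\<not> in_span p R A x) * (?G (card S) * ?M)"
    proof (cases "in_span p R A x")
      case True
      then show ?thesis using unit_mass_in_span_1[OF True iR] by simp
    next
      case False
      have i: "indep_rows p (insert i R) (A(i := x))"
        by (rule indep_rows_insert[OF p insert.prems(2) iR _ False]) simp
      show ?thesis unfolding insert.IH[OF SR i] using False by simp
    qed
  qed
  also have "\<dots> = (real (card (cube (p ^ 2) :: ('n \<Rightarrow> int) set)) - real (card {x \<in> cube (p ^ 2). in_span p R A x})) * (?G (card S) * ?M)"
  proof -
    have "(\<Sum>x\<in>cube (p ^ 2). of_bool (\<not> in_span p R A x)) = (\<Sum>x\<in>(cube (p ^ 2) :: ('n \<Rightarrow> int) set). 1 - of_bool (in_span p R A x) :: real)"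
      by (intro sum.cong) auto
    then show ?thesis unfolding sum_distrib_right[symmetric] sum_subtractf sum_of_bool_card[OF fin] by simp
  qed
  also have "\<dots> = (real p ^ (2 * CARD('n)) - real p ^ CARD('n) * real p ^ card R) * (?G (card S) * ?M)"
    unfolding card_in_span_square[OF p0 insert.prems(2)] card_cube by (simp add: power_mult)
  also have "real p ^ (2 * CARD('n)) - real p ^ CARD('n) * real p ^ card R = real p ^ (2 * CARD('n)) * (1 - 1 / real p ^ Suc (card S))"
  proof -
    have "(a * b) ^ 2 - a * b * a = (a * b) ^ 2 * (1 - 1 / b)" if "b > 0" for a b :: real
      using that by (simp add: field_simps power2_eq_square)
    from this[of "real p ^ Suc (card S)" "real p ^ card R"] p0 show ?thesis
      unfolding cR power_even_eq power_add by (simp only: zero_less_power of_nat_0_less_iff)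
  qed
  finally have "unit_mass R A 1 = (1 - 1 / real p ^ Suc (card S)) * (?G (card S) * ?M)"
    using p0 by simp
  then show ?case unfolding cS by (simp add: mult_ac)
qed

text \<open>
  A random new row lies outside the span of the fixed rows modulo \<open>p\<close>, or a factor \<open>p\<close> can be extracted from it and the remaining
  determinant must be a unit. With \<open>q = 1 / p\<close> this is the recursion \<open>P k = (1 - q^k) * P (k - 1) + q^k * G k\<close>, where \<open>G\<close> is the
  density of units.
\<close>
lemma unit_mass_2:
  fixes A :: "'n::finite \<Rightarrow> 'n \<Rightarrow> int"
  assumes "S = - R" "indep_rows p R A"
  shows "unit_mass R A 2 = (\<Prod>j=2..card S + 1. 1 - 1 / real p ^ j) * real (card (mats (\<lambda>(_::'n) (_::'n). {0..<int (p ^ 2)})))"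
  using finite[of S] assms
proof (induction S arbitrary: R A rule: finite_induct)
  case empty
  then have "R = UNIV" by auto
  then show ?case using empty unit_mass_UNIV[of A 2] by simp
next
  case (insert i S)
  let ?M = "real (card (mats (\<lambda>(_::'n) (_::'n). {0..<int (p ^ 2)})))"
  let ?G = "\<lambda>k. \<Prod>j=1..k. 1 - 1 / real p ^ j" and ?P = "\<lambda>k. \<Prod>j=2..k + 1. 1 - 1 / real p ^ j"
  have p0: "p > 0" using p by (simp add: prime_gt_0_nat)
  have iR: "i \<notin> R" and SR: "S = - insert i R" using insert.hyps insert.prems by auto
  have ind: "indep_rows p R A" by (rule insert.prems)
  have fin: "finite (cube N :: ('n \<Rightarrow> int) set)" for N by (rule finite_cube)
  have cS: "card (insert i S) = Suc (card S)" and cR: "CARD('n) = card R + Suc (card S)"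
  proof -
    show "card (insert i S) = Suc (card S)" using insert.hyps by simp
    then show "CARD('n) = card R + Suc (card S)"
      using insert.prems(1) card_mono[of UNIV R] by (simp add: Compl_eq_Diff_UNIV card_Diff_subset)
  qed
  have nsp: "unit_mass (insert i R) (A(i := x)) 2 = ?P (card S) * ?M" if "\<not> in_span p R A x" for x
  proof -
    have i: "indep_rows p (insert i R) (A(i := x))" by (rule indep_rows_insert[OF p ind iR _ that]) simp
    from insert.IH[OF SR i] show ?thesis .
  qed
  have nsp1: "unit_mass (insert i R) (A(i := x)) 1 = of_bool (\<not> in_span p R A x) * (?G (card S) * ?M)" for x
  proof (cases "in_span p R A x")
    case True
    then show ?thesis using unit_mass_in_span_1[OF True iR] by simp
  next
    case False
    have i: "indep_rows p (insert i R) (A(i := x))" by (rule indep_rows_insert[OF p ind iR _ False]) simp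
    show ?thesis unfolding unit_mass_1[OF SR i] using False by simp
  qed
  \<comment> \<open>For \<open>y\<close> in the span the new row is a combination of the fixed rows
    plus \<open>p * (v + w)\<close>. One factor \<open>p\<close> comes out, and the condition modulo
    p^2 becomes one modulo \<open>p\<close>.\<close>
  have sp: "(\<Sum>w\<in>cube p. unit_mass (insert i R) (A(i := (\<lambda>j. y j + int p * w j))) 2)
      = (real p ^ CARD('n) - real p ^ card R) * (?G (card S) * ?M)" if y: "in_span p R A y" for y
  proof -
    obtain c v where v: "\<And>j. y j = (\<Sum>k\<in>R. c k * A k j) + int p * v j" using in_spanE[OF y] by metis
    have "unit_mass (insert i R) (A(i := (\<lambda>j. y j + int p * w j))) 2
        = unit_mass (insert i R) (A(i := (\<lambda>j. v j + w j))) 1" for w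
    proof -
      have "y j + int p * w j = (\<Sum>k\<in>R. c k * A k j) + int p * (v j + w j)" for j
        using v by (simp add: algebra_simps)
      note e = dt_merge_span[OF iR this]
      show ?thesis unfolding unit_mass_def e using p0 by (simp add: power2_eq_square)
    qed
    then have "(\<Sum>w\<in>cube p. unit_mass (insert i R) (A(i := (\<lambda>j. y j + int p * w j))) 2)
       = (\<Sum>w\<in>cube p. of_bool (\<not> in_span p R A (\<lambda>j. v j + w j)) * (?G (card S) * ?M))"
      by (simp only: nsp1)
    also have "(\<Sum>w\<in>cube p. of_bool (\<not> in_span p R A (\<lambda>j. v j + w j)) * (?G (card S) * ?M))
       = (\<Sum>w\<in>(cube p :: ('n \<Rightarrow> int) set). 1 - of_bool (in_span p R A (\<lambda>j. v j + w j))) * (?G (card S) * ?M)"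
      unfolding sum_distrib_right by (intro sum.cong) auto
    also have "(\<Sum>w\<in>(cube p :: ('n \<Rightarrow> int) set). 1 - of_bool (in_span p R A (\<lambda>j. v j + w j)) :: real) = real p ^ CARD('n) - real p ^ card R"
      unfolding sum_subtractf sum_of_bool_card[OF fin] card_in_span_translate[OF p0 ind] by (simp add: card_cube)
    finally show ?thesis .
  qed
  have "real p ^ (2 * CARD('n)) * unit_mass R A 2
      = (\<Sum>y\<in>cube p. \<Sum>w\<in>cube p. unit_mass (insert i R) (A(i := (\<lambda>j. y j + int p * w j))) 2)"
    unfolding unit_mass_insert[OF iR] by (rule sum_cube_square[OF p0])
  also have "\<dots> = (\<Sum>y\<in>(cube p :: ('n \<Rightarrow> int) set). real p ^ CARD('n) * (?P (card S) * ?M) +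
      of_bool (in_span p R A y) * ((real p ^ CARD('n) - real p ^ card R) * (?G (card S) * ?M) - real p ^ CARD('n) * (?P (card S) * ?M)))"
  proof (intro sum.cong refl)
    fix y :: "'n \<Rightarrow> int"
    show "(\<Sum>w\<in>cube p. unit_mass (insert i R) (A(i := (\<lambda>j. y j + int p * w j))) 2)
      = real p ^ CARD('n) * (?P (card S) * ?M) +
      of_bool (in_span p R A y) * ((real p ^ CARD('n) - real p ^ card R) * (?G (card S) * ?M) - real p ^ CARD('n) * (?P (card S) * ?M))"
    proof (cases "in_span p R A y")
      case True
      then show ?thesis unfolding sp[OF True] by simp
    next
      case False
      then have "\<not> in_span p R A (\<lambda>j. y j + int p * w j)" for w by (simp add: dvd_in_span_shift)
      then show ?thesis using False by (simp add: nsp card_cube)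
    qed
  qed
  also have "\<dots> = real p ^ CARD('n) * (real p ^ CARD('n) * (?P (card S) * ?M)) +
      real p ^ card R * ((real p ^ CARD('n) - real p ^ card R) * (?G (card S) * ?M) - real p ^ CARD('n) * (?P (card S) * ?M))"
  proof -
    have "card {y \<in> cube p. in_span p R A y} = p ^ card R"
      using card_in_span_translate[OF p0 ind, of "\<lambda>_. 0"] by simp
    then show ?thesis
      unfolding sum.distrib sum_distrib_right[symmetric] sum_of_bool_card[OF fin] by (simp add: card_cube)
  qed
  finally have eq: "real p ^ (2 * CARD('n)) * unit_mass R A 2 = real p ^ CARD('n) * (real p ^ CARD('n) * (?P (card S) * ?M)) +
      real p ^ card R * ((real p ^ CARD('n) - real p ^ card R) * (?G (card S) * ?M) - real p ^ CARD('n) * (?P (card S) * ?M))" .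
  define a b k where "a = real p ^ card R" and "b = real p ^ Suc (card S)" and "k = Suc (card S)"
  have ab: "a > 0" "b > 0" "real p ^ CARD('n) = a * b" "real p ^ (2 * CARD('n)) = (a * b) ^ 2"
    using p0 unfolding a_def b_def cR power_even_eq power_add by simp_all
  \<comment> \<open>\<open>?G\<close> has the additional factor j = 1, and this closes the
    recursion: with q = 1 / p and P taken at k - 1, (1 - q^k) * P + q^k * (1 - q) * P = (1 -
    q^(k+1)) * P.\<close>
  have GP: "?G (Suc (card S)) = (1 - 1 / real p) * ?P (card S)"
    by (subst prod.atLeast_Suc_atMost) (auto simp: numeral_2_eq_2)
  have G: "(1 - 1 / b) * ?G (card S) = ?G (Suc (card S))" by (simp add: b_def mult.commute)
  have "(a * b) ^ 2 * unit_mass R A 2 = (a * b) ^ 2 * ((1 - 1 / b) * ?P (card S) * ?M + 1 / b * ((1 - 1 / b) * ?G (card S)) * ?M)"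
  proof -
    have "a * b * (a * b * (P * M)) + a * ((a * b - a) * (G * M) - a * b * (P * M))
        = (a * b) ^ 2 * ((1 - 1 / b) * P * M + 1 / b * ((1 - 1 / b) * G) * M)" for P G M :: real
      using ab(1,2) by (simp add: field_simps power2_eq_square)
    then show ?thesis unfolding eq[unfolded ab(3,4) a_def[symmetric]] .
  qed
  then have "unit_mass R A 2 = (1 - 1 / b) * ?P (card S) * ?M + 1 / b * ((1 - 1 / real p) * ?P (card S)) * ?M"
    unfolding G GP using ab by simp
  also have "\<dots> = ?P (card S) * (1 - 1 / real p ^ (Suc (card S) + 1)) * ?M"
  proof -
    have "real p ^ (Suc (card S) + 1) = b * real p" by (simp add: b_def)
    moreover have "(1 - 1 / b) * P * M + 1 / b * ((1 - 1 / q) * P) * M = P * (1 - 1 / (b * q)) * M" if "q > 0" for P M q :: real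
      using that ab(2) by (simp add: field_simps)
    ultimately show ?thesis using p0 by (simp only: of_nat_0_less_iff)
  qed
  also have "?P (card S) * (1 - 1 / real p ^ (Suc (card S) + 1)) = ?P (Suc (card S))" by simp
  finally show ?case unfolding cS .
qed

end

lemma card_dvd_dt_prime_square:
  fixes p :: nat
  assumes p: "prime p"
  shows "real (card {A \<in> mats (\<lambda>(_::'n::finite) (_::'n). {0..<int (p ^ 2)}). int (p ^ 2) dvd dt A})
    = (1 - (\<Prod>j=2..CARD('n) + 1. 1 - 1 / real p ^ j)) * real (card (mats (\<lambda>(_::'n) (_::'n). {0..<int (p ^ 2)})))"
proof -
  let ?M = "mats (\<lambda>(_::'n) (_::'n). {0..<int (p ^ 2)})"
  have fin: "finite ?M" by (rule finite_mats) auto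
  have "(\<Sum>B\<in>?M. of_bool (\<not> int p ^ 2 dvd dt B)) = (\<Prod>j=2..CARD('n) + 1. 1 - 1 / real p ^ j) * real (card ?M)"
    using unit_mass_2[OF p, of "UNIV :: 'n set" "{}"] by (simp add: indep_rows_def unit_mass_def[OF p] merge_rows_def)
  moreover have "(\<Sum>B\<in>?M. of_bool (\<not> int p ^ 2 dvd dt B)) = (\<Sum>B\<in>?M. 1 - of_bool (int p ^ 2 dvd dt B) :: real)"
    by (intro sum.cong) auto
  ultimately show ?thesis
    unfolding sum_subtractf sum_of_bool_card[OF fin] by (simp add: algebra_simps)
qed

section \<open>Multiplicativity of the local densities\<close>

definition resdens :: "'n::finite itself \<Rightarrow> nat \<Rightarrow> real" where
  "resdens _ m = dens (\<lambda>(_::'n) (_::'n). {0..<int m}) m"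

lemma card_mats_const:
  "card (mats (\<lambda>(_::'n::finite) (_::'n). V)) = card V ^ (CARD('n) ^ 2)"
  by (simp add: card_mats power2_eq_square power_mult)

lemma dvd_dt_cong:
  assumes "\<And>i j. [A i j = B i j] (mod m)"
  shows "m dvd dt A \<longleftrightarrow> m dvd dt B"
  using dt_cong[of A B m] assms by (simp add: cong_dvd_iff)

text \<open>Chinese remainder theorem entry by entry; surjectivity follows from equal
  cardinalities.\<close>

lemma resdens_mult_coprime:
  assumes cop: "coprime a b" and a: "a > 0" and b: "b > 0"
  shows "resdens TYPE('n::finite) (a * b) = resdens TYPE('n) a * resdens TYPE('n) b"
proof -
  let ?M = "\<lambda>m. mats (\<lambda>(_::'n) (_::'n). {0..<int m})"
  let ?E = "\<lambda>m. {A \<in> ?M m. int m dvd dt A}"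
  let ?r = "\<lambda>m (A :: 'n \<Rightarrow> 'n \<Rightarrow> int) i j. A i j mod int m"
  let ?f = "\<lambda>A. (?r a A, ?r b A)"
  have fin: "finite (?M m)" for m by (rule finite_mats) auto
  have inj: "inj_on ?f (?M (a * b))"
  proof (rule inj_onI)
    fix A B assume AB: "A \<in> ?M (a * b)" "B \<in> ?M (a * b)" and eq: "?f A = ?f B"
    have "A i j = B i j" for i j
    proof -
      have "A i j mod int a = B i j mod int a" "A i j mod int b = B i j mod int b"
        using eq by (auto simp: fun_eq_iff)
      then have "int a dvd A i j - B i j" "int b dvd A i j - B i j" by (simp_all add: mod_eq_dvd_iff)
      then have "int a * int b dvd A i j - B i j" using cop by (intro divides_mult) auto
      then have "A i j mod int (a * b) = B i j mod int (a * b)" by (simp add: mod_eq_dvd_iff)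
      moreover have "A i j \<in> {0..<int (a * b)}" "B i j \<in> {0..<int (a * b)}" using AB by (auto simp: mats_def)
      ultimately show ?thesis by simp
    qed
    then show "A = B" by (simp add: fun_eq_iff)
  qed
  have sub: "?f ` ?M (a * b) \<subseteq> ?M a \<times> ?M b"
    using a b by (auto simp: mats_def)
  have surj: "?f ` ?M (a * b) = ?M a \<times> ?M b"
  proof (rule card_subset_eq[OF _ sub])
    show "finite (?M a \<times> ?M b)" by (intro finite_cartesian_product fin)
    show "card (?f ` ?M (a * b)) = card (?M a \<times> ?M b)"
      unfolding card_image[OF inj] card_cartesian_product card_mats_const by (simp add: power_mult_distrib nat_mult_distrib)
  qed
  have iff: "int (a * b) dvd dt A \<longleftrightarrow> int a dvd dt (?r a A) \<and> int b dvd dt (?r b A)" for A :: "'n \<Rightarrow> 'n \<Rightarrow> int"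
  proof -
    have "int (a * b) dvd dt A \<longleftrightarrow> int a dvd dt A \<and> int b dvd dt A"
      using cop by (auto intro: divides_mult dvd_mult_left dvd_mult_right)
    moreover have "int a dvd dt A \<longleftrightarrow> int a dvd dt (?r a A)" "int b dvd dt A \<longleftrightarrow> int b dvd dt (?r b A)"
      by (rule dvd_dt_cong, simp add: cong_def)+
    ultimately show ?thesis by simp
  qed
  have "?f ` ?E (a * b) = ?E a \<times> ?E b"
  proof (intro equalityI subsetI)
    fix z assume "z \<in> ?f ` ?E (a * b)"
    then obtain A where A: "A \<in> ?M (a * b)" "int (a * b) dvd dt A" "z = ?f A" by blast
    then have "?f A \<in> ?M a \<times> ?M b" using surj by blast
    with A iff show "z \<in> ?E a \<times> ?E b" by simp
  next
    fix z assume z: "z \<in> ?E a \<times> ?E b"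
    then have "z \<in> ?f ` ?M (a * b)" unfolding surj by auto
    then obtain A where A: "A \<in> ?M (a * b)" "z = ?f A" by blast
    then have "int (a * b) dvd dt A" using z iff[of A] by auto
    with A show "z \<in> ?f ` ?E (a * b)" by blast
  qed
  moreover have "inj_on ?f (?E (a * b))" using inj by (rule inj_on_subset) auto
  ultimately have "card (?E (a * b)) = card (?E a) * card (?E b)"
    using card_image[of ?f "?E (a * b)"] by (simp only: card_cartesian_product)
  moreover have "card (?M (a * b)) = card (?M a) * card (?M b)"
    using card_image[OF inj] unfolding surj by (simp only: card_cartesian_product)
  ultimately show ?thesis by (simp add: resdens_def dens_def)
qed

lemma resdens_1: "resdens TYPE('n::finite) 1 = 1"
proof -
  have "card (mats (\<lambda>(_::'n) (_::'n). {0..<int 1})) = 1" unfolding card_mats_const by simp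
  then show ?thesis by (simp add: resdens_def dens_def)
qed

lemma resdens_prod_primes:
  assumes "finite S" "\<And>p. p \<in> S \<Longrightarrow> prime p"
  shows "resdens TYPE('n::finite) ((\<Prod>S) ^ 2) = (\<Prod>p\<in>S. resdens TYPE('n) (p ^ 2))"
  using assms
proof (induction S rule: finite_induct)
  case empty
  then show ?case using resdens_1 by simp
next
  case (insert p S)
  have "coprime p (\<Prod>S)"
    using insert by (intro prod_coprime_right) (auto intro: primes_coprime)
  moreover have "(\<Prod>S) > 0" using insert by (intro prod_pos) (auto intro: prime_gt_0_nat)
  moreover have "p > 0" using insert by (auto intro: prime_gt_0_nat)
  ultimately have "resdens TYPE('n) (p ^ 2 * (\<Prod>S) ^ 2) = resdens TYPE('n) (p ^ 2) * resdens TYPE('n) ((\<Prod>S) ^ 2)"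
    by (intro resdens_mult_coprime) auto
  then show ?case using insert by (simp add: power_mult_distrib)
qed

lemma resdens_nonneg: "resdens T m \<ge> 0"
  by (simp add: resdens_def dens_def)

lemma resdens_le:
  assumes m: "m > 0"
  shows "resdens TYPE('n::finite) m \<le> real (tau m) ^ (CARD('n) - 1) / real m"
proof -
  let ?W = "\<lambda>(_::'n) (_::'n). {0..<int m}"
  have "real (card {A \<in> mats ?W. int m dvd dt A}) * real m \<le> 1 * (1 * real (tau m)) ^ (CARD('n) - 1) * real (card (mats ?W))"
    using m by (intro count_dvd_dt spread_residues) auto
  moreover have "card (mats ?W) > 0" unfolding card_mats_const using m by simp
  ultimately show ?thesis using m by (simp add: resdens_def dens_def field_simps)
qed

section \<open>Moebius function, Euler products and divisor counts\<close>

definition mu :: "nat \<Rightarrow> real" where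
  "mu d = (if squarefree d then (-1) ^ card (prime_factors d) else 0)"

lemma abs_mu_le_1: "\<bar>mu d\<bar> \<le> 1"
  by (simp add: mu_def power_abs)

lemma prime_factors_prod_primes:
  fixes S :: "nat set"
  assumes "finite S" "\<And>p. p \<in> S \<Longrightarrow> prime p"
  shows "prime_factors (\<Prod>S) = S"
  using assms
proof (induction S rule: finite_induct)
  case (insert p S)
  have "\<And>q. q \<in> insert p S \<Longrightarrow> q \<noteq> 0" using insert.prems by (metis not_prime_0)
  then have "(\<Prod>S) \<noteq> 0" "p \<noteq> 0" using insert.hyps by auto
  then show ?case using insert by (auto simp: prime_factors_product prime_prime_factors)
qed simp

lemma squarefree_prod_primes:
  fixes S :: "nat set"
  assumes "finite S" "\<And>p. p \<in> S \<Longrightarrow> prime p"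
  shows "squarefree (\<Prod>S)"
  using assms by (intro squarefree_prod_coprime) (auto intro: primes_coprime squarefree_prime)

lemma squarefree_eq_prod_prime_factors:
  fixes d :: nat
  assumes "squarefree d"
  shows "\<Prod>(prime_factors d) = d"
proof -
  have d: "d \<noteq> 0" using assms not_squarefree_0[where 'a = nat] by metis
  have "(\<Prod>p\<in>prime_factors d. p ^ multiplicity p d) = d"
    using prod_prime_factors[OF d] by simp
  moreover have "multiplicity p d = 1" if "p \<in> prime_factors d" for p
  proof -
    have "multiplicity p d \<le> 1" using assms d in_prime_factors_imp_prime[OF that] by (simp add: squarefree_factorial_semiring'')
    moreover have "multiplicity p d > 0" using that by (simp add: prime_factors_multiplicity)
    ultimately show ?thesis by simp
  qed
  ultimately show ?thesis by simp
qed

lemma sum_minus_one_power_card: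
  assumes "finite Q"
  shows "(\<Sum>S\<in>Pow Q. (-1 :: real) ^ card S) = of_bool (Q = {})"
proof -
  have "(\<Prod>x\<in>Q. (-1 :: real) + 1) = (\<Sum>X\<in>Pow Q. (\<Prod>x\<in>X. -1) * (\<Prod>x\<in>Q - X. 1))"
    by (rule prod_add[OF assms])
  then show ?thesis using assms by (cases "Q = {}") (simp_all add: power_0_left card_eq_0_iff)
qed

text \<open>The square-free \<open>d\<close> with d^2 dividing \<open>k\<close> are the products of
  the subsets of \<open>Q\<close>, and the signs cancel unless \<open>Q\<close> is empty.
  \<open>X\<close> is any finite set containing all relevant \<open>d\<close>, because one common
  range must serve all matrices of the box.\<close>

lemma sum_mu_square_dvd:
  assumes "k \<noteq> 0" and N: "\<And>d. d > 0 \<Longrightarrow> int d ^ 2 dvd k \<Longrightarrow> d \<in> X" and X: "finite X" "0 \<notin> X"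
  shows "(\<Sum>d\<in>X. mu d * of_bool (int d ^ 2 dvd k)) = of_bool (squarefree (k::int))"
proof -
  define Q where "Q = {p::nat. prime p \<and> int p ^ 2 dvd k}"
  have QX: "Q \<subseteq> X" using N by (auto simp: Q_def prime_gt_0_nat)
  have finQ: "finite Q" using QX X(1) by (rule finite_subset)
  have dvd_prod: "int (\<Prod>S) ^ 2 dvd k" if "S \<subseteq> Q" for S
  proof -
    have "finite S" using that finQ by (rule finite_subset)
    then have "(\<Prod>p\<in>S. int p ^ 2) dvd k" using that
    proof (induction S rule: finite_induct)
      case (insert p S)
      have "coprime (int p ^ 2) (\<Prod>p\<in>S. int p ^ 2)"
      proof (rule prod_coprime_right)
        fix q assume "q \<in> S"
        then have "coprime p q" using insert by (intro primes_coprime) (auto simp: Q_def)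
        then show "coprime (int p ^ 2) (int q ^ 2)" by simp
      qed
      moreover have "int p ^ 2 dvd k" using insert by (auto simp: Q_def)
      ultimately show ?case using insert by (auto intro: divides_mult)
    qed simp
    then show ?thesis by (simp add: prod_power_distrib[symmetric])
  qed
  have "(\<Sum>d\<in>X. mu d * of_bool (int d ^ 2 dvd k)) = (\<Sum>d | d \<in> X \<and> squarefree d \<and> int d ^ 2 dvd k. mu d)"
    using X by (intro sum.mono_neutral_cong_right) (auto simp: mu_def)
  also have "\<dots> = (\<Sum>S\<in>Pow Q. (-1) ^ card S)"
  proof (rule sum.reindex_bij_witness[of _ "\<Prod>" prime_factors])
    fix d assume d: "d \<in> {d \<in> X. squarefree d \<and> int d ^ 2 dvd k}"
    then show "\<Prod>(prime_factors d) = d" by (simp add: squarefree_eq_prod_prime_factors)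
    have "int p ^ 2 dvd k" if "p \<in> prime_factors d" for p
    proof -
      have "p dvd d" using that by auto
      then have "int p ^ 2 dvd int d ^ 2" by (intro dvd_power_same) simp
      then show ?thesis using d by (auto intro: dvd_trans)
    qed
    then show "prime_factors d \<in> Pow Q" by (auto simp: Q_def)
    show "(-1) ^ card (prime_factors d) = mu d" using d by (simp add: mu_def)
  next
    fix S assume S: "S \<in> Pow Q"
    then have S': "finite S" "\<And>p. p \<in> S \<Longrightarrow> prime p" using finQ by (auto intro: finite_subset simp: Q_def)
    show "prime_factors (\<Prod>S) = S" by (rule prime_factors_prod_primes[OF S'])
    have "(\<Prod>S) > 0" using S' by (intro prod_pos) (auto simp: prime_gt_0_nat)
    then show "\<Prod>S \<in> {d \<in> X. squarefree d \<and> int d ^ 2 dvd k}"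
      using S dvd_prod[of S] squarefree_prod_primes[OF S'] N by auto
  qed
  also have "\<dots> = of_bool (Q = {})" by (rule sum_minus_one_power_card[OF finQ])
  also have "Q = {} \<longleftrightarrow> squarefree k"
  proof
    assume Q: "Q = {}"
    show "squarefree k"
    proof (subst squarefree_factorial_semiring[OF \<open>k \<noteq> 0\<close>], safe)
      fix q :: int assume "prime q" "q ^ 2 dvd k"
      then have "nat q \<in> Q" by (auto simp: Q_def prime_ge_0_int)
      with Q show False by simp
    qed
  next
    assume "squarefree k"
    then have "\<not> int p ^ 2 dvd k" if "prime p" for p :: nat
      using that squarefreeD[of k "int p"] by auto
    then show "Q = {}" by (auto simp: Q_def)
  qed
  finally show ?thesis .
qed

section \<open>Subpolynomial growth of the divisor function\<close>

lemma tau_mult_le: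
  assumes "x > 0" "y > 0" shows "tau (x * y) \<le> tau x * tau y"
proof -
  have "{d. d dvd x * y} \<subseteq> (\<lambda>(b, c). b * c) ` ({d. d dvd x} \<times> {d. d dvd y})"
  proof
    fix d assume "d \<in> {d. d dvd x * y}"
    then obtain b c where "d = b * c" "b dvd x" "c dvd y" using division_decomp[of d x y] by auto
    then show "d \<in> (\<lambda>(b, c). b * c) ` ({d. d dvd x} \<times> {d. d dvd y})" by force
  qed
  then have "tau (x * y) \<le> card ((\<lambda>(b, c). b * c) ` ({d. d dvd x} \<times> {d. d dvd y}))"
    unfolding tau_def using assms by (intro card_mono finite_imageI finite_cartesian_product finite_divisors) auto
  also have "\<dots> \<le> card ({d. d dvd x} \<times> {d. d dvd y})"
    using assms by (intro card_image_le finite_cartesian_product finite_divisors)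
  finally show ?thesis by (simp add: tau_def card_cartesian_product)
qed

lemma tau_primepow_le:
  assumes "prime p" shows "tau (p ^ a) \<le> a + 1"
proof -
  have "{d. d dvd p ^ a} \<subseteq> (\<lambda>i. p ^ i) ` {0..a}"
    using divides_primepow_nat[OF assms] by auto
  then have "tau (p ^ a) \<le> card ((\<lambda>i. p ^ i) ` {0..a})" unfolding tau_def by (intro card_mono) auto
  also have "\<dots> \<le> card {0..a}" by (rule card_image_le) simp
  finally show ?thesis by simp
qed

text \<open>
  The primes with \<open>p powr \<epsilon> \<ge> 2\<close> contribute nothing, because \<open>a + 1 \<le> 2 ^ a\<close>; the others
  contribute a bounded factor each.
\<close>
lemma tau_le_powr:
  assumes eps: "\<epsilon> > 0"
  shows "\<exists>C\<ge>1. \<forall>m>0. real (tau m) \<le> C * real m powr \<epsilon>"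
proof -
  \<comment> \<open>Chosen so that \<open>C1 * (1 + a * \<epsilon> * ln 2)\<close> is at least
    \<open>a + 1\<close> for every \<open>a\<close>.\<close>
  define C1 where "C1 = 1 + 1 / (\<epsilon> * ln 2)"
  define P0 where "P0 = nat \<lceil>2 powr (1 / \<epsilon>)\<rceil>"
  have C1: "C1 \<ge> 1" using eps by (simp add: C1_def)
  have small: "real a + 1 \<le> C1 * (2 powr \<epsilon>) ^ a" for a :: nat
  proof -
    have "(2 powr \<epsilon>) ^ a = exp (real a * (\<epsilon> * ln 2))"
      by (simp add: powr_def exp_of_nat_mult)
    then have "(2 powr \<epsilon>) ^ a \<ge> 1 + real a * (\<epsilon> * ln 2)" using exp_ge_add_one_self[of "real a * (\<epsilon> * ln 2)"] by simp
    then have "C1 * (2 powr \<epsilon>) ^ a \<ge> C1 * (1 + real a * (\<epsilon> * ln 2))" using C1 by (intro mult_left_mono) auto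
    moreover have "C1 * (1 + real a * (\<epsilon> * ln 2)) = 1 + real a * (\<epsilon> * ln 2) + 1 / (\<epsilon> * ln 2) + real a"
      using eps by (simp add: C1_def field_simps)
    moreover have "real a * (\<epsilon> * ln 2) \<ge> 0" "1 / (\<epsilon> * ln 2) \<ge> 0" using eps by simp_all
    ultimately show ?thesis by linarith
  qed
  have step: "real a + 1 \<le> (if p < P0 then C1 else 1) * real (p ^ a) powr \<epsilon>" if "prime p" for p a
  proof -
    have p2: "real p \<ge> 2" using prime_ge_2_nat[OF that] by simp
    have pw: "real (p ^ a) powr \<epsilon> = (real p powr \<epsilon>) ^ a"
      using p2 by (simp add: powr_realpow[symmetric] powr_powr mult.commute)
    show ?thesis
    proof (cases "p < P0")
      case True
      have "(2 powr \<epsilon>) ^ a \<le> (real p powr \<epsilon>) ^ a" using p2 eps by (intro power_mono powr_mono2) auto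
      then have "C1 * (2 powr \<epsilon>) ^ a \<le> C1 * (real p powr \<epsilon>) ^ a" using C1 by (intro mult_left_mono) auto
      then show ?thesis unfolding pw using small[of a] True by simp
    next
      case False
      then have "2 powr (1 / \<epsilon>) \<le> real p" unfolding P0_def by linarith
      then have "(2 powr (1 / \<epsilon>)) powr \<epsilon> \<le> real p powr \<epsilon>" using eps by (intro powr_mono2) auto
      then have "2 \<le> real p powr \<epsilon>" using eps by (simp add: powr_powr)
      then have "2 ^ a \<le> (real p powr \<epsilon>) ^ a" by (intro power_mono) auto
      moreover have "real a + 1 \<le> 2 ^ a" by (metis of_nat_Suc of_nat_le_iff of_nat_numeral of_nat_power Suc_leI less_exp add.commute)
      ultimately show ?thesis unfolding pw using False by simp
    qed
  qed
  \<comment> \<open>\<open>S\<close> may be larger than the set of prime factors, so the induction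
    can also remove a prime of multiplicity 0.\<close>
  have main: "real (tau m) \<le> C1 ^ card {p \<in> S. p < P0} * real m powr \<epsilon>"
    if "finite S" "m > 0" "prime_factors m \<subseteq> S" "\<And>p. p \<in> S \<Longrightarrow> prime p" for S m
    using that
  proof (induction S arbitrary: m rule: finite_induct)
    case empty
    then have "m = 1" by (auto simp: prime_factorization_empty_iff)
    then show ?case by (simp add: tau_def)
  next
    case (insert p S)
    have p: "prime p" using insert by auto
    define a where "a = multiplicity p m"
    obtain m' where m': "m = p ^ a * m'" "\<not> p dvd m'"
      using multiplicity_decompose'[of m p] insert.prems p unfolding a_def by (metis not_prime_unit not_gr_zero)
    have m'0: "m' > 0" using m' insert.prems by (auto intro: Nat.gr0I)
    have pf: "prime_factors m' \<subseteq> S"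
    proof
      fix q assume q: "q \<in> prime_factors m'"
      then have "q \<in> prime_factors m" using m' insert.prems by (auto simp: prime_factors_dvd)
      moreover have "q \<noteq> p" using q m' by auto
      ultimately show "q \<in> S" using insert by auto
    qed
    have IH: "real (tau m') \<le> C1 ^ card {p \<in> S. p < P0} * real m' powr \<epsilon>"
      using insert.IH[OF m'0 pf] insert.prems by simp
    have "tau m \<le> tau (p ^ a) * tau m'"
      unfolding m'(1) using m'0 p by (intro tau_mult_le) (auto simp: prime_gt_0_nat)
    also have "\<dots> \<le> (a + 1) * tau m'" using tau_primepow_le[OF p] by (rule mult_right_mono) simp
    finally have "real (tau m) \<le> real ((a + 1) * tau m')" by (simp only: of_nat_le_iff)
    then have "real (tau m) \<le> (real a + 1) * real (tau m')" by (simp add: distrib_right add.commute)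
    also have "\<dots> \<le> ((if p < P0 then C1 else 1) * real (p ^ a) powr \<epsilon>) * (C1 ^ card {p \<in> S. p < P0} * real m' powr \<epsilon>)"
      using C1 by (intro mult_mono step[OF p] IH) auto
    also have "\<dots> = ((if p < P0 then C1 else 1) * C1 ^ card {p \<in> S. p < P0}) * real m powr \<epsilon>"
      unfolding m'(1) of_nat_mult by (simp add: powr_mult)
    also have "(if p < P0 then C1 else 1) * C1 ^ card {p \<in> S. p < P0} = C1 ^ card {q \<in> insert p S. q < P0}"
    proof (cases "p < P0")
      case True
      then have "{q \<in> insert p S. q < P0} = insert p {p \<in> S. p < P0}" by auto
      then show ?thesis using True insert.hyps by simp
    next
      case False
      then have "{q \<in> insert p S. q < P0} = {p \<in> S. p < P0}" by auto
      then show ?thesis using False by simp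
    qed
    finally show ?case .
  qed
  show ?thesis
  \<comment> \<open>At most \<open>P0\<close> primes lie below \<open>P0\<close>, each contributing
    one factor \<open>C1\<close>.\<close>
  proof (intro exI[of _ "C1 ^ P0"] conjI allI impI)
    show "C1 ^ P0 \<ge> 1" using C1 by (rule one_le_power)
    fix m :: nat assume m: "m > 0"
    have "card {p \<in> prime_factors m. p < P0} \<le> card {..<P0}" by (intro card_mono) auto
    then have "C1 ^ card {p \<in> prime_factors m. p < P0} \<le> C1 ^ P0" using C1 by (intro power_increasing) auto
    then show "real (tau m) \<le> C1 ^ P0 * real m powr \<epsilon>"
      using main[of "prime_factors m" m] m by (smt (verit) finite_set_mset in_prime_factors_imp_prime mult_right_mono order_refl powr_ge_zero)
  qed
qed

text \<open>The product over primes up to n expands into a sum over the square-free numbers with all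
  prime factors at most n. For n at least \<open>D\<close> these include every square-free number up
  to \<open>D\<close>, and the remaining terms are bounded by the tail of \<open>g\<close>; then n
  tends to infinity.\<close>

lemma euler_product_mu:
  fixes g :: "nat \<Rightarrow> real"
  assumes mult: "\<And>S. finite S \<Longrightarrow> (\<And>p. p \<in> S \<Longrightarrow> prime p) \<Longrightarrow> g (\<Prod>S) = (\<Prod>p\<in>S. g p)"
    and nonneg: "\<And>d. g d \<ge> 0" and summ: "summable g"
  shows "\<bar>prodinf (\<lambda>p. if prime p then 1 - g p else 1) - (\<Sum>d=1..D. mu d * g d)\<bar> \<le> (\<Sum>d. g (d + Suc D))"
proof -
  let ?f = "\<lambda>p. if prime p then 1 - g p else 1"
  have "summable (\<lambda>p. norm (?f p - 1))"
    by (rule summable_comparison_test[OF _ summ]) (use nonneg in auto)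
  then have conv: "convergent_prod ?f"
    by (intro abs_convergent_prod_imp_convergent_prod summable_imp_abs_convergent_prod)
  then have lim: "(\<lambda>n. \<Prod>i\<le>n. ?f i) \<longlonglongrightarrow> prodinf ?f" by (rule convergent_prod_LIMSEQ)
  have bound: "\<bar>(\<Prod>i\<le>n. ?f i) - (\<Sum>d=1..D. mu d * g d)\<bar> \<le> (\<Sum>d. g (d + Suc D))" if n: "n \<ge> D" for n
  proof -
    define Q where "Q = {p. p \<le> n \<and> prime p}"
    define X where "X = {d. squarefree d \<and> prime_factors d \<subseteq> Q}"
    have finQ: "finite Q" by (simp add: Q_def)
    have Qp: "prime p" if "p \<in> Q" for p using that by (simp add: Q_def)
    have bij: "bij_betw (\<lambda>S. \<Prod>S) (Pow Q) X"
    proof (rule bij_betw_byWitness[where f' = prime_factors])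
      show "\<forall>S\<in>Pow Q. prime_factors (\<Prod>S) = S"
        using finQ Qp by (auto intro!: prime_factors_prod_primes intro: finite_subset)
      show "\<forall>d\<in>X. \<Prod>(prime_factors d) = d" by (auto simp: X_def squarefree_eq_prod_prime_factors)
      show "prime_factors ` X \<subseteq> Pow Q" by (auto simp: X_def)
      show "(\<lambda>S. \<Prod>S) ` Pow Q \<subseteq> X"
      proof clarify
        fix S assume S: "S \<subseteq> Q"
        then have S': "finite S" "\<And>p. p \<in> S \<Longrightarrow> prime p" using finQ Qp by (auto intro: finite_subset)
        show "\<Prod>S \<in> X" unfolding X_def using squarefree_prod_primes[OF S'] prime_factors_prod_primes[OF S'] S by simp
      qed
    qed
    have finX: "finite X" using bij finQ bij_betw_finite by blast
    have "(\<Prod>i\<le>n. ?f i) = (\<Prod>p\<in>Q. - g p + 1)"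
      unfolding Q_def by (rule prod.mono_neutral_cong_right) auto
    also have "\<dots> = (\<Sum>S\<in>Pow Q. (\<Prod>p\<in>S. - g p) * (\<Prod>p\<in>Q - S. 1))"
      by (rule prod_add[OF finQ])
    also have "\<dots> = (\<Sum>S\<in>Pow Q. mu (\<Prod>S) * g (\<Prod>S))"
    proof (intro sum.cong refl)
      fix S assume S: "S \<in> Pow Q"
      then have S': "finite S" "\<And>p. p \<in> S \<Longrightarrow> prime p" using finQ Qp by (auto intro: finite_subset)
      show "(\<Prod>p\<in>S. - g p) * (\<Prod>p\<in>Q - S. 1) = mu (\<Prod>S) * g (\<Prod>S)"
        using mult[OF S'] squarefree_prod_primes[OF S'] prime_factors_prod_primes[OF S']
        by (simp add: mu_def prod_uminus)
    qed
    also have "\<dots> = (\<Sum>d\<in>X. mu d * g d)"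
      by (rule sum.reindex_bij_betw[OF bij])
    finally have P: "(\<Prod>i\<le>n. ?f i) = (\<Sum>d\<in>X. mu d * g d)" .
    have "(\<Sum>d=1..D. mu d * g d) = (\<Sum>d\<in>X \<inter> {1..D}. mu d * g d)"
    proof (rule sum.mono_neutral_right)
      show "\<forall>d\<in>{1..D} - X \<inter> {1..D}. mu d * g d = 0"
      proof
        fix d assume d: "d \<in> {1..D} - X \<inter> {1..D}"
        have "\<not> squarefree d"
        proof
          assume "squarefree d"
          moreover have "prime_factors d \<subseteq> Q"
          proof
            fix p assume "p \<in> prime_factors d"
            then have "p dvd d" "prime p" by auto
            then have "p \<le> d" using d by (intro dvd_imp_le) auto
            then show "p \<in> Q" using d n \<open>prime p\<close> by (auto simp: Q_def)
          qed
          ultimately show False using d by (auto simp: X_def)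
        qed
        then show "mu d * g d = 0" by (simp add: mu_def)
      qed
    qed auto
    moreover have "(\<Sum>d\<in>X. mu d * g d) = (\<Sum>d\<in>X \<inter> {1..D}. mu d * g d) + (\<Sum>d\<in>X - {1..D}. mu d * g d)"
      using sum.Int_Diff[OF finX, of _ "{1..D}"] by blast
    ultimately have "\<bar>(\<Prod>i\<le>n. ?f i) - (\<Sum>d=1..D. mu d * g d)\<bar> = \<bar>\<Sum>d\<in>X - {1..D}. mu d * g d\<bar>"
      unfolding P by simp
    also have "\<dots> \<le> (\<Sum>d\<in>X - {1..D}. \<bar>mu d * g d\<bar>)" by (rule sum_abs)
    also have "\<dots> \<le> (\<Sum>d\<in>X - {1..D}. g d)"
    proof (rule sum_mono)
      fix d
      show "\<bar>mu d * g d\<bar> \<le> g d" using mult_right_mono[OF abs_mu_le_1 nonneg, of d d] nonneg[of d] by (simp add: abs_mult)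
    qed
    also have "\<dots> = (\<Sum>d\<in>(\<lambda>d. d - Suc D) ` (X - {1..D}). g (d + Suc D))"
    proof (subst sum.reindex)
      \<comment> \<open>Removing \<open>{1..D}\<close> leaves only numbers beyond \<open>D\<close>,
        because 0 is not square-free; this permits the shift of the index.\<close>
      have pos: "d \<ge> Suc D" if "d \<in> X - {1..D}" for d
      proof -
        have "squarefree d" using that by (auto simp: X_def)
        then have "d \<noteq> 0" using not_squarefree_0[where 'a = nat] by metis
        then show ?thesis using that by auto
      qed
      show "inj_on (\<lambda>d. d - Suc D) (X - {1..D})"
        by (rule inj_onI) (use pos in \<open>metis le_add_diff_inverse2\<close>)
      show "(\<Sum>d\<in>X - {1..D}. g d) = sum ((\<lambda>d. g (d + Suc D)) \<circ> (\<lambda>d. d - Suc D)) (X - {1..D})"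
      proof (intro sum.cong refl)
        fix d assume "d \<in> X - {1..D}"
        from pos[OF this] show "g d = ((\<lambda>d. g (d + Suc D)) \<circ> (\<lambda>d. d - Suc D)) d" by simp
      qed
    qed
    also have "\<dots> \<le> (\<Sum>d. g (d + Suc D))"
      using finX nonneg summ by (intro sum_le_suminf) (auto simp: summable_iff_shift simp del: add_Suc_right)
    finally show ?thesis .
  qed
  have "(\<lambda>n. \<bar>(\<Prod>i\<le>n. ?f i) - (\<Sum>d=1..D. mu d * g d)\<bar>) \<longlonglongrightarrow> \<bar>prodinf ?f - (\<Sum>d=1..D. mu d * g d)\<bar>"
    by (intro tendsto_intros lim)
  then show ?thesis
    by (rule LIMSEQ_le_const2) (use bound in blast)
qed

section \<open>The sieve\<close>

lemma sqfree_det_count_eq: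
  "sqfree_det_count H TYPE('n::finite) = card {A \<in> mats (\<lambda>(_::'n) (_::'n). {-H..H}). squarefree (dt A)}"
proof -
  let ?f = "\<lambda>A :: int^'n^'n. \<lambda>i j. A $ i $ j"
  let ?E = "{A \<in> (bounded_int_matrices H :: (int^'n^'n) set). squarefree (det A)}"
  let ?F = "{A \<in> mats (\<lambda>(_::'n) (_::'n). {-H..H}). squarefree (dt A)}"
  have "bij_betw ?f ?E ?F"
    by (rule bij_betw_byWitness[where f' = "\<lambda>A. \<chi> i j. A i j"])
       (auto simp: bounded_int_matrices_def mats_def dt_def abs_le_iff minus_le_iff)
  then show ?thesis unfolding sqfree_det_count_def by (rule bij_betw_same_card)
qed

lemma singular_series_eq:
  "singular_series CARD('n::finite) = prodinf (\<lambda>p. if prime p then 1 - resdens TYPE('n) (p ^ 2) else 1)"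
proof -
  have "(\<Prod>j=2..CARD('n) + 1. 1 - 1 / real p ^ j) = 1 - resdens TYPE('n) (p ^ 2)" if p: "prime p" for p
  proof -
    have "card (mats (\<lambda>(_::'n) (_::'n). {0..<int (p ^ 2)})) > 0"
      unfolding card_mats_const using prime_gt_0_nat[OF p] by simp
    then show ?thesis
      unfolding resdens_def dens_def card_dvd_dt_prime_square[OF p] by simp
  qed
  then show ?thesis unfolding singular_series_def by (intro prodinf_cong) auto
qed

definition det_count :: "'n::finite itself \<Rightarrow> int \<Rightarrow> nat \<Rightarrow> real" where
  "det_count _ H m = real (card {A \<in> mats (\<lambda>(_::'n) (_::'n). {-H..H}). int m dvd dt A})"

definition det_count_nonzero :: "'n::finite itself \<Rightarrow> int \<Rightarrow> nat \<Rightarrow> real" where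
  "det_count_nonzero _ H m = real (card {A \<in> mats (\<lambda>(_::'n) (_::'n). {-H..H}). int m dvd dt A \<and> dt A \<noteq> 0})"

definition det_count_zero :: "'n::finite itself \<Rightarrow> int \<Rightarrow> real" where
  "det_count_zero _ H = real (card {A \<in> mats (\<lambda>(_::'n) (_::'n). {-H..H}). dt A = 0})"

lemma det_count_eq: "det_count TYPE('n::finite) H m = det_count_nonzero TYPE('n) H m + det_count_zero TYPE('n) H"
proof -
  let ?M = "mats (\<lambda>(_::'n) (_::'n). {-H..H})"
  have fin: "finite ?M" by (rule finite_mats) auto
  have "{A \<in> ?M. int m dvd dt A} = {A \<in> ?M. int m dvd dt A \<and> dt A \<noteq> 0} \<union> {A \<in> ?M. dt A = 0}" by auto
  then have "card {A \<in> ?M. int m dvd dt A} = card {A \<in> ?M. int m dvd dt A \<and> dt A \<noteq> 0} + card {A \<in> ?M. dt A = 0}"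
    using fin by (simp add: card_Un_disjoint disjoint_iff)
  then show ?thesis by (simp add: det_count_def det_count_nonzero_def det_count_zero_def)
qed

text \<open>The inversion runs over non-zero determinants, since a singular matrix is divisible by
  every square. Up to \<open>D\<close> the counts are replaced by densities, beyond it
  \<open>t\<close> bounds them from above, and the last term pays for completing the truncated sum
  to the Euler product.\<close>

lemma square_sieve:
  fixes E t :: "nat \<Rightarrow> real" and D :: nat and H :: int
  defines "M \<equiv> real (card (mats (\<lambda>(_::'n::finite) (_::'n). {-H..H})))"
  assumes E: "\<And>d. 1 \<le> d \<Longrightarrow> d \<le> D \<Longrightarrow>
      \<bar>det_count TYPE('n) H (d ^ 2) - det_count_zero TYPE('n) H - M * resdens TYPE('n) (d ^ 2)\<bar> \<le> E d"
    and t: "\<And>d. D < d \<Longrightarrow> det_count_nonzero TYPE('n) H (d ^ 2) \<le> t d" and t_summable: "summable t"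
    and r_summable: "summable (\<lambda>d. resdens TYPE('n) (d ^ 2))"
  shows "\<bar>real (sqfree_det_count H TYPE('n)) - M * singular_series CARD('n)\<bar>
     \<le> (\<Sum>d=1..D. E d) + (\<Sum>d. t (d + Suc D)) + M * (\<Sum>d. resdens TYPE('n) ((d + Suc D) ^ 2))"
proof -
  let ?M = "mats (\<lambda>(_::'n) (_::'n). {-H..H})" and ?r = "\<lambda>d. resdens TYPE('n) (d ^ 2)"
  have fin: "finite ?M" by (rule finite_mats) auto
  have finnz: "finite {A \<in> ?M. dt A \<noteq> 0}" using fin by simp
  \<comment> \<open>The sum bounds the absolute determinant of every matrix of the box, hence every
    \<open>d\<close> with d^2 dividing a non-zero determinant; the summand \<open>D\<close> ensures
    that \<open>{1..B}\<close> contains \<open>{1..D}\<close>.\<close>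
  define B where "B = D + (\<Sum>A\<in>?M. nat \<bar>dt A\<bar>)"
  have inB: "d \<in> {1..B}" if "A \<in> ?M" "dt A \<noteq> 0" "d > 0" "int d ^ 2 dvd dt A" for A d
  proof -
    have "int d dvd dt A" using that(4) by (meson dvd_power dvd_trans zero_less_numeral)
    then have "d \<le> nat \<bar>dt A\<bar>" using that(2) dvd_imp_le_int[of "dt A" "int d"] by simp
    also have "\<dots> \<le> (\<Sum>A\<in>?M. nat \<bar>dt A\<bar>)" using fin that(1) by (intro member_le_sum) auto
    finally show ?thesis using that(3) by (simp add: B_def)
  qed
  have "real (sqfree_det_count H TYPE('n)) = (\<Sum>A | A \<in> ?M \<and> dt A \<noteq> 0. of_bool (squarefree (dt A)))"
    unfolding sqfree_det_count_eq sum_of_bool_card[OF finnz]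
    by (intro arg_cong[where f = "\<lambda>X. real (card X)"]) auto
  also have "\<dots> = (\<Sum>A | A \<in> ?M \<and> dt A \<noteq> 0. \<Sum>d\<in>{1..B}. mu d * of_bool (int d ^ 2 dvd dt A))"
    using inB by (intro sum.cong refl sum_mu_square_dvd[symmetric]) auto
  also have "\<dots> = (\<Sum>d\<in>{1..B}. mu d * det_count_nonzero TYPE('n) H (d ^ 2))"
    unfolding sum.swap[of _ "{1..B}"] sum_distrib_left[symmetric] sum_of_bool_card[OF finnz]
    by (intro sum.cong refl) (simp add: det_count_nonzero_def conj_ac)
  also have "{1..B} = {1..D} \<union> {Suc D..B}" by (auto simp: B_def)
  also have "(\<Sum>d\<in>{1..D} \<union> {Suc D..B}. mu d * det_count_nonzero TYPE('n) H (d ^ 2))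
     = (\<Sum>d=1..D. mu d * det_count_nonzero TYPE('n) H (d ^ 2)) + (\<Sum>d=Suc D..B. mu d * det_count_nonzero TYPE('n) H (d ^ 2))"
    by (rule sum.union_disjoint) auto
  finally have S: "real (sqfree_det_count H TYPE('n)) = \<dots>" .
  have cnz0: "det_count_nonzero TYPE('n) H m \<ge> 0" for m by (simp add: det_count_nonzero_def)
  have 1: "\<bar>(\<Sum>d=1..D. mu d * det_count_nonzero TYPE('n) H (d ^ 2)) - M * (\<Sum>d=1..D. mu d * ?r d)\<bar> \<le> (\<Sum>d=1..D. E d)"
  proof -
    have "(\<Sum>d=1..D. mu d * det_count_nonzero TYPE('n) H (d ^ 2)) - M * (\<Sum>d=1..D. mu d * ?r d)
       = (\<Sum>d=1..D. mu d * (det_count TYPE('n) H (d ^ 2) - det_count_zero TYPE('n) H - M * ?r d))"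
      by (simp add: det_count_eq sum_distrib_left sum_subtractf[symmetric] algebra_simps)
    also have "\<bar>\<dots>\<bar> \<le> (\<Sum>d=1..D. \<bar>mu d * (det_count TYPE('n) H (d ^ 2) - det_count_zero TYPE('n) H - M * ?r d)\<bar>)"
      by (rule sum_abs)
    also have "\<dots> \<le> (\<Sum>d=1..D. 1 * E d)"
      unfolding abs_mult by (intro sum_mono mult_mono E abs_mu_le_1) auto
    finally show ?thesis by simp
  qed
  have 2: "\<bar>\<Sum>d=Suc D..B. mu d * det_count_nonzero TYPE('n) H (d ^ 2)\<bar> \<le> (\<Sum>d. t (d + Suc D))"
  proof -
    have "\<bar>\<Sum>d=Suc D..B. mu d * det_count_nonzero TYPE('n) H (d ^ 2)\<bar> \<le> (\<Sum>d=Suc D..B. \<bar>mu d * det_count_nonzero TYPE('n) H (d ^ 2)\<bar>)"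
      by (rule sum_abs)
    also have "\<dots> \<le> (\<Sum>d=Suc D..B. 1 * t d)"
      unfolding abs_mult using cnz0 t by (intro sum_mono mult_mono abs_mu_le_1) auto
    also have "\<dots> = (\<Sum>d\<in>{..<Suc B - Suc D}. t (d + Suc D))"
      by (rule sum.reindex_bij_witness[of _ "\<lambda>d. d + Suc D" "\<lambda>d. d - Suc D"]) auto
    also have "\<dots> \<le> (\<Sum>d. t (d + Suc D))"
    proof (rule sum_le_suminf)
      show "summable (\<lambda>d. t (d + Suc D))" using t_summable by (subst summable_iff_shift)
      show "0 \<le> t (d + Suc D)" for d using t[of "d + Suc D"] cnz0[of "(d + Suc D) ^ 2"] by simp
    qed auto
    finally show ?thesis .
  qed
  have 3: "\<bar>singular_series CARD('n) - (\<Sum>d=1..D. mu d * ?r d)\<bar> \<le> (\<Sum>d. ?r (d + Suc D))"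
    unfolding singular_series_eq
    by (rule euler_product_mu[where g = ?r, OF resdens_prod_primes resdens_nonneg r_summable])
  have "M \<ge> 0" by (simp add: M_def)
  then have 4: "\<bar>M * singular_series CARD('n) - M * (\<Sum>d=1..D. mu d * ?r d)\<bar> \<le> M * (\<Sum>d. ?r (d + Suc D))"
    unfolding right_diff_distrib[symmetric] abs_mult using mult_left_mono[OF 3] by simp
  show ?thesis unfolding S using 1 2 4 by linarith
qed

text \<open>Splits -2 + \<eta> as (-1 - \<eta>) + (-1 + 2 * \<eta>): the first power is summable,
  the second is largest at the first index. The additional loss of \<eta> is harmless.\<close>

lemma powr_tail:
  fixes \<eta> :: real
  assumes "0 < \<eta>" "\<eta> \<le> 1/2"
  obtains C where "C \<ge> 0" "\<And>D. summable (\<lambda>d. real (d + Suc D) powr (-2 + \<eta>))"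
    "\<And>D. (\<Sum>d. real (d + Suc D) powr (-2 + \<eta>)) \<le> C * real (Suc D) powr (-1 + 2 * \<eta>)"
proof -
  let ?g = "\<lambda>d. real d powr (-1 - \<eta>)"
  have s1: "summable ?g" using assms by (simp add: summable_real_powr_iff)
  have s2: "summable (\<lambda>d. real d powr (-2 + \<eta>))" using assms by (simp add: summable_real_powr_iff)
  show ?thesis
  proof (rule that[of "suminf ?g"])
    show "suminf ?g \<ge> 0" by (rule suminf_nonneg[OF s1]) simp
    fix D
    show s3: "summable (\<lambda>d. real (d + Suc D) powr (-2 + \<eta>))"
      using s2 by (subst summable_iff_shift[where f = "\<lambda>d. real d powr (-2 + \<eta>)"])
    have s4: "summable (\<lambda>d. ?g (d + Suc D))"
      using s1 by (subst summable_iff_shift)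
    have "(\<Sum>d. real (d + Suc D) powr (-2 + \<eta>)) \<le> (\<Sum>d. ?g (d + Suc D) * real (Suc D) powr (-1 + 2 * \<eta>))"
    proof (rule suminf_le[OF _ s3])
      show "summable (\<lambda>d. ?g (d + Suc D) * real (Suc D) powr (-1 + 2 * \<eta>))" using s4 by (rule summable_mult2)
      fix d
      have "real (d + Suc D) powr (-2 + \<eta>) = ?g (d + Suc D) * real (d + Suc D) powr (-1 + 2 * \<eta>)"
        by (simp add: powr_add[symmetric])
      also have "\<dots> \<le> ?g (d + Suc D) * real (Suc D) powr (-1 + 2 * \<eta>)"
        using assms by (intro mult_left_mono powr_mono2') auto
      finally show "real (d + Suc D) powr (-2 + \<eta>) \<le> \<dots>" .
    qed
    also have "\<dots> = (\<Sum>d. ?g (d + Suc D)) * real (Suc D) powr (-1 + 2 * \<eta>)"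
      using s4 by (rule suminf_mult2[symmetric])
    also have "\<dots> \<le> suminf ?g * real (Suc D) powr (-1 + 2 * \<eta>)"
    proof (rule mult_right_mono)
      have "suminf ?g = (\<Sum>d. ?g (d + Suc D)) + (\<Sum>i<Suc D. ?g i)"
        by (rule suminf_split_initial_segment[OF s1])
      moreover have "(\<Sum>i<Suc D. ?g i) \<ge> 0" by (intro sum_nonneg) auto
      ultimately show "(\<Sum>d. ?g (d + Suc D)) \<le> suminf ?g" by linarith
    qed simp
    finally show "(\<Sum>d. real (d + Suc D) powr (-2 + \<eta>)) \<le> suminf ?g * real (Suc D) powr (-1 + 2 * \<eta>)" .
  qed
qed

section \<open>Bounds at squares for divisor powers, densities and determinant counts\<close>

lemma tau_square_power_le:
  fixes \<eta> :: real
  assumes "\<eta> > 0"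
  shows "\<exists>C\<ge>1. \<forall>d>0. real (tau (d ^ 2)) ^ k \<le> C * real d powr \<eta>"
proof -
  \<comment> \<open>Using k + 1 instead of k keeps the quotient positive also for k = 0.\<close>
  define \<epsilon> where "\<epsilon> = \<eta> / (2 * (real k + 1))"
  have eps: "\<epsilon> > 0" using assms by (simp add: \<epsilon>_def)
  obtain C where C1: "C \<ge> 1" "\<forall>m>0. real (tau m) \<le> C * real m powr \<epsilon>"
    using tau_le_powr[OF eps] by blast
  note C = C1(1) C1(2)[rule_format]
  show ?thesis
  proof (intro exI[of _ "C ^ k"] conjI allI impI)
    show "C ^ k \<ge> 1" using C(1) by (rule one_le_power)
    fix d :: nat assume d: "d > 0"
    have "real (tau (d ^ 2)) ^ k \<le> (C * real (d ^ 2) powr \<epsilon>) ^ k"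
      using C(2)[of "d ^ 2"] d by (intro power_mono) auto
    also have "\<dots> = C ^ k * (real (d ^ 2) powr \<epsilon>) ^ k" by (simp add: power_mult_distrib)
    also have "(real (d ^ 2) powr \<epsilon>) ^ k = real d powr (2 * \<epsilon> * real k)"
    proof -
      have "real (d ^ 2) powr \<epsilon> = real d powr (2 * \<epsilon>)"
      proof -
        have "real (d ^ 2) = real d powr 2" by (simp add: powr_numeral)
        then show ?thesis by (simp only: powr_powr)
      qed
      moreover have "(real d powr (2 * \<epsilon>)) ^ k = real d powr (2 * \<epsilon> * real k)"
        using d by (simp add: powr_realpow[symmetric] powr_powr)
      ultimately show ?thesis by simp
    qed
    also have "C ^ k * real d powr (2 * \<epsilon> * real k) \<le> C ^ k * real d powr \<eta>"
    proof (intro mult_left_mono powr_mono)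
      have "2 * \<epsilon> * real k = \<eta> * (real k / (real k + 1))" by (simp add: \<epsilon>_def field_simps)
      also have "\<dots> \<le> \<eta> * 1" using assms by (intro mult_left_mono) auto
      finally show "2 * \<epsilon> * real k \<le> \<eta>" by simp
    qed (use d C in auto)
    finally show "real (tau (d ^ 2)) ^ k \<le> C ^ k * real d powr \<eta>" .
  qed
qed

lemma powr_neg2: "d > 0 \<Longrightarrow> real d powr \<eta> / real (d ^ 2) = real d powr (-2 + \<eta>)"
  using powr_diff[of "real d" \<eta> 2] by (simp add: powr_numeral)

lemma resdens_square_le:
  fixes \<eta> :: real
  assumes "\<eta> > 0"
  shows "\<exists>C\<ge>1. \<forall>d>0. resdens TYPE('n::finite) (d ^ 2) \<le> C * real d powr (-2 + \<eta>)"
proof -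
  obtain C where C1: "C \<ge> 1" "\<forall>d>0. real (tau (d ^ 2)) ^ (CARD('n) - 1) \<le> C * real d powr \<eta>"
    using tau_square_power_le[OF assms, of "CARD('n) - 1"] by blast
  note C = C1(1) C1(2)[rule_format]
  show ?thesis
  proof (intro exI[of _ C] conjI allI impI C(1))
    fix d :: nat assume d: "d > 0"
    have "resdens TYPE('n) (d ^ 2) \<le> real (tau (d ^ 2)) ^ (CARD('n) - 1) / real (d ^ 2)"
      using d by (intro resdens_le) auto
    also have "\<dots> \<le> C * real d powr \<eta> / real (d ^ 2)"
      by (intro divide_right_mono C d) auto
    also have "\<dots> = C * real d powr (-2 + \<eta>)" unfolding powr_neg2[OF d, symmetric] by simp
    finally show "resdens TYPE('n) (d ^ 2) \<le> C * real d powr (-2 + \<eta>)" .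
  qed
qed

lemma summable_resdens_square: "summable (\<lambda>d. resdens TYPE('n::finite) (d ^ 2))"
proof -
  have half: "(0::real) < 1/2" by simp
  obtain C where C1: "C \<ge> 1" "\<forall>d>0. resdens TYPE('n) (d ^ 2) \<le> C * real d powr (-2 + 1/2)"
    using resdens_square_le[OF half, where 'n = 'n] by blast
  note C = C1(1) C1(2)[rule_format]
  have "summable (\<lambda>d. C * real d powr (-2 + 1/2))"
    by (intro summable_mult) (simp add: summable_real_powr_iff)
  moreover have "\<exists>N. \<forall>d\<ge>N. norm (resdens TYPE('n) (d ^ 2)) \<le> C * real d powr (-2 + 1/2)"
    using C(2) resdens_nonneg[of "TYPE('n)"] by (intro exI[of _ 1]) auto
  ultimately show ?thesis by (rule summable_comparison_test[rotated])
qed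

lemma det_count_nonzero_square_le:
  fixes \<eta> :: real
  assumes "\<eta> > 0"
  shows "\<exists>C\<ge>1. \<forall>H\<ge>1. \<forall>d>0.
     det_count_nonzero TYPE('n::finite) H (d ^ 2) \<le> C * real (card (mats (\<lambda>(_::'n) (_::'n). {-H..H}))) * real d powr (-2 + \<eta>)"
proof -
  obtain C where C1: "C \<ge> 1" "\<forall>d>0. real (tau (d ^ 2)) ^ CARD('n) \<le> C * real d powr \<eta>"
    using tau_square_power_le[OF assms, of "CARD('n)"] by blast
  note C = C1(1) C1(2)[rule_format]
  define B where "B = real CARD('n) * real (CARD('n) + 1) ^ CARD('n)"
  have B: "B \<ge> 1"
  proof -
    have "1 * 1 \<le> B" unfolding B_def
      by (intro mult_mono one_le_power) (auto simp: Suc_le_eq)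
    then show ?thesis by simp
  qed
  show ?thesis
  proof (intro exI[of _ "B ^ CARD('n) * C"] conjI allI impI)
    have "1 * 1 \<le> B ^ CARD('n) * C" using B C by (intro mult_mono one_le_power) auto
    then show "1 \<le> B ^ CARD('n) * C" by simp
    fix H :: int and d :: nat assume H: "H \<ge> 1" and d: "d > 0"
    let ?M = "real (card (mats (\<lambda>(_::'n) (_::'n). {-H..H})))"
    have u: "unit_rows {} id A = A" for A :: "'n \<Rightarrow> 'n \<Rightarrow> int" by (simp add: unit_rows_def)
    have "det_count_nonzero TYPE('n) H (d ^ 2) * real (d ^ 2) \<le> (B * tau (d ^ 2)) ^ CARD('n) * ?M"
      using count_dvd_dt_nonzero[OF H, of "d ^ 2" "UNIV :: 'n set" "{}" id] d
      unfolding u det_count_nonzero_def B_def by simp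
    also have "\<dots> = B ^ CARD('n) * ?M * real (tau (d ^ 2)) ^ CARD('n)" by (simp add: power_mult_distrib)
    also have "\<dots> \<le> B ^ CARD('n) * ?M * (C * real d powr \<eta>)"
      using B by (intro mult_left_mono C d) auto
    finally have "det_count_nonzero TYPE('n) H (d ^ 2) \<le> B ^ CARD('n) * ?M * (C * real d powr \<eta>) / real (d ^ 2)"
      using d by (simp add: pos_le_divide_eq)
    also have "\<dots> = B ^ CARD('n) * C * ?M * real d powr (-2 + \<eta>)"
      unfolding powr_neg2[OF d, symmetric] by simp
    finally show "det_count_nonzero TYPE('n) H (d ^ 2) \<le> B ^ CARD('n) * C * ?M * real d powr (-2 + \<eta>)" .
  qed
qed

section \<open>Volume of the box and size of the exponent\<close>

lemma power_add_one_diff_le: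
  fixes x :: real
  assumes "x \<ge> 0"
  shows "(x + 1) ^ Suc k - x ^ Suc k \<le> real (Suc k) * (x + 1) ^ k"
proof (induction k)
  case (Suc k)
  have "(x + 1) ^ Suc (Suc k) - x ^ Suc (Suc k) = (x + 1) * ((x + 1) ^ Suc k - x ^ Suc k) + x ^ Suc k"
    by (simp add: algebra_simps)
  also have "\<dots> \<le> (x + 1) * (real (Suc k) * (x + 1) ^ k) + (x + 1) ^ Suc k"
    using assms by (intro add_mono mult_left_mono Suc.IH power_mono) auto
  also have "\<dots> = real (Suc (Suc k)) * (x + 1) ^ Suc k" by (simp add: algebra_simps)
  finally show ?case .
qed simp

lemma card_mats_interval:
  assumes "H \<ge> 0"
  shows "real (card (mats (\<lambda>(_::'n::finite) (_::'n). {-H..H}))) = (2 * real_of_int H + 1) ^ (CARD('n) ^ 2)"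
  unfolding card_mats_const using assms by simp

lemma box_volume_diff:
  assumes H: "H \<ge> 1" and \<gamma>: "\<gamma> \<le> 1" and k: "k > 0"
  shows "\<bar>(2 * real_of_int H + 1) ^ k - (2 * real_of_int H) ^ k\<bar> \<le> real k * 3 ^ k * real_of_int H powr (real k - \<gamma>)"
proof -
  let ?h = "real_of_int H"
  have h: "?h \<ge> 1" using H by simp
  obtain j where j: "k = Suc j" using k by (cases k) auto
  have "(2 * ?h) ^ k \<le> (2 * ?h + 1) ^ k" using h by (intro power_mono) auto
  then have "\<bar>(2 * ?h + 1) ^ k - (2 * ?h) ^ k\<bar> = (2 * ?h + 1) ^ k - (2 * ?h) ^ k" by simp
  also have "\<dots> \<le> real k * (2 * ?h + 1) ^ j"
    unfolding j using h by (intro power_add_one_diff_le) auto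
  also have "\<dots> \<le> real k * (3 * ?h) ^ j"
    using h by (intro mult_left_mono power_mono) auto
  also have "\<dots> = real k * 3 ^ j * ?h ^ j" by (simp add: power_mult_distrib)
  also have "\<dots> \<le> real k * 3 ^ k * ?h powr (real k - \<gamma>)"
  proof (intro mult_mono)
    show "(3::real) ^ j \<le> 3 ^ k" by (rule power_increasing) (auto simp: j)
    have "?h ^ j = ?h powr real j" using h by (simp add: powr_realpow)
    also have "\<dots> \<le> ?h powr (real k - \<gamma>)" using h \<gamma> by (intro powr_mono) (auto simp: j)
    finally show "?h ^ j \<le> ?h powr (real k - \<gamma>)" .
  qed (use h in auto)
  finally show ?thesis .
qed

lemma gamma_denominator_pos: "n \<ge> 1 \<Longrightarrow> real n ^ 3 + 3 * real n ^ 2 - real n + 1 > 0"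
proof -
  assume "n \<ge> 1"
  then have "real n * 1 \<le> real n * real n" by (intro mult_left_mono) auto
  moreover have "real n ^ 3 \<ge> 0" by simp
  moreover have "real n \<ge> 0" by simp
  ultimately show ?thesis unfolding power2_eq_square by linarith
qed

text \<open>After clearing denominators this is x^3 - x^2 + 3 * x + 1 > 0. The strictness leaves the
  room that absorbs the divisor functions in \<open>sieve_bound\<close>.\<close>

lemma gamma_exp_less: "n \<ge> 1 \<Longrightarrow> gamma_exp n < 1/2 + 1 / (8 * real n)"
proof -
  assume n: "n \<ge> 1"
  define x where "x = real n"
  let ?q = "x ^ 3 + 3 * x ^ 2 - x + 1"
  have x: "x \<ge> 1" using n by (simp add: x_def)
  have q: "?q > 0" using gamma_denominator_pos[OF n] by (simp add: x_def)
  have "x ^ 2 * 1 \<le> x ^ 2 * x" using x by (intro mult_left_mono) auto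
  then have "x ^ 2 \<le> x ^ 3" by (simp add: power3_eq_cube power2_eq_square)
  then have "4 * x ^ 2 - 4 * x < ?q" using x by linarith
  then have "(x - 1) * (8 * x) < 2 * ?q" by (simp add: algebra_simps power2_eq_square)
  then have "(x - 1) / (2 * ?q) < 1 / (8 * x)" using q x by (simp add: field_simps)
  then show ?thesis by (simp add: gamma_exp_def x_def)
qed

lemma gamma_exp_le: "n \<ge> 1 \<Longrightarrow> gamma_exp n \<le> 3/4"
proof -
  assume n: "n \<ge> 1"
  have "1 / (8 * real n) \<le> 1 / 8" using n by (simp add: field_simps)
  then show ?thesis using gamma_exp_less[OF n] by linarith
qed

lemma gamma_exp_ge: "n \<ge> 1 \<Longrightarrow> gamma_exp n \<ge> 1/2"
  using gamma_denominator_pos[of n] by (simp add: gamma_exp_def)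

section \<open>The one-dimensional case\<close>

lemma suminf_inverse_squares_le:
  "(\<Sum>d. 1 / real (d + Suc D) ^ 2) \<le> 2 / real (Suc D)" "summable (\<lambda>d. 1 / real (d + Suc D) ^ 2)"
proof -
  let ?f = "\<lambda>d. 1 / real (d + Suc D)"
  have lim: "?f \<longlonglongrightarrow> 0"
    using LIMSEQ_ignore_initial_segment[OF lim_1_over_n, of "Suc D"] by simp
  have sums: "(\<lambda>d. 2 * (?f d - ?f (Suc d))) sums (2 * (?f 0 - 0))"
    by (intro sums_mult telescope_sums' lim)
  have le: "1 / real (d + Suc D) ^ 2 \<le> 2 * (?f d - ?f (Suc d))" for d
  proof -
    have "1 / x ^ 2 \<le> 2 * (1 / x - 1 / (x + 1))" if "x \<ge> 1" for x :: real
    proof -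
      have "x * 1 \<le> x * x" using that by (intro mult_left_mono) auto
      then have "1 / x ^ 2 \<le> 1 / (x * (x + 1) / 2)"
      proof (intro divide_left_mono)
        show "0 < x ^ 2 * (x * (x + 1) / 2)" using that by (intro mult_pos_pos divide_pos_pos) auto
      qed (auto simp: power2_eq_square algebra_simps)
      also have "\<dots> = 2 * (1 / x - 1 / (x + 1))" using that by (simp add: field_simps)
      finally show ?thesis .
    qed
    from this[of "real (d + Suc D)"] show ?thesis by (simp add: add_ac)
  qed
  show s: "summable (\<lambda>d. 1 / real (d + Suc D) ^ 2)"
    by (rule summable_comparison_test[OF _ sums_summable[OF sums]]) (use le in auto)
  have "(\<Sum>d. 1 / real (d + Suc D) ^ 2) \<le> (\<Sum>d. 2 * (?f d - ?f (Suc d)))"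
    by (rule suminf_le[OF le s sums_summable[OF sums]])
  also have "\<dots> = 2 / real (Suc D)" using sums_unique[OF sums] by simp
  finally show "(\<Sum>d. 1 / real (d + Suc D) ^ 2) \<le> 2 / real (Suc D)" .
qed

lemma dt_one_dim:
  fixes A :: "'n::finite \<Rightarrow> 'n \<Rightarrow> int"
  assumes "UNIV = {i :: 'n}"
  shows "\<bar>dt A\<bar> = \<bar>A i i\<bar>"
proof -
  have all: "k = i" for k :: 'n using assms by (metis UNIV_I singletonD)
  have "A(i := unit_row i) = (\<lambda>k. unit_row (id k))" by (metis (mono_tags) all ext fun_upd_same id_apply)
  then have "\<bar>dt (A(i := unit_row i))\<bar> = 1" using dt_unit_rows_bij[OF bij_id] by simp
  moreover have "dt (A(i := A i)) = A i i * dt (A(i := unit_row i))"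
    by (subst dt_row_expand) (simp add: assms)
  ultimately show ?thesis by (simp add: abs_mult)
qed

lemma card_mats_one_dim:
  assumes "UNIV = {i :: 'n::finite}"
  shows "card {A \<in> mats (\<lambda>(_::'n) (_::'n). V). P (A i i)} = card {b \<in> V. P b}"
proof (rule bij_betw_same_card)
  have all: "k = i" for k :: 'n using assms by (metis UNIV_I singletonD)
  show "bij_betw (\<lambda>A. A i i) {A \<in> mats (\<lambda>(_::'n) (_::'n). V). P (A i i)} {b \<in> V. P b}"
    by (rule bij_betw_byWitness[where f' = "\<lambda>b _ _. b"])
       (auto simp: mats_def fun_eq_iff, (metis all)+)
qed

text \<open>The subtracted 1 is the multiple 0, which corresponds to the singular matrices. With q
  the floor of H / m the count is 2 * q + 1; the floor costs at most 2 and the term 1 / m at most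
  1.\<close>

lemma card_multiples_interval:
  assumes H: "H \<ge> 0" and m: "m > 0"
  shows "\<bar>real (card {b \<in> {-H..H}. int m dvd b}) - 1 - (2 * real_of_int H + 1) / real m\<bar> \<le> 3"
proof -
  define q where "q = H div int m"
  have "{b \<in> {-H..H}. int m dvd b} = (\<lambda>k. int m * k) ` {-q..q}"
  proof (intro equalityI subsetI)
    fix b assume "b \<in> {b \<in> {-H..H}. int m dvd b}"
    then obtain k where k: "b = int m * k" "- H \<le> int m * k" "int m * k \<le> H" by auto
    have "k \<le> q" using zdiv_mono1[OF k(3), of "int m"] m by (simp add: q_def)
    moreover have "int m * - k \<le> H" using k(2) by simp
    then have "- k \<le> q" using zdiv_mono1[of "int m * - k" H "int m"] m by (simp add: q_def del: mult_minus_right)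
    ultimately show "b \<in> (\<lambda>k. int m * k) ` {-q..q}" using k by auto
  next
    fix b assume "b \<in> (\<lambda>k. int m * k) ` {-q..q}"
    then obtain k where "b = int m * k" "k \<in> {-q..q}" by (rule imageE)
    then have k: "b = int m * k" "- q \<le> k" "k \<le> q" by simp_all
    have "int m * q \<le> H"
      using mult_div_mod_eq[of "int m" H] pos_mod_sign[of "int m" H] m unfolding q_def by linarith
    moreover have "int m * k \<le> int m * q" "int m * (- k) \<le> int m * q" using k m by (intro mult_left_mono; simp)+
    ultimately show "b \<in> {b \<in> {-H..H}. int m dvd b}" using k(1) by auto
  qed
  moreover have "inj_on (\<lambda>k. int m * k) {-q..q}" using m by (auto simp: inj_on_def)
  ultimately have "card {b \<in> {-H..H}. int m dvd b} = card {-q..q}" by (simp add: card_image)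
  moreover have "q \<ge> 0" using H m by (simp add: q_def pos_imp_zdiv_nonneg_iff)
  ultimately have c: "real (card {b \<in> {-H..H}. int m dvd b}) = 2 * real_of_int q + 1" by simp
  have q: "real_of_int q = real_of_int \<lfloor>real_of_int H / real m\<rfloor>"
    using floor_divide_of_int_eq[of H "int m", where 'a = real] by (simp add: q_def)
  have "(2 * real_of_int H + 1) / real m = 2 * (real_of_int H / real m) + 1 / real m" by (simp add: add_divide_distrib)
  moreover have "0 \<le> 1 / real m" "1 / real m \<le> 1" using m by auto
  moreover have "real_of_int q \<le> real_of_int H / real m" "real_of_int H / real m < real_of_int q + 1" unfolding q by linarith+
  ultimately show ?thesis unfolding c abs_le_iff by linarith
qed

lemma sieve_bound_one_dim:
  assumes n: "CARD('n::finite) = 1" and H: "H \<ge> 1"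
  shows "\<bar>real (sqfree_det_count H TYPE('n)) - real (card (mats (\<lambda>(_::'n) (_::'n). {-H..H}))) * singular_series CARD('n)\<bar>
     \<le> 9 * real_of_int H powr (real (CARD('n) ^ 2) - gamma_exp CARD('n))"
proof -
  obtain i :: 'n where i: "UNIV = {i}" using n by (auto simp: card_1_singleton_iff)
  let ?h = "real_of_int H" and ?M = "real (card (mats (\<lambda>(_::'n) (_::'n). {-H..H})))"
  have h: "?h \<ge> 1" using H by simp
  \<comment> \<open>Beyond the square root of \<open>H\<close> no non-zero entry of the box is
    divisible by d^2, so the upper bound for large \<open>d\<close> can be 0.\<close>
  define D where "D = nat \<lfloor>sqrt ?h\<rfloor>"
  have D: "real D \<le> sqrt ?h" "sqrt ?h < real (Suc D)"
  proof -
    have "sqrt ?h \<ge> 0" using h by simp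
    then show "real D \<le> sqrt ?h" unfolding D_def by (rule of_nat_floor)
    show "sqrt ?h < real (Suc D)" unfolding D_def by linarith
  qed
  have dvd: "int m dvd dt A \<longleftrightarrow> int m dvd A i i" and zero: "dt A = 0 \<longleftrightarrow> A i i = 0" for A :: "'n \<Rightarrow> 'n \<Rightarrow> int" and m
    using dt_one_dim[OF i, of A] by (metis dvd_abs_iff, linarith)
  have M: "?M = 2 * ?h + 1" using card_mats_interval[of H, where 'n = 'n] H n by simp
  have cnt: "det_count TYPE('n) H m = real (card {b \<in> {-H..H}. int m dvd b})" for m
    unfolding det_count_def dvd using card_mats_one_dim[OF i] by simp
  have sing: "det_count_zero TYPE('n) H = 1"
  proof -
    have "{b \<in> {-H..H}. b = 0} = {0}" using H by auto
    then show ?thesis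
      unfolding det_count_zero_def zero using card_mats_one_dim[OF i, of "{-H..H}" "\<lambda>b. b = 0"] by simp
  qed
  have res: "resdens TYPE('n) m = 1 / real m" if m: "m > 0" for m
  proof -
    have "{b \<in> {0..<int m}. int m dvd b} = {0}" using m by (auto dest: zdvd_imp_le)
    then show ?thesis
      unfolding resdens_def dens_def dvd card_mats_const
      using card_mats_one_dim[OF i, of "{0..<int m}" "\<lambda>b. int m dvd b"] n by simp
  qed
  have "\<bar>real (sqfree_det_count H TYPE('n)) - ?M * singular_series CARD('n)\<bar>
     \<le> (\<Sum>d=1..D. 3) + (\<Sum>d. (\<lambda>_. 0) (d + Suc D)) + ?M * (\<Sum>d. resdens TYPE('n) ((d + Suc D) ^ 2))"
  proof (rule square_sieve)
    fix d :: nat assume "1 \<le> d" "d \<le> D"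
    then show "\<bar>det_count TYPE('n) H (d ^ 2) - det_count_zero TYPE('n) H - ?M * resdens TYPE('n) (d ^ 2)\<bar> \<le> 3"
      using card_multiples_interval[of H "d ^ 2"] H by (simp add: cnt sing res M)
  next
    fix d :: nat assume d: "D < d"
    have "sqrt ?h < real d" using D(2) d by linarith
    then have "sqrt ?h < sqrt (real d ^ 2)" by simp
    then have "?h < real d ^ 2" by (simp only: real_sqrt_less_iff)
    then have "H < int (d ^ 2)" by (metis of_int_less_iff of_int_of_nat_eq of_nat_power)
    note Hd = this
    have "\<not> (int (d ^ 2) dvd b \<and> b \<noteq> 0)" if "b \<in> {-H..H}" for b
    proof
      assume "int (d ^ 2) dvd b \<and> b \<noteq> 0"
      then have "\<bar>int (d ^ 2)\<bar> \<le> \<bar>b\<bar>" using dvd_imp_le_int by blast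
      moreover have "\<bar>b\<bar> \<le> H" using that by auto
      ultimately show False using Hd by linarith
    qed
    then have e: "{b \<in> {-H..H}. int (d ^ 2) dvd b \<and> b \<noteq> 0} = {}" by blast
    show "det_count_nonzero TYPE('n) H (d ^ 2) \<le> 0"
      unfolding det_count_nonzero_def dvd zero
      using card_mats_one_dim[OF i, of "{-H..H}" "\<lambda>b. int (d ^ 2) dvd b \<and> b \<noteq> 0"]
      unfolding e by (simp only: card.empty of_nat_0)
  qed (auto intro: summable_resdens_square)
  also have "(\<Sum>d. resdens TYPE('n) ((d + Suc D) ^ 2)) = (\<Sum>d. 1 / real (d + Suc D) ^ 2)"
    by (intro suminf_cong) (simp add: res)
  \<comment> \<open>Error 3 for each of at most sqrt H values of \<open>d\<close>; the tail of
    inverse squares is at most 2 / sqrt H and the volume at most 3 * H. Together this is 9 * sqrt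
    H.\<close>
  also have "(\<Sum>d=1..D. 3) + (\<Sum>d. (\<lambda>_. 0) (d + Suc D)) + ?M * (\<Sum>d. 1 / real (d + Suc D) ^ 2)
     \<le> 3 * sqrt ?h + 0 + 3 * ?h * (2 / sqrt ?h)"
  proof (intro add_mono mult_mono)
    have "2 / real (Suc D) \<le> 2 / sqrt ?h" using D(2) h by (intro divide_left_mono) auto
    then show "(\<Sum>d. 1 / real (d + Suc D) ^ 2) \<le> 2 / sqrt ?h" using suminf_inverse_squares_le(1)[of D] by linarith
    show "0 \<le> (\<Sum>d. 1 / real (d + Suc D) ^ 2)" by (rule suminf_nonneg[OF suminf_inverse_squares_le(2)]) simp
  qed (use D h in \<open>auto simp: M\<close>)
  also have "\<dots> = 3 * sqrt ?h + 6 * (?h / sqrt ?h)" by simp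
  also have "\<dots> = 9 * sqrt ?h" using h by (subst real_div_sqrt) auto
  also have "sqrt ?h = ?h powr (real (CARD('n) ^ 2) - gamma_exp CARD('n))"
    using h n by (simp add: gamma_exp_def powr_half_sqrt)
  finally show ?thesis .
qed

section \<open>The case of at least two rows\<close>

lemma one_plus_ln_square_le:
  assumes "d > 0"
  shows "(1 + ln (real (d ^ 2))) ^ 2 \<le> 289 * real d powr (1/4)"
proof -
  have d: "real d \<ge> 1" using assms by simp
  have "ln (real d) \<le> real d powr (1/8) / (1/8)" using d by (intro ln_powr_bound) auto
  moreover have "real d powr (1/8) \<ge> 1" using d by (intro ge_one_powr_ge_zero) auto
  moreover have "ln (real (d ^ 2)) = 2 * ln (real d)" using d by (simp add: ln_realpow)
  \<comment> \<open>17 = 1 + 2 * 8, as ln d is at most 8 * d powr (1/8).\<close>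
  ultimately have "1 + ln (real (d ^ 2)) \<le> 17 * real d powr (1/8)" by simp
  moreover have "ln (real (d ^ 2)) \<ge> 0" using d by (simp add: ln_realpow)
  ultimately have "(1 + ln (real (d ^ 2))) ^ 2 \<le> (17 * real d powr (1/8)) ^ 2" by (intro power_mono) auto
  also have "\<dots> = 289 * real d powr (1/4)" by (simp add: power_mult_distrib power2_eq_square powr_add[symmetric])
  finally show ?thesis .
qed

text \<open>On this range d^2 is at most H powr (1 + 1 / (4 * n)), which permits K = 2 * H powr (1 /
  (4 * n)). In \<open>dens_residues_diff\<close> the power K^n then costs H powr (1/4), dividing by
  2 * H + 1 gains a factor H, and the divisor function and the logarithm, each bounded by d powr
  (1/4), turn 1 / d^2 into d powr (-3/2).\<close>

lemma det_count_approx: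
  assumes n: "CARD('n::finite) \<ge> 2"
  shows "\<exists>C\<ge>0. \<forall>H\<ge>1. \<forall>d>0. real d \<le> real_of_int H powr (1/2 + 1 / (8 * real CARD('n))) \<longrightarrow>
     \<bar>det_count TYPE('n) H (d ^ 2) - real (card (mats (\<lambda>(_::'n) (_::'n). {-H..H}))) * resdens TYPE('n) (d ^ 2)\<bar>
     \<le> C * real_of_int H powr (real (CARD('n) ^ 2) - 3/4) * real d powr (-3/2)"
proof -
  let ?n = "CARD('n)"
  have q: "(0::real) < 1/4" by simp
  obtain Ct where Ct: "Ct \<ge> 1" "\<forall>d>0. real (tau (d ^ 2)) ^ ?n \<le> Ct * real d powr (1/4)"
    using tau_square_power_le[OF q, of ?n] by blast
  define C where "C = 3 ^ (?n ^ 2 - 1) * (real ?n ^ 2 * (2 ^ ?n * Ct * 289))"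
  have "C \<ge> 0" using Ct(1) by (simp add: C_def)
  moreover have "\<bar>det_count TYPE('n) H (d ^ 2) - real (card (mats (\<lambda>(_::'n) (_::'n). {-H..H}))) * resdens TYPE('n) (d ^ 2)\<bar>
     \<le> C * real_of_int H powr (real (?n ^ 2) - 3/4) * real d powr (-3/2)"
    if H: "H \<ge> 1" and d: "d > 0" and dH: "real d \<le> real_of_int H powr (1/2 + 1 / (8 * real ?n))" for H :: int and d :: nat
  proof -
    define h where "h = real_of_int H"
    define N where "N = 2 * h + 1"
    define M where "M = real (card (mats (\<lambda>(_::'n) (_::'n). {-H..H})))"
    define K where "K = 2 * h powr (1 / (4 * real ?n))"
    define L where "L = 1 + ln (real (d ^ 2))"
    let ?W = "\<lambda>(_::'n) (_::'n). {-H..H}"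
    have h: "h \<ge> 1" using H by (simp add: h_def)
    have N: "N > 0" "N = real_of_int (2 * H + 1)" "N \<le> 3 * h" using h by (simp_all add: N_def h_def)
    obtain k where k: "?n ^ 2 = Suc k" using n by (metis Suc_pred' zero_less_card_finite zero_less_power)
    have M: "M = N ^ k * N" using card_mats_interval[of H, where 'n = 'n] H k by (simp add: M_def N_def h_def)
    have M0: "M > 0" unfolding M using N by simp
    have Km: "K \<ge> 1 + real (d ^ 2) / real_of_int (2 * H + 1)"
    proof -
      have "real (d ^ 2) \<le> (h powr (1/2 + 1 / (8 * real ?n))) ^ 2"
        unfolding of_nat_power using dH by (intro power_mono) (auto simp: h_def)
      also have "\<dots> = h powr (2 * (1/2 + 1 / (8 * real ?n)))"
        by (simp only: power2_eq_square powr_add[symmetric] mult_2)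
      also have "2 * (1/2 + 1 / (8 * real ?n)) = 1 + 1 / (4 * real ?n)" by (simp add: field_simps)
      also have "h powr (1 + 1 / (4 * real ?n)) = h * h powr (1 / (4 * real ?n))" using h by (simp add: powr_add)
      also have "\<dots> \<le> N * h powr (1 / (4 * real ?n))" using h by (intro mult_right_mono) (auto simp: N_def)
      finally have "real (d ^ 2) / N \<le> h powr (1 / (4 * real ?n))" using N by (simp add: pos_divide_le_eq mult.commute)
      moreover have "1 \<le> h powr (1 / (4 * real ?n))" using h by (intro ge_one_powr_ge_zero) auto
      ultimately show ?thesis unfolding K_def N(2)[symmetric] by simp
    qed
    have "det_count TYPE('n) H (d ^ 2) = M * dens ?W (d ^ 2)"
      using M0 by (simp add: det_count_def dens_def M_def)
    then have "\<bar>det_count TYPE('n) H (d ^ 2) - M * resdens TYPE('n) (d ^ 2)\<bar> = M * \<bar>dens ?W (d ^ 2) - resdens TYPE('n) (d ^ 2)\<bar>"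
      using M0 by (simp add: abs_mult flip: right_diff_distrib)
    also have "\<dots> = N ^ k * (\<bar>dens ?W (d ^ 2) - resdens TYPE('n) (d ^ 2)\<bar> * (real (d ^ 2) * N)) / real (d ^ 2)"
      unfolding M using d by simp
    also have "\<dots> \<le> N ^ k * (real ?n ^ 2 * (K * tau (d ^ 2)) ^ ?n * L ^ 2) / real (d ^ 2)"
      using dens_residues_diff[OF n _ _ Km L_def] d H N unfolding resdens_def N(2)[symmetric]
      by (intro divide_right_mono mult_left_mono) auto
    also have "\<dots> \<le> (3 ^ k * h ^ k) * (real ?n ^ 2 * (2 ^ ?n * h powr (1/4) * (Ct * real d powr (1/4))) * (289 * real d powr (1/4))) / real (d ^ 2)"
    proof (intro divide_right_mono mult_mono mult_left_mono)
      show "N ^ k \<le> 3 ^ k * h ^ k" unfolding power_mult_distrib[symmetric] using N by (intro power_mono) auto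
      show "L ^ 2 \<le> 289 * real d powr (1/4)" unfolding L_def by (rule one_plus_ln_square_le[OF d])
      have "(K * tau (d ^ 2)) ^ ?n = 2 ^ ?n * (h powr (1 / (4 * real ?n))) ^ ?n * real (tau (d ^ 2)) ^ ?n"
        by (simp add: K_def power_mult_distrib)
      also have "(h powr (1 / (4 * real ?n))) ^ ?n = h powr (1/4)"
        using h by (simp add: powr_realpow[symmetric] powr_powr)
      also have "2 ^ ?n * h powr (1/4) * real (tau (d ^ 2)) ^ ?n \<le> 2 ^ ?n * h powr (1/4) * (Ct * real d powr (1/4))"
        using Ct(2) d by (intro mult_left_mono) auto
      finally show "(K * tau (d ^ 2)) ^ ?n \<le> 2 ^ ?n * h powr (1/4) * (Ct * real d powr (1/4))" .
    qed (use h Ct N in \<open>auto simp: K_def\<close>)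
    also have "\<dots> = C * (h ^ k * h powr (1/4)) * (real d powr (1/4 + 1/4) / real (d ^ 2))"
      unfolding powr_add by (simp add: C_def k)
    also have "real d powr (1/4 + 1/4) / real (d ^ 2) = real d powr (-3/2)"
      unfolding powr_neg2[OF d] by simp
    also have "h ^ k * h powr (1/4) = h powr (real (?n ^ 2) - 3/4)"
      using h unfolding k by (simp add: powr_realpow[symmetric] powr_add[symmetric] add.commute)
    finally show ?thesis unfolding M_def h_def .
  qed
  ultimately show ?thesis by blast
qed

lemma sieve_bound:
  assumes n: "CARD('n::finite) \<ge> 2"
  shows "\<exists>C\<ge>0. \<forall>H\<ge>1.
     \<bar>real (sqfree_det_count H TYPE('n)) - real (card (mats (\<lambda>(_::'n) (_::'n). {-H..H}))) * singular_series CARD('n)\<bar>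
     \<le> C * real_of_int H powr (real (CARD('n) ^ 2) - gamma_exp CARD('n))"
proof -
  let ?n = "CARD('n)"
  define \<gamma> \<theta> where "\<gamma> = gamma_exp ?n" and "\<theta> = 1/2 + 1 / (8 * real ?n)"
  define \<eta> where "\<eta> = (1 - \<gamma> / \<theta>) / 2" \<comment> \<open>chosen so that \<open>\<theta> * (1 - 2 * \<eta>) = \<gamma>\<close>\<close>
  have n1: "?n \<ge> 1" using n by simp
  have \<gamma>: "1/2 \<le> \<gamma>" "\<gamma> \<le> 3/4" "\<gamma> < \<theta>"
    using gamma_exp_ge[OF n1] gamma_exp_le[OF n1] gamma_exp_less[OF n1] by (simp_all add: \<gamma>_def \<theta>_def)
  have \<eta>: "0 < \<eta>" "\<eta> \<le> 1/2" using \<gamma> by (simp_all add: \<eta>_def field_simps)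
  have \<theta>\<eta>: "\<theta> * (-1 + 2 * \<eta>) = - \<gamma>" using \<gamma> by (simp add: \<eta>_def field_simps)
  obtain Cr where Cr: "Cr \<ge> 1" "\<forall>d>0. resdens TYPE('n) (d ^ 2) \<le> Cr * real d powr (-2 + \<eta>)"
    using resdens_square_le[OF \<eta>(1), where 'n = 'n] by blast
  obtain Ct where Ct: "Ct \<ge> 1" "\<forall>H\<ge>1. \<forall>d>0. det_count_nonzero TYPE('n) H (d ^ 2)
       \<le> Ct * real (card (mats (\<lambda>(_::'n) (_::'n). {-H..H}))) * real d powr (-2 + \<eta>)"
    using det_count_nonzero_square_le[OF \<eta>(1), where 'n = 'n] by blast
  obtain Ca where Ca: "Ca \<ge> 0" "\<forall>H\<ge>1. \<forall>d>0. real d \<le> real_of_int H powr (1/2 + 1 / (8 * real ?n)) \<longrightarrow>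
     \<bar>det_count TYPE('n) H (d ^ 2) - real (card (mats (\<lambda>(_::'n) (_::'n). {-H..H}))) * resdens TYPE('n) (d ^ 2)\<bar>
     \<le> Ca * real_of_int H powr (real (?n ^ 2) - 3/4) * real d powr (-3/2)"
    using det_count_approx[OF n] by blast
  obtain Cp where Cp: "Cp \<ge> 0" "\<And>D. summable (\<lambda>d. real (d + Suc D) powr (-2 + \<eta>))"
    "\<And>D. (\<Sum>d. real (d + Suc D) powr (-2 + \<eta>)) \<le> Cp * real (Suc D) powr (-1 + 2 * \<eta>)"
    using powr_tail[OF \<eta>] by metis
  have s32: "summable (\<lambda>d. real d powr (-3/2))" by (simp add: summable_real_powr_iff)
  define Cs where "Cs = (\<Sum>d. real d powr (-3/2))"
  have Cs0: "Cs \<ge> 0" unfolding Cs_def by (rule suminf_nonneg[OF s32]) simp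
  let ?T = "3 ^ (?n ^ 2) :: real"
  \<comment> \<open>One summand for each error: the approximation up to \<open>D\<close>, the
    singular matrices subtracted for each of these \<open>d\<close>, the matrices with larger
    \<open>d\<close>, and the tail of the Euler product.\<close>
  define C where "C = Ca * Cs + (?T * Cr * 2 + Ca) + Ct * ?T * Cp + ?T * Cr * Cp"
  have "C \<ge> 0" using Ca Cs0 Cr Ct Cp by (simp add: C_def)
  moreover have "\<bar>real (sqfree_det_count H TYPE('n)) - real (card (mats (\<lambda>(_::'n) (_::'n). {-H..H}))) * singular_series ?n\<bar>
     \<le> C * real_of_int H powr (real (?n ^ 2) - gamma_exp ?n)" if H: "H \<ge> 1" for H :: int
  proof -
    define h where "h = real_of_int H"
    define M where "M = real (card (mats (\<lambda>(_::'n) (_::'n). {-H..H})))"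
    define D where "D = nat \<lfloor>h powr \<theta>\<rfloor>"
    define P Q X where "P = h powr (real (?n ^ 2) - \<gamma>)" and "Q = h powr (real (?n ^ 2) - 3/4)"
      and "X = real (Suc D) powr (-1 + 2 * \<eta>)"
    define e where "e = (\<lambda>d. Ca * Q * real d powr (-3/2))"
    define z where "z = det_count_zero TYPE('n) H"
    have h: "h \<ge> 1" using H by (simp add: h_def)
    have D: "real D \<le> h powr \<theta>" "h powr \<theta> \<le> real (Suc D)" "D \<ge> 1"
    proof -
      show "real D \<le> h powr \<theta>" unfolding D_def by (rule of_nat_floor) simp
      show "h powr \<theta> \<le> real (Suc D)" unfolding D_def by linarith
      have "h powr \<theta> \<ge> 1" using h \<gamma> by (intro ge_one_powr_ge_zero) auto
      then show "D \<ge> 1" unfolding D_def by linarith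
    qed
    have P0: "P \<ge> 0" and Q0: "Q \<ge> 0" and X0: "X \<ge> 0" by (simp_all add: P_def Q_def X_def)
    have QP: "Q \<le> P" unfolding P_def Q_def using h \<gamma> by (intro powr_mono) auto
    have M0: "M \<ge> 0" by (simp add: M_def)
    \<comment> \<open>Volume times tail power: since \<open>Suc D\<close> is at least h powr
      \<theta>, the choice of \<eta> produces the exponent n^2 - \<gamma>.\<close>
    have MX: "M * X \<le> ?T * P"
    proof -
      have "M = (2 * h + 1) ^ (?n ^ 2)" using card_mats_interval[of H, where 'n = 'n] H by (simp add: M_def h_def)
      also have "\<dots> \<le> (3 * h) ^ (?n ^ 2)" using h by (intro power_mono) auto
      also have "\<dots> = ?T * h ^ (?n ^ 2)" by (rule power_mult_distrib)
      also have "h ^ (?n ^ 2) = h powr real (?n ^ 2)" by (rule powr_realpow[symmetric]) (use h in simp)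
      finally have 1: "M \<le> ?T * h powr real (?n ^ 2)" .
      have "X \<le> (h powr \<theta>) powr (-1 + 2 * \<eta>)"
        unfolding X_def using D h \<eta> by (intro powr_mono2') auto
      also have "\<dots> = h powr (- \<gamma>)" unfolding powr_powr \<theta>\<eta> ..
      finally have 2: "X \<le> h powr (- \<gamma>)" .
      have "M * X \<le> (?T * h powr real (?n ^ 2)) * h powr (- \<gamma>)"
        using 1 2 M0 X0 by (intro mult_mono) auto
      also have "\<dots> = ?T * P" by (simp add: P_def powr_add[symmetric])
      finally show ?thesis .
    qed
    have e: "\<bar>det_count TYPE('n) H (d ^ 2) - M * resdens TYPE('n) (d ^ 2)\<bar> \<le> e d" if "1 \<le> d" "d \<le> D" for d
    proof -
      have "real d \<le> h powr \<theta>" using that D by linarith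
      then show ?thesis using Ca(2) H that unfolding e_def M_def Q_def h_def \<theta>_def by simp
    qed
    have z0: "z \<ge> 0" by (simp add: z_def det_count_zero_def)
    \<comment> \<open>Each \<open>d\<close> up to \<open>D\<close> carries the error
      \<open>z\<close>. A singular matrix has determinant divisible by D^2, so \<open>z\<close> is
      at most about M / D^2, and \<open>D\<close> copies cost about M / D.\<close>
    have zD: "real D * z \<le> (?T * Cr * 2 + Ca) * P"
    proof -
      have D0: "D > 0" using D(3) by simp
      have "z \<le> det_count TYPE('n) H (D ^ 2)" by (simp add: det_count_eq z_def det_count_nonzero_def)
      also have "\<dots> \<le> M * resdens TYPE('n) (D ^ 2) + e D" using e[of D] D(3) by linarith
      also have "\<dots> \<le> M * (Cr * real D powr (-2 + \<eta>)) + e D"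
        using Cr(2) D0 M0 by (intro add_right_mono mult_left_mono) auto
      finally have "real D * z \<le> real D * (M * (Cr * real D powr (-2 + \<eta>)) + e D)" by (rule mult_left_mono) simp
      also have "\<dots> = Cr * (M * (real D * real D powr (-2 + \<eta>))) + Ca * Q * (real D * real D powr (-3/2))"
        by (simp add: e_def algebra_simps)
      also have "real D * real D powr (-2 + \<eta>) = real D powr (-1 + \<eta>)"
        using D0 powr_add[of "real D" 1 "-2 + \<eta>"] by simp
      also have "real D * real D powr (-3/2) = real D powr (-1/2)"
        using D0 powr_add[of "real D" 1 "-3/2"] by simp
      also have "Cr * (M * real D powr (-1 + \<eta>)) + Ca * Q * real D powr (-1/2) \<le> Cr * (2 * (?T * P)) + Ca * P * 1"
      proof (rule add_mono)
        have "real D powr (-1/2) \<le> 1" using D0 powr_mono2'[of "-1/2" 1 "real D"] by simp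
        then show "Ca * Q * real D powr (-1/2) \<le> Ca * P * 1" using Ca QP P0 Q0 by (intro mult_mono) auto
        \<comment> \<open>\<open>D\<close> is at least half of \<open>Suc D\<close>. The passage is
          needed because \<open>D\<close> is a floor and \<open>X\<close> is formed with
          \<open>Suc D\<close>.\<close>
        have "real D powr (-1 + \<eta>) \<le> (real (Suc D) / 2) powr (-1 + \<eta>)"
          using D(3) \<eta> by (intro powr_mono2') auto
        also have "\<dots> = real (Suc D) powr (-1 + \<eta>) / 2 powr (-1 + \<eta>)" by (rule powr_divide)
        also have "\<dots> = real (Suc D) powr (-1 + \<eta>) * 2 powr (1 - \<eta>)"
          using powr_minus_divide[of 2 "1 - \<eta>"] by (simp add: field_simps)
        also have "\<dots> \<le> X * 2"
        proof (intro mult_mono)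
          show "real (Suc D) powr (-1 + \<eta>) \<le> X" unfolding X_def using \<eta> by (intro powr_mono) auto
          have "(2::real) powr (1 - \<eta>) \<le> 2 powr 1" using \<eta> by (intro powr_mono) auto
          then show "(2::real) powr (1 - \<eta>) \<le> 2" by simp
        qed (use X0 in auto)
        finally have "M * real D powr (-1 + \<eta>) \<le> M * (X * 2)" using M0 by (intro mult_left_mono) auto
        then have "M * real D powr (-1 + \<eta>) \<le> 2 * (?T * P)" using MX by simp
        then show "Cr * (M * real D powr (-1 + \<eta>)) \<le> Cr * (2 * (?T * P))" using Cr by (intro mult_left_mono) auto
      qed
      finally show ?thesis by (simp add: algebra_simps)
    qed
    have pw: "summable (\<lambda>d. real d powr (-2 + \<eta>))" using \<eta> by (simp add: summable_real_powr_iff)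
    have "\<bar>real (sqfree_det_count H TYPE('n)) - M * singular_series ?n\<bar>
       \<le> (\<Sum>d=1..D. e d + z) + (\<Sum>d. Ct * M * real (d + Suc D) powr (-2 + \<eta>)) + M * (\<Sum>d. resdens TYPE('n) ((d + Suc D) ^ 2))"
      unfolding M_def
    proof (rule square_sieve[where t = "\<lambda>d. Ct * real (card (mats (\<lambda>(_::'n) (_::'n). {-H..H}))) * real d powr (-2 + \<eta>)"])
      fix d :: nat assume d: "1 \<le> d" "d \<le> D"
      show "\<bar>det_count TYPE('n) H (d ^ 2) - det_count_zero TYPE('n) H - real (card (mats (\<lambda>(_::'n) (_::'n). {-H..H}))) * resdens TYPE('n) (d ^ 2)\<bar> \<le> e d + z"
        using e[OF d] z0 unfolding M_def z_def by linarith
    next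
      fix d :: nat assume "D < d"
      then show "det_count_nonzero TYPE('n) H (d ^ 2) \<le> Ct * real (card (mats (\<lambda>(_::'n) (_::'n). {-H..H}))) * real d powr (-2 + \<eta>)"
        using Ct(2) H by auto
    qed (rule summable_mult[OF pw], rule summable_resdens_square)
    also have "(\<Sum>d=1..D. e d + z) \<le> Ca * Cs * P + (?T * Cr * 2 + Ca) * P"
    proof -
      have "(\<Sum>d=1..D. e d) = Ca * Q * (\<Sum>d=1..D. real d powr (-3/2))" by (simp add: e_def sum_distrib_left)
      also have "\<dots> \<le> Ca * P * Cs"
      proof (intro mult_mono)
        show "(\<Sum>d=1..D. real d powr (-3/2)) \<le> Cs" unfolding Cs_def by (rule sum_le_suminf[OF s32]) auto
      qed (use Ca QP P0 Q0 in \<open>auto intro: sum_nonneg\<close>)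
      finally show ?thesis using zD by (simp add: sum.distrib mult_ac)
    qed
    also have "(\<Sum>d. Ct * M * real (d + Suc D) powr (-2 + \<eta>)) \<le> Ct * ?T * Cp * P"
    proof -
      have "(\<Sum>d. Ct * M * real (d + Suc D) powr (-2 + \<eta>)) = Ct * M * (\<Sum>d. real (d + Suc D) powr (-2 + \<eta>))"
        by (rule suminf_mult[OF Cp(2)])
      also have "\<dots> \<le> Ct * M * (Cp * X)"
        unfolding X_def using Ct M0 by (intro mult_left_mono Cp(3)) auto
      also have "\<dots> = Ct * Cp * (M * X)" by simp
      also have "\<dots> \<le> Ct * Cp * (?T * P)" using Ct Cp by (intro mult_left_mono MX) auto
      finally show ?thesis by (simp add: mult_ac)
    qed
    also have "M * (\<Sum>d. resdens TYPE('n) ((d + Suc D) ^ 2)) \<le> ?T * Cr * Cp * P"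
    proof -
      have "(\<Sum>d. resdens TYPE('n) ((d + Suc D) ^ 2)) \<le> (\<Sum>d. Cr * real (d + Suc D) powr (-2 + \<eta>))"
      proof (rule suminf_le)
        show "resdens TYPE('n) ((d + Suc D) ^ 2) \<le> Cr * real (d + Suc D) powr (-2 + \<eta>)" for d
          using Cr(2)[rule_format, of "d + Suc D"] by (simp only: zero_less_Suc add_Suc_right)
        show "summable (\<lambda>d. resdens TYPE('n) ((d + Suc D) ^ 2))"
          using summable_resdens_square[where 'n = 'n] by (subst summable_iff_shift[where f = "\<lambda>d. resdens TYPE('n) (d ^ 2)"])
        show "summable (\<lambda>d. Cr * real (d + Suc D) powr (-2 + \<eta>))" by (rule summable_mult[OF Cp(2)])
      qed
      also have "\<dots> = Cr * (\<Sum>d. real (d + Suc D) powr (-2 + \<eta>))" by (rule suminf_mult[OF Cp(2)])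
      also have "\<dots> \<le> Cr * (Cp * X)" unfolding X_def using Cr by (intro mult_left_mono Cp(3)) auto
      finally have "M * (\<Sum>d. resdens TYPE('n) ((d + Suc D) ^ 2)) \<le> M * (Cr * (Cp * X))" using M0 by (rule mult_left_mono)
      also have "\<dots> = Cr * Cp * (M * X)" by simp
      also have "\<dots> \<le> Cr * Cp * (?T * P)" using Cr Cp by (intro mult_left_mono MX) auto
      finally show ?thesis by (simp add: mult_ac)
    qed
    finally show ?thesis unfolding M_def[symmetric] P_def C_def \<gamma>_def h_def by (simp add: algebra_simps)
  qed
  ultimately show ?thesis by blast
qed

theorem theorem1p1:
  "\<exists>C::real. \<forall>H::int. H \<ge> 1 \<longrightarrow>
     \<bar>real (sqfree_det_count H TYPE('n::finite))
        - 2 ^ (CARD('n)^2) * singular_series CARD('n) * real_of_int H ^ (CARD('n)^2)\<bar>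
     \<le> C * real_of_int H powr (real (CARD('n)^2) - gamma_exp CARD('n))"
proof -
  let ?n = "CARD('n)" and ?S = "singular_series CARD('n)"
  have n1: "?n \<ge> 1" by (simp add: Suc_le_eq)
  have \<gamma>: "gamma_exp ?n \<le> 1" using gamma_exp_le[OF n1] by simp
  have "\<exists>C\<ge>0. \<forall>H\<ge>1.
     \<bar>real (sqfree_det_count H TYPE('n)) - real (card (mats (\<lambda>(_::'n) (_::'n). {-H..H}))) * ?S\<bar>
     \<le> C * real_of_int H powr (real (?n ^ 2) - gamma_exp ?n)"
  proof (cases "?n = 1")
    case True
    show ?thesis using sieve_bound_one_dim[OF True] by (intro exI[of _ 9]) auto
  next
    case False
    then have "?n \<ge> 2" using n1 by linarith
    then show ?thesis by (rule sieve_bound)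
  qed
  then obtain C where C: "\<forall>H\<ge>1.
     \<bar>real (sqfree_det_count H TYPE('n)) - real (card (mats (\<lambda>(_::'n) (_::'n). {-H..H}))) * ?S\<bar>
     \<le> C * real_of_int H powr (real (?n ^ 2) - gamma_exp ?n)" by blast
  show ?thesis
  proof (intro exI[of _ "C + \<bar>?S\<bar> * (real (?n ^ 2) * 3 ^ (?n ^ 2))"] allI impI)
    fix H :: int assume H: "H \<ge> 1"
    let ?h = "real_of_int H" and ?V = "real (card (mats (\<lambda>(_::'n) (_::'n). {-H..H})))"
    let ?P = "?h powr (real (?n ^ 2) - gamma_exp ?n)"
    have V: "?V = (2 * ?h + 1) ^ (?n ^ 2)" using card_mats_interval[of H, where 'n = 'n] H by simp
    \<comment> \<open>An entry has 2 * H + 1 values rather than 2 * H; the difference of the volumes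
      is O(H powr (n^2 - 1)), which is admissible as \<open>gamma_exp\<close> is at most 1.\<close>
    have "\<bar>?V - (2 * ?h) ^ (?n ^ 2)\<bar> \<le> real (?n ^ 2) * 3 ^ (?n ^ 2) * ?P"
      unfolding V using H \<gamma> n1 by (intro box_volume_diff) auto
    then have "\<bar>?S\<bar> * \<bar>?V - (2 * ?h) ^ (?n ^ 2)\<bar> \<le> \<bar>?S\<bar> * (real (?n ^ 2) * 3 ^ (?n ^ 2) * ?P)"
      by (intro mult_left_mono) auto
    then have "\<bar>?V * ?S - 2 ^ (?n ^ 2) * ?S * ?h ^ (?n ^ 2)\<bar> \<le> \<bar>?S\<bar> * (real (?n ^ 2) * 3 ^ (?n ^ 2)) * ?P"
      by (simp add: abs_mult[symmetric] power_mult_distrib algebra_simps)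
    moreover have "\<bar>real (sqfree_det_count H TYPE('n)) - ?V * ?S\<bar> \<le> C * ?P" using C H by blast
    ultimately show "\<bar>real (sqfree_det_count H TYPE('n)) - 2 ^ (?n ^ 2) * ?S * ?h ^ (?n ^ 2)\<bar>
       \<le> (C + \<bar>?S\<bar> * (real (?n ^ 2) * 3 ^ (?n ^ 2))) * ?P"
      unfolding distrib_right by linarith
  qed
qed

end
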